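(* Let $(R,\mathfrak m)$ be a commutative noetherian local ring, $I$ an ideal of $R$, $\mathcal P$ the class of all $I$-generated $R$-modules and $\mathcal S$ the class of all $I^\circ$-cogenerated $R$-modules. Then $(\mathcal S,\mathcal P)$ is a dual pair, that is: for all $R$-modules $N$ and $M$, $$N\in\mathcal S\iff N^\circ\in\mathcal P,\qquad M\in\mathcal P\iff M^\circ\in\mathcal S,$$ and both $\mathcal S$ and $\mathcal P$ are closed under direct summands and arbitrary direct products.
   Context: $E$ is the injective hull of the residue field $R/\mathfrak m$, and $M^\circ=\operatorname{Hom}_R(M,E)$ is the Matlis dual of an $R$-module $M$; in particular $I^\circ=\operatorname{Hom}_R(I,E)$. An $R$-module $M$ is $I$-generated if there is an epimorphism $I^{(\Lambda)}\twoheadrightarrow M$ for some index set $\Lambda$ (direct sum of copies of $I$). An $R$-module $N$ is $I^\circ$-cogenerated if there is a monomorphism $N\hookrightarrow (I^\circ)^\Lambda$ for some index set $\Lambda$ (direct product of copies of $I^\circ$). *)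

theory Defs
  imports "HOL-Algebra.Module" "HOL-Algebra.QuotRing" "HOL-Algebra.Ring_Divisibility"
begin

text \<open>
  The record type of modules extends that of rings, so every module constructed below carries two
  multiplicative fields that the locale \<^locale>\<open>module\<close> ignores; they are set to
  \<^const>\<open>undefined\<close> unless a natural value is at hand.
\<close>

definition local_ring :: "('r, 's) ring_scheme \<Rightarrow> 'r set \<Rightarrow> bool"
  where "local_ring R m \<longleftrightarrow> cring R \<and> maximalideal m R \<and> (\<forall>J. maximalideal J R \<longrightarrow> J = m)"


subsection \<open>Homomorphisms\<close>

definition mod_hom ::
  "('r, 's) ring_scheme \<Rightarrow> ('r, 'm) module \<Rightarrow> ('r, 'n) module \<Rightarrow> ('m \<Rightarrow> 'n) set"
  where "mod_hom R M N =
    {f \<in> carrier M \<rightarrow> carrier N.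
      (\<forall>x \<in> carrier M. \<forall>y \<in> carrier M. f (x \<oplus>\<^bsub>M\<^esub> y) = f x \<oplus>\<^bsub>N\<^esub> f y) \<and>
      (\<forall>a \<in> carrier R. \<forall>x \<in> carrier M. f (a \<odot>\<^bsub>M\<^esub> x) = a \<odot>\<^bsub>N\<^esub> f x)}"

definition mod_mono ::
  "('r, 's) ring_scheme \<Rightarrow> ('r, 'm) module \<Rightarrow> ('r, 'n) module \<Rightarrow> ('m \<Rightarrow> 'n) set"
  where "mod_mono R M N = {f \<in> mod_hom R M N. inj_on f (carrier M)}"

definition mod_epi ::
  "('r, 's) ring_scheme \<Rightarrow> ('r, 'm) module \<Rightarrow> ('r, 'n) module \<Rightarrow> ('m \<Rightarrow> 'n) set"
  where "mod_epi R M N = {f \<in> mod_hom R M N. f ` carrier M = carrier N}"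

definition mod_iso ::
  "('r, 's) ring_scheme \<Rightarrow> ('r, 'm) module \<Rightarrow> ('r, 'n) module \<Rightarrow> ('m \<Rightarrow> 'n) set"
  where "mod_iso R M N = {f \<in> mod_hom R M N. bij_betw f (carrier M) (carrier N)}"


subsection \<open>Constructions of modules\<close>

definition ideal_module :: "('r, 's) ring_scheme \<Rightarrow> 'r set \<Rightarrow> ('r, 'r) module"
  where "ideal_module R I =
    \<lparr>carrier = I, monoid.mult = mult R, one = one R, zero = zero R, add = add R, smult = mult R\<rparr>"

definition quotient_module :: "('r, 's) ring_scheme \<Rightarrow> 'r set \<Rightarrow> ('r, 'r set) module"
  where "quotient_module R J =
    \<lparr>carrier = carrier (R Quot J), monoid.mult = mult (R Quot J), one = one (R Quot J),
     zero = zero (R Quot J), add = add (R Quot J),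
     smult = (\<lambda>a X. (J +>\<^bsub>R\<^esub> a) \<otimes>\<^bsub>R Quot J\<^esub> X)\<rparr>"

text \<open>
  Elements are extensional functions, so that two of them are equal as soon as they agree on the
  carrier of the domain.
\<close>

definition hom_module ::
  "('r, 's) ring_scheme \<Rightarrow> ('r, 'm) module \<Rightarrow> ('r, 'n) module \<Rightarrow> ('r, 'm \<Rightarrow> 'n) module"
  where "hom_module R M N =
    \<lparr>carrier = mod_hom R M N \<inter> extensional (carrier M),
     monoid.mult = undefined, one = undefined,
     zero = (\<lambda>x \<in> carrier M. \<zero>\<^bsub>N\<^esub>),
     add = (\<lambda>f g. \<lambda>x \<in> carrier M. f x \<oplus>\<^bsub>N\<^esub> g x),
     smult = (\<lambda>a f. \<lambda>x \<in> carrier M. a \<odot>\<^bsub>N\<^esub> f x)\<rparr>"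

definition direct_product :: "'i set \<Rightarrow> ('i \<Rightarrow> ('r, 'm) module) \<Rightarrow> ('r, 'i \<Rightarrow> 'm) module"
  where "direct_product \<Lambda> M =
    \<lparr>carrier = (\<Pi>\<^sub>E i \<in> \<Lambda>. carrier (M i)),
     monoid.mult = undefined, one = undefined,
     zero = (\<lambda>i \<in> \<Lambda>. \<zero>\<^bsub>M i\<^esub>),
     add = (\<lambda>x y. \<lambda>i \<in> \<Lambda>. x i \<oplus>\<^bsub>M i\<^esub> y i),
     smult = (\<lambda>a x. \<lambda>i \<in> \<Lambda>. a \<odot>\<^bsub>M i\<^esub> x i)\<rparr>"

definition direct_sum :: "'i set \<Rightarrow> ('i \<Rightarrow> ('r, 'm) module) \<Rightarrow> ('r, 'i \<Rightarrow> 'm) module"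
  where "direct_sum \<Lambda> M = (direct_product \<Lambda> M)
    \<lparr>carrier := {x \<in> carrier (direct_product \<Lambda> M). finite {i \<in> \<Lambda>. x i \<noteq> \<zero>\<^bsub>M i\<^esub>}}\<rparr>"

definition binary_sum :: "('r, 'm) module \<Rightarrow> ('r, 'n) module \<Rightarrow> ('r, 'm \<times> 'n) module"
  where "binary_sum A B =
    \<lparr>carrier = carrier A \<times> carrier B,
     monoid.mult = undefined, one = undefined,
     zero = (\<zero>\<^bsub>A\<^esub>, \<zero>\<^bsub>B\<^esub>),
     add = (\<lambda>(a, b) (a', b'). (a \<oplus>\<^bsub>A\<^esub> a', b \<oplus>\<^bsub>B\<^esub> b')),
     smult = (\<lambda>r (a, b). (r \<odot>\<^bsub>A\<^esub> a, r \<odot>\<^bsub>B\<^esub> b))\<rparr>"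


subsection \<open>Injective hulls and Matlis duals\<close>

text \<open>
  HOL cannot quantify over the types in which the carriers of the test modules live. In
  \<open>injective_wrt\<close> that type is a parameter; \<open>injective_module\<close> takes the type of the ring itself,
  which by the lemma \<open>injective_module_universal\<close> below yields the lifting property for test
  modules of every type.
\<close>

definition injective_wrt :: "'x itself \<Rightarrow> ('r, 's) ring_scheme \<Rightarrow> ('r, 'e) module \<Rightarrow> bool"
  where "injective_wrt _ R E \<longleftrightarrow>
    (\<forall>(A :: ('r, 'x) module) (B :: ('r, 'x) module) i f.
      module R A \<and> module R B \<and> i \<in> mod_mono R A B \<and> f \<in> mod_hom R A E \<longrightarrow>
      (\<exists>g \<in> mod_hom R B E. \<forall>x \<in> carrier A. g (i x) = f x))"

definition injective_module :: "('r, 's) ring_scheme \<Rightarrow> ('r, 'e) module \<Rightarrow> bool"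
  where "injective_module R E \<longleftrightarrow> module R E \<and> injective_wrt TYPE('r) R E"

definition injective_hull ::
  "('r, 's) ring_scheme \<Rightarrow> ('r, 'k) module \<Rightarrow> ('r, 'e) module \<Rightarrow> bool"
  where "injective_hull R K E \<longleftrightarrow> injective_module R E \<and>
    (\<exists>i \<in> mod_mono R K E.
      \<forall>A. submodule A R E \<and> A \<inter> i ` carrier K = {\<zero>\<^bsub>E\<^esub>} \<longrightarrow> A = {\<zero>\<^bsub>E\<^esub>})"

abbreviation matlis_dual ::
  "('r, 's) ring_scheme \<Rightarrow> ('r, 'e) module \<Rightarrow> ('r, 'm) module \<Rightarrow> ('r, 'm \<Rightarrow> 'e) module"
  where "matlis_dual R E M \<equiv> hom_module R M E"


lemma mod_homD:
  assumes "f \<in> mod_hom R M N"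
  shows "x \<in> carrier M \<Longrightarrow> f x \<in> carrier N"
    and "x \<in> carrier M \<Longrightarrow> y \<in> carrier M \<Longrightarrow> f (x \<oplus>\<^bsub>M\<^esub> y) = f x \<oplus>\<^bsub>N\<^esub> f y"
    and "a \<in> carrier R \<Longrightarrow> x \<in> carrier M \<Longrightarrow> f (a \<odot>\<^bsub>M\<^esub> x) = a \<odot>\<^bsub>N\<^esub> f x"
  using assms unfolding mod_hom_def by auto

lemma mod_homI:
  assumes "\<And>x. x \<in> carrier M \<Longrightarrow> f x \<in> carrier N"
    and "\<And>x y. x \<in> carrier M \<Longrightarrow> y \<in> carrier M \<Longrightarrow> f (x \<oplus>\<^bsub>M\<^esub> y) = f x \<oplus>\<^bsub>N\<^esub> f y"
    and "\<And>a x. a \<in> carrier R \<Longrightarrow> x \<in> carrier M \<Longrightarrow> f (a \<odot>\<^bsub>M\<^esub> x) = a \<odot>\<^bsub>N\<^esub> f x"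
  shows "f \<in> mod_hom R M N"
  using assms unfolding mod_hom_def by auto

lemma mod_hom_zero:
  assumes "module R M" "module R N" "f \<in> mod_hom R M N"
  shows "f \<zero>\<^bsub>M\<^esub> = \<zero>\<^bsub>N\<^esub>"
proof -
  interpret M: module R M by fact
  interpret N: module R N by fact
  have "f (\<zero>\<^bsub>R\<^esub> \<odot>\<^bsub>M\<^esub> \<zero>\<^bsub>M\<^esub>) = \<zero>\<^bsub>R\<^esub> \<odot>\<^bsub>N\<^esub> f \<zero>\<^bsub>M\<^esub>"
    using mod_homD(3)[OF assms(3)] by blast
  then show ?thesis
    using mod_homD(1)[OF assms(3)] by simp
qed

lemma ideal_module_module:
  assumes "cring R" "ideal I R"
  shows "module R (ideal_module R I)"
proof -
  interpret cring R by fact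
  interpret I: ideal I R by fact
  have mem: "x \<in> carrier R" if "x \<in> I" for x using that I.Icarr by blast
  show ?thesis
  proof (rule moduleI)
    show "abelian_group (ideal_module R I)"
    proof (rule abelian_groupI)
      fix x assume "x \<in> carrier (ideal_module R I)"
      then show "\<exists>y\<in>carrier (ideal_module R I). y \<oplus>\<^bsub>ideal_module R I\<^esub> x = \<zero>\<^bsub>ideal_module R I\<^esub>"
        by (intro bexI[of _ "\<ominus>\<^bsub>R\<^esub> x"]) (auto simp: ideal_module_def mem l_neg)
    qed (auto simp: ideal_module_def mem a_ac)
  qed (auto simp: ideal_module_def mem assms(1) I.I_l_closed l_distr r_distr m_assoc)
qed

lemma quotient_module_module:
  assumes "cring R" "ideal J R"
  shows "module R (quotient_module R J)"
proof -
  interpret cring R by fact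
  interpret J: ideal J R by fact
  interpret Q: ring "R Quot J" by (rule J.quotient_is_ring)
  interpret h: ring_hom_ring R "R Quot J" "(+>\<^bsub>R\<^esub>) J" by (rule J.rcos_ring_hom_ring)
  show ?thesis
  proof (rule moduleI)
    show "abelian_group (quotient_module R J)"
    proof (rule abelian_groupI)
      fix x assume "x \<in> carrier (quotient_module R J)"
      then show "\<exists>y\<in>carrier (quotient_module R J).
          y \<oplus>\<^bsub>quotient_module R J\<^esub> x = \<zero>\<^bsub>quotient_module R J\<^esub>"
        by (intro bexI[of _ "\<ominus>\<^bsub>R Quot J\<^esub> x"]) (auto simp: quotient_module_def Q.l_neg)
    qed (auto simp: quotient_module_def Q.a_ac)
  qed (auto simp: quotient_module_def assms(1) Q.l_distr Q.r_distr Q.m_assoc)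
qed

lemma (in module) smult_minus_one_cancel:
  assumes "x \<in> carrier M"
  shows "x \<oplus>\<^bsub>M\<^esub> (\<ominus>\<^bsub>R\<^esub> \<one>\<^bsub>R\<^esub>) \<odot>\<^bsub>M\<^esub> x = \<zero>\<^bsub>M\<^esub>"
  using assms by (simp add: smult_l_minus M.r_neg)

text \<open>
  Graphs of partial homomorphisms from \<open>B\<close> to \<open>E\<close>, used for the Zorn argument in Baer's criterion.
\<close>

definition partial_graph ::
  "('r, 's) ring_scheme \<Rightarrow> ('r, 'm) module \<Rightarrow> ('r, 'e) module \<Rightarrow> ('m \<times> 'e) set \<Rightarrow> bool"
  where "partial_graph R B E G \<longleftrightarrow>
    G \<subseteq> carrier B \<times> carrier E \<and>
    (\<forall>x u y v. (x, u) \<in> G \<longrightarrow> (y, v) \<in> G \<longrightarrow> (x \<oplus>\<^bsub>B\<^esub> y, u \<oplus>\<^bsub>E\<^esub> v) \<in> G) \<and>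
    (\<forall>a x u. a \<in> carrier R \<longrightarrow> (x, u) \<in> G \<longrightarrow> (a \<odot>\<^bsub>B\<^esub> x, a \<odot>\<^bsub>E\<^esub> u) \<in> G) \<and>
    (\<forall>u. (\<zero>\<^bsub>B\<^esub>, u) \<in> G \<longrightarrow> u = \<zero>\<^bsub>E\<^esub>)"

lemma partial_graphD:
  assumes "partial_graph R B E G"
  shows "(x, u) \<in> G \<Longrightarrow> x \<in> carrier B"
    and "(x, u) \<in> G \<Longrightarrow> u \<in> carrier E"
    and "(x, u) \<in> G \<Longrightarrow> (y, v) \<in> G \<Longrightarrow> (x \<oplus>\<^bsub>B\<^esub> y, u \<oplus>\<^bsub>E\<^esub> v) \<in> G"
    and "a \<in> carrier R \<Longrightarrow> (x, u) \<in> G \<Longrightarrow> (a \<odot>\<^bsub>B\<^esub> x, a \<odot>\<^bsub>E\<^esub> u) \<in> G"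
    and "(\<zero>\<^bsub>B\<^esub>, u) \<in> G \<Longrightarrow> u = \<zero>\<^bsub>E\<^esub>"
  using assms unfolding partial_graph_def by blast+

lemma partial_graph_unique:
  assumes "module R B" "module R E" "partial_graph R B E G" "(x, u) \<in> G" "(x, v) \<in> G"
  shows "u = v"
proof -
  interpret B: module R B by fact
  interpret E: module R E by fact
  note G = partial_graphD[OF assms(3)]
  have c: "x \<in> carrier B" "u \<in> carrier E" "v \<in> carrier E" using G(1,2) assms(4,5) by blast+
  have n1: "\<ominus>\<^bsub>R\<^esub> \<one>\<^bsub>R\<^esub> \<in> carrier R" by simp
  have "(x \<oplus>\<^bsub>B\<^esub> (\<ominus>\<^bsub>R\<^esub> \<one>\<^bsub>R\<^esub>) \<odot>\<^bsub>B\<^esub> x, u \<oplus>\<^bsub>E\<^esub> (\<ominus>\<^bsub>R\<^esub> \<one>\<^bsub>R\<^esub>) \<odot>\<^bsub>E\<^esub> v) \<in> G"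
    using G(3)[OF assms(4) G(4)[OF n1 assms(5)]] .
  then have "u \<oplus>\<^bsub>E\<^esub> (\<ominus>\<^bsub>R\<^esub> \<one>\<^bsub>R\<^esub>) \<odot>\<^bsub>E\<^esub> v = \<zero>\<^bsub>E\<^esub>"
    using G(5) B.smult_minus_one_cancel[OF c(1)] by simp
  then have "u \<oplus>\<^bsub>E\<^esub> \<ominus>\<^bsub>E\<^esub> v = \<zero>\<^bsub>E\<^esub>" using c by (simp add: E.smult_l_minus)
  then show ?thesis using c
    by (metis E.M.a_inv_closed E.M.minus_equality E.M.minus_minus)
qed

lemma partial_graph_extend:
  fixes R :: "('r, 's) ring_scheme"
  assumes "injective_module R E" "module R B" "partial_graph R B E G" "G \<noteq> {}" "b \<in> carrier B"
  obtains G' where "partial_graph R B E G'" "G \<subseteq> G'" "b \<in> fst ` G'"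
proof -
  have "module R E" using assms(1) by (simp add: injective_module_def)
  then interpret R: cring R by (rule module.axioms(1))
  interpret B: module R B by fact
  interpret E: module R E by fact
  note G = partial_graphD[OF assms(3)]
  note uniq = partial_graph_unique[OF assms(2) \<open>module R E\<close> assms(3)]
  have zG: "(\<zero>\<^bsub>B\<^esub>, \<zero>\<^bsub>E\<^esub>) \<in> G"
  proof -
    obtain x u where xu: "(x, u) \<in> G" using assms(4) by auto
    have "(\<zero>\<^bsub>R\<^esub> \<odot>\<^bsub>B\<^esub> x, \<zero>\<^bsub>R\<^esub> \<odot>\<^bsub>E\<^esub> u) \<in> G" using G(4)[OF _ xu] by simp
    then show ?thesis using G(1,2)[OF xu] by simp
  qed
  define J where "J = {r \<in> carrier R. r \<odot>\<^bsub>B\<^esub> b \<in> fst ` G}"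
  have JE: "r \<in> carrier R" "\<exists>u. (r \<odot>\<^bsub>B\<^esub> b, u) \<in> G" if "r \<in> J" for r
    using that unfolding J_def by (simp, force)
  have J: "ideal J R"
  proof (rule idealI)
    show "ring R" by (rule R.ring_axioms)
    show "subgroup J (add_monoid R)"
    proof (rule R.add.subgroupI)
      show "J \<subseteq> carrier R" by (auto simp: J_def)
      have "\<zero>\<^bsub>R\<^esub> \<in> J" using zG assms(5) by (force simp: J_def)
      then show "J \<noteq> {}" by auto
    next
      fix a assume a: "a \<in> J"
      obtain u where u: "(a \<odot>\<^bsub>B\<^esub> b, u) \<in> G" and aR: "a \<in> carrier R" using JE[OF a] by auto
      have "((\<ominus>\<^bsub>R\<^esub> \<one>\<^bsub>R\<^esub>) \<odot>\<^bsub>B\<^esub> (a \<odot>\<^bsub>B\<^esub> b), (\<ominus>\<^bsub>R\<^esub> \<one>\<^bsub>R\<^esub>) \<odot>\<^bsub>E\<^esub> u) \<in> G"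
        using G(4)[OF _ u] by simp
      then have "((\<ominus>\<^bsub>R\<^esub> a) \<odot>\<^bsub>B\<^esub> b, (\<ominus>\<^bsub>R\<^esub> \<one>\<^bsub>R\<^esub>) \<odot>\<^bsub>E\<^esub> u) \<in> G"
        using aR assms(5) by (simp add: B.smult_l_minus)
      then show "\<ominus>\<^bsub>R\<^esub> a \<in> J" using aR by (force simp: J_def)
    next
      fix a c assume ac: "a \<in> J" "c \<in> J"
      obtain u v where u: "(a \<odot>\<^bsub>B\<^esub> b, u) \<in> G" "(c \<odot>\<^bsub>B\<^esub> b, v) \<in> G"
        and R: "a \<in> carrier R" "c \<in> carrier R"
        using JE[OF ac(1)] JE[OF ac(2)] by auto
      have "((a \<oplus>\<^bsub>R\<^esub> c) \<odot>\<^bsub>B\<^esub> b, u \<oplus>\<^bsub>E\<^esub> v) \<in> G"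
        using G(3)[OF u] R assms(5) by (simp add: B.smult_l_distr)
      then show "a \<oplus>\<^bsub>R\<^esub> c \<in> J" using R by (force simp: J_def)
    qed
    show l: "x \<otimes>\<^bsub>R\<^esub> a \<in> J" if "a \<in> J" "x \<in> carrier R" for a x
    proof -
      obtain u where u: "(a \<odot>\<^bsub>B\<^esub> b, u) \<in> G" and aR: "a \<in> carrier R"
        using JE[OF \<open>a \<in> J\<close>] by auto
      have "((x \<otimes>\<^bsub>R\<^esub> a) \<odot>\<^bsub>B\<^esub> b, x \<odot>\<^bsub>E\<^esub> u) \<in> G"
        using G(4)[OF that(2) u] that(2) aR assms(5) by (simp add: B.smult_assoc1)
      then show ?thesis using that(2) aR by (force simp: J_def)
    qed
    show "a \<otimes>\<^bsub>R\<^esub> x \<in> J" if "a \<in> J" "x \<in> carrier R" for a x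
      using l[OF that] that by (simp add: J_def R.m_comm)
  qed
  define f where "f r = (SOME u. (r \<odot>\<^bsub>B\<^esub> b, u) \<in> G)" for r
  have f: "(r \<odot>\<^bsub>B\<^esub> b, f r) \<in> G" if "r \<in> J" for r
  proof -
    obtain u where "(r \<odot>\<^bsub>B\<^esub> b, u) \<in> G" using JE(2)[OF \<open>r \<in> J\<close>] by blast
    then show ?thesis unfolding f_def by (rule someI)
  qed
  have JR: "r \<in> carrier R" if "r \<in> J" for r using that by (simp add: J_def)
  have Rid: "ideal (carrier R) R" by (rule R.oneideal)
  have fh: "f \<in> mod_hom R (ideal_module R J) E"
  proof (rule mod_homI)
    fix x assume "x \<in> carrier (ideal_module R J)"
    then show "f x \<in> carrier E" using G(2) f by (force simp: ideal_module_def)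
  next
    fix x y assume "x \<in> carrier (ideal_module R J)" "y \<in> carrier (ideal_module R J)"
    then have xy: "x \<in> J" "y \<in> J" by (auto simp: ideal_module_def)
    have s: "x \<oplus>\<^bsub>R\<^esub> y \<in> J" using xy J by (simp add: additive_subgroup.a_closed ideal.axioms(1))
    have "((x \<oplus>\<^bsub>R\<^esub> y) \<odot>\<^bsub>B\<^esub> b, f x \<oplus>\<^bsub>E\<^esub> f y) \<in> G"
      using G(3)[OF f[OF xy(1)] f[OF xy(2)]] xy JR assms(5) by (simp add: B.smult_l_distr)
    then show "f (x \<oplus>\<^bsub>ideal_module R J\<^esub> y) = f x \<oplus>\<^bsub>E\<^esub> f y"
      using uniq f[OF s] by (simp add: ideal_module_def)
  next
    fix a x assume a: "a \<in> carrier R" and "x \<in> carrier (ideal_module R J)"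
    then have x: "x \<in> J" by (auto simp: ideal_module_def)
    have s: "a \<otimes>\<^bsub>R\<^esub> x \<in> J" using x J a by (simp add: ideal.I_l_closed)
    have "((a \<otimes>\<^bsub>R\<^esub> x) \<odot>\<^bsub>B\<^esub> b, a \<odot>\<^bsub>E\<^esub> f x) \<in> G"
      using G(4)[OF a f[OF x]] x JR assms(5) a by (simp add: B.smult_assoc1)
    then show "f (a \<odot>\<^bsub>ideal_module R J\<^esub> x) = a \<odot>\<^bsub>E\<^esub> f x"
      using uniq f[OF s] by (simp add: ideal_module_def)
  qed
  have idm: "(\<lambda>x. x) \<in> mod_mono R (ideal_module R J) (ideal_module R (carrier R))"
    using JR by (auto simp: mod_mono_def mod_hom_def ideal_module_def)
  have "injective_wrt TYPE('r) R E" using assms(1) by (simp add: injective_module_def)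
  then have "\<exists>g \<in> mod_hom R (ideal_module R (carrier R)) E.
      \<forall>x \<in> carrier (ideal_module R J). g x = f x"
    using ideal_module_module[OF R.cring_axioms J] ideal_module_module[OF R.cring_axioms Rid] idm fh
    unfolding injective_wrt_def by blast
  then obtain g where g: "g \<in> mod_hom R (ideal_module R (carrier R)) E"
    and gf: "\<And>x. x \<in> J \<Longrightarrow> g x = f x"
    by (auto simp: ideal_module_def)
  have gc: "g x \<in> carrier E" if "x \<in> carrier R" for x
    using mod_homD(1)[OF g] that by (simp add: ideal_module_def)
  have ga: "g (x \<oplus>\<^bsub>R\<^esub> y) = g x \<oplus>\<^bsub>E\<^esub> g y" if "x \<in> carrier R" "y \<in> carrier R" for x y
    using mod_homD(2)[OF g] that by (simp add: ideal_module_def)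
  have gs: "g (a \<otimes>\<^bsub>R\<^esub> x) = a \<odot>\<^bsub>E\<^esub> g x" if "a \<in> carrier R" "x \<in> carrier R" for a x
    using mod_homD(3)[OF g] that by (simp add: ideal_module_def)
  define G' where "G' = {(x \<oplus>\<^bsub>B\<^esub> r \<odot>\<^bsub>B\<^esub> b, u \<oplus>\<^bsub>E\<^esub> g r) | x u r. (x, u) \<in> G \<and> r \<in> carrier R}"
  have G'I: "(x', u') \<in> G'"
    if "(x, u) \<in> G" "r \<in> carrier R" "x' = x \<oplus>\<^bsub>B\<^esub> r \<odot>\<^bsub>B\<^esub> b" "u' = u \<oplus>\<^bsub>E\<^esub> g r" for x u r x' u'
    using that unfolding G'_def by blast
  have G'E: "\<exists>x u r. (x, u) \<in> G \<and> r \<in> carrier R \<and> x' = x \<oplus>\<^bsub>B\<^esub> r \<odot>\<^bsub>B\<^esub> b \<and> u' = u \<oplus>\<^bsub>E\<^esub> g r"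
    if "(x', u') \<in> G'" for x' u' using that unfolding G'_def by blast
  have g0: "g \<zero>\<^bsub>R\<^esub> = \<zero>\<^bsub>E\<^esub>"
    using gs[of "\<zero>\<^bsub>R\<^esub>" "\<zero>\<^bsub>R\<^esub>"] gc[of "\<zero>\<^bsub>R\<^esub>"] by simp
  have "partial_graph R B E G'"
    unfolding partial_graph_def
  proof (intro conjI allI impI)
    show "G' \<subseteq> carrier B \<times> carrier E"
      using G(1,2) gc assms(5) unfolding G'_def by blast
  next
    fix x' u' y' v' assume "(x', u') \<in> G'" "(y', v') \<in> G'"
    then obtain x u r y v s where xu: "(x, u) \<in> G" and r: "r \<in> carrier R"
      and e1: "x' = x \<oplus>\<^bsub>B\<^esub> r \<odot>\<^bsub>B\<^esub> b" "u' = u \<oplus>\<^bsub>E\<^esub> g r"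
      and yv: "(y, v) \<in> G" and s: "s \<in> carrier R"
      and e2: "y' = y \<oplus>\<^bsub>B\<^esub> s \<odot>\<^bsub>B\<^esub> b" "v' = v \<oplus>\<^bsub>E\<^esub> g s" using G'E by meson
    note c = G(1,2)[OF xu] G(1,2)[OF yv]
    show "(x' \<oplus>\<^bsub>B\<^esub> y', u' \<oplus>\<^bsub>E\<^esub> v') \<in> G'"
      by (rule G'I[OF G(3)[OF xu yv], of "r \<oplus>\<^bsub>R\<^esub> s"])
        (use c r s e1 e2 assms(5) in \<open>simp_all add: B.smult_l_distr ga gc B.M.a_ac E.M.a_ac\<close>)
  next
    fix a x' u' assume a: "a \<in> carrier R" and "(x', u') \<in> G'"
    then obtain x u r where xu: "(x, u) \<in> G" and r: "r \<in> carrier R"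
      and e1: "x' = x \<oplus>\<^bsub>B\<^esub> r \<odot>\<^bsub>B\<^esub> b" "u' = u \<oplus>\<^bsub>E\<^esub> g r" using G'E by meson
    note c = G(1,2)[OF xu]
    show "(a \<odot>\<^bsub>B\<^esub> x', a \<odot>\<^bsub>E\<^esub> u') \<in> G'"
      by (rule G'I[OF G(4)[OF a xu], of "a \<otimes>\<^bsub>R\<^esub> r"])
        (use c r e1 a assms(5) in
          \<open>simp_all add: B.smult_r_distr E.smult_r_distr gs gc B.smult_assoc1\<close>)
  next
    fix u' assume "(\<zero>\<^bsub>B\<^esub>, u') \<in> G'"
    then obtain x u r where xu: "(x, u) \<in> G" and r: "r \<in> carrier R"
      and e1: "\<zero>\<^bsub>B\<^esub> = x \<oplus>\<^bsub>B\<^esub> r \<odot>\<^bsub>B\<^esub> b" "u' = u \<oplus>\<^bsub>E\<^esub> g r" using G'E by meson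
    note c = G(1,2)[OF xu]
    have "(\<ominus>\<^bsub>R\<^esub> \<one>\<^bsub>R\<^esub>) \<odot>\<^bsub>B\<^esub> x = r \<odot>\<^bsub>B\<^esub> b"
    proof -
      have "\<ominus>\<^bsub>B\<^esub> x = r \<odot>\<^bsub>B\<^esub> b"
        using e1(1) c r assms(5) by (metis B.M.a_comm B.M.minus_equality B.smult_closed)
      then show ?thesis using c by (simp add: B.smult_l_minus)
    qed
    then have *: "(r \<odot>\<^bsub>B\<^esub> b, (\<ominus>\<^bsub>R\<^esub> \<one>\<^bsub>R\<^esub>) \<odot>\<^bsub>E\<^esub> u) \<in> G"
      using G(4)[OF _ xu, of "\<ominus>\<^bsub>R\<^esub> \<one>\<^bsub>R\<^esub>"] by simp
    then have rJ: "r \<in> J" using r by (force simp: J_def)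
    have "g r = (\<ominus>\<^bsub>R\<^esub> \<one>\<^bsub>R\<^esub>) \<odot>\<^bsub>E\<^esub> u" using uniq[OF f[OF rJ] *] gf[OF rJ] by simp
    then show "u' = \<zero>\<^bsub>E\<^esub>" using e1(2) E.smult_minus_one_cancel c by simp
  qed
  moreover have "G \<subseteq> G'"
  proof
    fix p assume p: "p \<in> G"
    obtain x u where pe: "p = (x, u)" by force
    show "p \<in> G'" unfolding pe
      by (rule G'I[of x u "\<zero>\<^bsub>R\<^esub>"]) (use p pe G(1,2) assms(5) g0 in \<open>auto\<close>)
  qed
  moreover have "b \<in> fst ` G'"
  proof -
    have "(b, g \<one>\<^bsub>R\<^esub>) \<in> G'"
      by (rule G'I[OF zG, of "\<one>\<^bsub>R\<^esub>"]) (use assms(5) gc in auto)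
    then show ?thesis by force
  qed
  ultimately show thesis using that by blast
qed

text \<open>Baer's criterion: injectivity does not depend on the type of the test modules.\<close>

lemma injective_module_universal:
  fixes R :: "('r, 's) ring_scheme"
  assumes "injective_module R E"
  shows "injective_wrt TYPE('x) R E"
  unfolding injective_wrt_def
proof (intro allI impI, elim conjE)
  fix A B :: "('r, 'x) module" and i f
  assume A: "module R A" and B: "module R B"
    and i: "i \<in> mod_mono R A B" and f: "f \<in> mod_hom R A E"
  have E: "module R E" using assms by (simp add: injective_module_def)
  interpret A: module R A by fact
  interpret B: module R B by fact
  interpret E: module R E by fact
  have ih: "i \<in> mod_hom R A B" and inj: "inj_on i (carrier A)"
    using i by (auto simp: mod_mono_def)
  define G0 where "G0 = (\<lambda>x. (i x, f x)) ` carrier A"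
  have G0: "partial_graph R B E G0"
    unfolding partial_graph_def
  proof (intro conjI allI impI)
    show "G0 \<subseteq> carrier B \<times> carrier E"
      using mod_homD(1)[OF ih] mod_homD(1)[OF f] by (auto simp: G0_def)
  next
    fix x u y v assume "(x, u) \<in> G0" "(y, v) \<in> G0"
    then obtain p q where "p \<in> carrier A" "q \<in> carrier A" "x = i p" "u = f p" "y = i q" "v = f q"
      by (auto simp: G0_def)
    then show "(x \<oplus>\<^bsub>B\<^esub> y, u \<oplus>\<^bsub>E\<^esub> v) \<in> G0"
      using mod_homD(2)[OF ih] mod_homD(2)[OF f]
      by (auto simp: G0_def intro!: image_eqI[of _ _ "p \<oplus>\<^bsub>A\<^esub> q"])
  next
    fix a x u assume "a \<in> carrier R" "(x, u) \<in> G0"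
    moreover then obtain p where "p \<in> carrier A" "x = i p" "u = f p" by (auto simp: G0_def)
    ultimately show "(a \<odot>\<^bsub>B\<^esub> x, a \<odot>\<^bsub>E\<^esub> u) \<in> G0"
      using mod_homD(3)[OF ih] mod_homD(3)[OF f]
      by (auto simp: G0_def intro!: image_eqI[of _ _ "a \<odot>\<^bsub>A\<^esub> p"])
  next
    fix u assume "(\<zero>\<^bsub>B\<^esub>, u) \<in> G0"
    then obtain p where p: "p \<in> carrier A" "i p = \<zero>\<^bsub>B\<^esub>" "u = f p" by (auto simp: G0_def)
    have "p = \<zero>\<^bsub>A\<^esub>"
      using inj_onD[OF inj _ p(1) A.M.zero_closed] p(2) mod_hom_zero[OF A B ih] by simp
    then show "u = \<zero>\<^bsub>E\<^esub>" using p mod_hom_zero[OF A E f] by simp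
  qed
  define \<A> where "\<A> = {G. partial_graph R B E G \<and> G0 \<subseteq> G}"
  have "\<exists>M\<in>\<A>. \<forall>X\<in>\<A>. M \<subseteq> X \<longrightarrow> X = M"
  proof (rule subset_Zorn_nonempty)
    show "\<A> \<noteq> {}" using G0 by (auto simp: \<A>_def)
  next
    fix C assume ne: "C \<noteq> {}" and ch: "subset.chain \<A> C"
    have CA: "C \<subseteq> \<A>" using ch by (simp add: subset.chain_def)
    have pg: "partial_graph R B E X" if "X \<in> C" for X using that CA by (auto simp: \<A>_def)
    have two: "\<exists>X\<in>C. p \<in> X \<and> q \<in> X" if "p \<in> \<Union>C" "q \<in> \<Union>C" for p q
    proof -
      obtain X Y where "X \<in> C" "p \<in> X" "Y \<in> C" "q \<in> Y"
        using \<open>p \<in> \<Union>C\<close> \<open>q \<in> \<Union>C\<close> by blast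
      moreover then have "X \<subseteq> Y \<or> Y \<subseteq> X" using ch by (auto simp: subset_chain_def)
      ultimately show ?thesis by blast
    qed
    have "partial_graph R B E (\<Union>C)"
      unfolding partial_graph_def
    proof (intro conjI allI impI)
      show "\<Union>C \<subseteq> carrier B \<times> carrier E"
        by (rule Union_least) (use pg in \<open>simp add: partial_graph_def\<close>)
    next
      fix x u y v assume "(x, u) \<in> \<Union>C" "(y, v) \<in> \<Union>C"
      from two[OF this] obtain X where X: "X \<in> C" "(x, u) \<in> X" "(y, v) \<in> X" by auto
      then show "(x \<oplus>\<^bsub>B\<^esub> y, u \<oplus>\<^bsub>E\<^esub> v) \<in> \<Union>C"
        using partial_graphD(3)[OF pg[OF X(1)] X(2,3)] by (intro UnionI)
    next
      fix a x u assume a: "a \<in> carrier R" and "(x, u) \<in> \<Union>C"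
      then obtain X where X: "X \<in> C" "(x, u) \<in> X" by auto
      then show "(a \<odot>\<^bsub>B\<^esub> x, a \<odot>\<^bsub>E\<^esub> u) \<in> \<Union>C"
        using partial_graphD(4)[OF pg[OF X(1)] a X(2)] by (intro UnionI)
    next
      fix u assume "(\<zero>\<^bsub>B\<^esub>, u) \<in> \<Union>C"
      then obtain X where X: "X \<in> C" "(\<zero>\<^bsub>B\<^esub>, u) \<in> X" by auto
      then show "u = \<zero>\<^bsub>E\<^esub>" using partial_graphD(5)[OF pg[OF X(1)]] by simp
    qed
    moreover have "G0 \<subseteq> \<Union>C" using ne CA by (auto simp: \<A>_def)
    ultimately show "\<Union>C \<in> \<A>" by (simp add: \<A>_def)
  qed
  then obtain G where GA: "G \<in> \<A>" and maxA: "\<forall>X\<in>\<A>. G \<subseteq> X \<longrightarrow> X = G" by blast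
  have G: "partial_graph R B E G" and G0G: "G0 \<subseteq> G" using GA by (simp_all add: \<A>_def)
  have max: "X = G" if "partial_graph R B E X" "G \<subseteq> X" for X
    using maxA that G0G by (auto simp: \<A>_def)
  have "G \<noteq> {}" using G0G A.M.zero_closed by (auto simp: G0_def)
  have dom: "\<exists>u. (x, u) \<in> G" if "x \<in> carrier B" for x
  proof -
    obtain G' where "partial_graph R B E G'" "G \<subseteq> G'" "x \<in> fst ` G'"
      by (rule partial_graph_extend[OF assms B G \<open>G \<noteq> {}\<close> \<open>x \<in> carrier B\<close>])
    moreover then have "G' = G" using max by simp
    ultimately show ?thesis by auto
  qed
  define g where "g x = (SOME u. (x, u) \<in> G)" for x
  have g: "(x, g x) \<in> G" if "x \<in> carrier B" for x
    unfolding g_def using dom[OF that] by (rule someI_ex)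
  note GD = partial_graphD[OF G] and uniq = partial_graph_unique[OF B E G]
  have "g \<in> mod_hom R B E"
  proof (rule mod_homI)
    show "g x \<in> carrier E" if "x \<in> carrier B" for x using GD(2)[OF g[OF that]] .
    show "g (x \<oplus>\<^bsub>B\<^esub> y) = g x \<oplus>\<^bsub>E\<^esub> g y" if "x \<in> carrier B" "y \<in> carrier B" for x y
      using uniq[OF g GD(3)[OF g[OF that(1)] g[OF that(2)]]] that by simp
    show "g (a \<odot>\<^bsub>B\<^esub> x) = a \<odot>\<^bsub>E\<^esub> g x" if "a \<in> carrier R" "x \<in> carrier B" for a x
      using uniq[OF g GD(4)[OF that(1) g[OF that(2)]]] that by simp
  qed
  moreover have "g (i x) = f x" if "x \<in> carrier A" for x
  proof -
    have "(i x, f x) \<in> G" using that G0G by (auto simp: G0_def)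
    then show ?thesis using uniq[OF g[OF mod_homD(1)[OF ih that]]] by simp
  qed
  ultimately show "\<exists>g\<in>mod_hom R B E. \<forall>x\<in>carrier A. g (i x) = f x" by (intro bexI ballI)
qed


subsection \<open>Generated and cogenerated modules\<close>

text \<open>
  The index set ranges over the subsets of a fixed type, large enough to contain all homomorphisms
  from \<open>U\<close> to \<open>M\<close> (respectively from \<open>N\<close> to \<open>V\<close>). The lemmas \<open>generated_byI\<close> and
  \<open>cogenerated_byI\<close> below show that index sets of other types give nothing more.
\<close>

definition generated_by ::
  "('r, 's) ring_scheme \<Rightarrow> ('r, 'u) module \<Rightarrow> ('r, 'm) module \<Rightarrow> bool"
  where "generated_by R U M \<longleftrightarrow>
    (\<exists>(\<Lambda> :: ('u \<Rightarrow> 'm) set) f. f \<in> mod_epi R (direct_sum \<Lambda> (\<lambda>_. U)) M)"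

definition cogenerated_by ::
  "('r, 's) ring_scheme \<Rightarrow> ('r, 'v) module \<Rightarrow> ('r, 'n) module \<Rightarrow> bool"
  where "cogenerated_by R V N \<longleftrightarrow>
    (\<exists>(\<Lambda> :: ('n \<Rightarrow> 'v) set) f. f \<in> mod_mono R N (direct_product \<Lambda> (\<lambda>_. V)))"

lemma generated_byI:
  fixes \<Lambda> :: "'i set"
  assumes U: "module R U" and M: "module R M"
    and f: "f \<in> mod_epi R (direct_sum \<Lambda> (\<lambda>_. U)) M"
  shows "generated_by R U M"
proof -
  interpret U: module R U by fact
  interpret M: module R M by fact
  let ?S = "direct_sum \<Lambda> (\<lambda>_. U)"
  define single where "single i u = (\<lambda>j \<in> \<Lambda>. if j = i then u else \<zero>\<^bsub>U\<^esub>)" for i u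
  define h where "h i = (\<lambda>u \<in> carrier U. f (single i u))" for i
  define s where "s = inv_into \<Lambda> h"
  let ?T = "direct_sum (h ` \<Lambda>) (\<lambda>_. U)"
  define p where "p x = (\<lambda>i \<in> \<Lambda>. if s (h i) = i then x (h i) else \<zero>\<^bsub>U\<^esub>)" for x
  have fh: "f \<in> mod_hom R ?S M" and fs: "f ` carrier ?S = carrier M"
    using f by (auto simp: mod_epi_def)
  have sh: "s (h i) \<in> \<Lambda>" "h (s (h i)) = h i" if "i \<in> \<Lambda>" for i
    using that by (auto simp: s_def inv_into_into f_inv_into_f)
  have S: "x \<in> carrier ?S \<longleftrightarrow> x \<in> \<Lambda> \<rightarrow>\<^sub>E carrier U \<and> finite {i \<in> \<Lambda>. x i \<noteq> \<zero>\<^bsub>U\<^esub>}" for x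
    by (simp add: direct_sum_def direct_product_def)
  have T: "x \<in> carrier ?T \<longleftrightarrow>
      x \<in> h ` \<Lambda> \<rightarrow>\<^sub>E carrier U \<and> finite {k \<in> h ` \<Lambda>. x k \<noteq> \<zero>\<^bsub>U\<^esub>}" for x
    by (simp add: direct_sum_def direct_product_def)
  have Sadd: "add ?S x y = (\<lambda>i \<in> \<Lambda>. x i \<oplus>\<^bsub>U\<^esub> y i)" for x y
    by (simp add: direct_sum_def direct_product_def)
  have Tadd: "add ?T x y = (\<lambda>k \<in> h ` \<Lambda>. x k \<oplus>\<^bsub>U\<^esub> y k)" for x y
    by (simp add: direct_sum_def direct_product_def)
  have Ssm: "smult ?S a x = (\<lambda>i \<in> \<Lambda>. a \<odot>\<^bsub>U\<^esub> x i)" for a x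
    by (simp add: direct_sum_def direct_product_def)
  have Tsm: "smult ?T a x = (\<lambda>k \<in> h ` \<Lambda>. a \<odot>\<^bsub>U\<^esub> x k)" for a x
    by (simp add: direct_sum_def direct_product_def)
  have pS: "p x \<in> carrier ?S" if "x \<in> carrier ?T" for x
  proof -
    have "{i \<in> \<Lambda>. p x i \<noteq> \<zero>\<^bsub>U\<^esub>} \<subseteq> s ` {k \<in> h ` \<Lambda>. x k \<noteq> \<zero>\<^bsub>U\<^esub>}"
      by (auto simp: p_def split: if_splits) (metis (mono_tags, lifting) image_iff mem_Collect_eq)
    moreover have "finite {k \<in> h ` \<Lambda>. x k \<noteq> \<zero>\<^bsub>U\<^esub>}" using that T by blast
    ultimately have "finite {i \<in> \<Lambda>. p x i \<noteq> \<zero>\<^bsub>U\<^esub>}" by (meson finite_imageI finite_subset)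
    moreover have "p x \<in> \<Lambda> \<rightarrow>\<^sub>E carrier U" using that T by (auto simp: p_def)
    ultimately show ?thesis by (simp add: S)
  qed
  have hom: "f \<circ> p \<in> mod_hom R ?T M"
  proof (rule mod_homI)
    fix x assume "x \<in> carrier ?T"
    then show "(f \<circ> p) x \<in> carrier M" using mod_homD(1)[OF fh pS] by simp
  next
    fix x y assume xy: "x \<in> carrier ?T" "y \<in> carrier ?T"
    have "p (add ?T x y) = add ?S (p x) (p y)"
      unfolding Sadd Tadd by (rule ext) (use xy T in \<open>auto simp: p_def\<close>)
    then show "(f \<circ> p) (add ?T x y) = (f \<circ> p) x \<oplus>\<^bsub>M\<^esub> (f \<circ> p) y"
      using mod_homD(2)[OF fh pS[OF xy(1)] pS[OF xy(2)]] by simp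
  next
    fix a x assume a: "a \<in> carrier R" and x: "x \<in> carrier ?T"
    have "p (smult ?T a x) = smult ?S a (p x)"
      unfolding Ssm Tsm by (rule ext) (use a x T in \<open>auto simp: p_def\<close>)
    then show "(f \<circ> p) (smult ?T a x) = a \<odot>\<^bsub>M\<^esub> (f \<circ> p) x"
      using mod_homD(3)[OF fh a pS[OF x]] by simp
  qed
  have addT: "add ?T x y \<in> carrier ?T" if "x \<in> carrier ?T" "y \<in> carrier ?T" for x y
  proof -
    have "{k \<in> h ` \<Lambda>. add ?T x y k \<noteq> \<zero>\<^bsub>U\<^esub>}
        \<subseteq> {k \<in> h ` \<Lambda>. x k \<noteq> \<zero>\<^bsub>U\<^esub>} \<union> {k \<in> h ` \<Lambda>. y k \<noteq> \<zero>\<^bsub>U\<^esub>}"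
      by (auto simp: Tadd)
    moreover have "finite ({k \<in> h ` \<Lambda>. x k \<noteq> \<zero>\<^bsub>U\<^esub>} \<union> {k \<in> h ` \<Lambda>. y k \<noteq> \<zero>\<^bsub>U\<^esub>})"
      using that T by blast
    ultimately have "finite {k \<in> h ` \<Lambda>. add ?T x y k \<noteq> \<zero>\<^bsub>U\<^esub>}" by (rule finite_subset)
    moreover have "add ?T x y \<in> h ` \<Lambda> \<rightarrow>\<^sub>E carrier U" using that T by (auto simp: Tadd)
    ultimately show ?thesis using T by blast
  qed
  have single_im: "f (single i u) \<in> (f \<circ> p) ` carrier ?T" if "i \<in> \<Lambda>" "u \<in> carrier U" for i u
  proof -
    define x where "x = (\<lambda>k \<in> h ` \<Lambda>. if k = h i then u else \<zero>\<^bsub>U\<^esub>)"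
    have "{k \<in> h ` \<Lambda>. x k \<noteq> \<zero>\<^bsub>U\<^esub>} \<subseteq> {h i}" by (auto simp: x_def split: if_splits)
    then have "finite {k \<in> h ` \<Lambda>. x k \<noteq> \<zero>\<^bsub>U\<^esub>}" by (rule finite_subset) simp
    moreover have "x \<in> h ` \<Lambda> \<rightarrow>\<^sub>E carrier U" using that by (auto simp: x_def)
    ultimately have xT: "x \<in> carrier ?T" using T by blast
    have "p x = single (s (h i)) u"
    proof (rule ext)
      fix j
      have "s (h j) = j \<and> h j = h i \<longleftrightarrow> j = s (h i)" if "j \<in> \<Lambda>"
        using sh[OF \<open>i \<in> \<Lambda>\<close>] by auto
      then show "p x j = single (s (h i)) u j" by (auto simp: p_def x_def single_def)
    qed
    moreover have "f (single (s (h i)) u) = f (single i u)"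
      using sh[OF that(1)] that(2) unfolding h_def by (metis restrict_apply')
    ultimately show ?thesis using xT by (auto intro!: image_eqI[of _ _ x])
  qed
  have im: "f y \<in> (f \<circ> p) ` carrier ?T" if "y \<in> carrier ?S" "finite F" "{i \<in> \<Lambda>. y i \<noteq> \<zero>\<^bsub>U\<^esub>} = F" for y F
    using that(2,1,3)
  proof (induction F arbitrary: y rule: finite_induct)
    case empty
    have "p (\<lambda>k \<in> h ` \<Lambda>. \<zero>\<^bsub>U\<^esub>) = y"
      by (rule ext) (use empty S in \<open>force simp: p_def\<close>)
    moreover have "(\<lambda>k \<in> h ` \<Lambda>. \<zero>\<^bsub>U\<^esub>) \<in> carrier ?T" unfolding T by auto
    ultimately show ?case by (metis comp_apply imageI)
  next
    case (insert i F)
    have i: "i \<in> \<Lambda>" using insert.prems(2) by blast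
    have yU: "y j \<in> carrier U" if "j \<in> \<Lambda>" for j using insert.prems(1) that S by blast
    define z where "z = (\<lambda>j \<in> \<Lambda>. if j = i then \<zero>\<^bsub>U\<^esub> else y j)"
    have zF: "{j \<in> \<Lambda>. z j \<noteq> \<zero>\<^bsub>U\<^esub>} = F" using insert.prems(2) insert.hyps(2) by (auto simp: z_def)
    have zS: "z \<in> carrier ?S" unfolding S zF using insert.hyps(1) yU by (auto simp: z_def)
    have "{j \<in> \<Lambda>. single i (y i) j \<noteq> \<zero>\<^bsub>U\<^esub>} \<subseteq> {i}" by (auto simp: single_def split: if_splits)
    then have "finite {j \<in> \<Lambda>. single i (y i) j \<noteq> \<zero>\<^bsub>U\<^esub>}" by (rule finite_subset) simp
    then have sS: "single i (y i) \<in> carrier ?S" unfolding S using yU[OF i] by (auto simp: single_def)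
    have "y = add ?S z (single i (y i))"
      unfolding Sadd
    proof (rule ext)
      fix j
      show "y j = (\<lambda>j\<in>\<Lambda>. z j \<oplus>\<^bsub>U\<^esub> single i (y i) j) j"
        using yU insert.prems(1) S by (cases "j \<in> \<Lambda>") (auto simp: z_def single_def)
    qed
    then have "f y = f z \<oplus>\<^bsub>M\<^esub> f (single i (y i))" using mod_homD(2)[OF fh zS sS] by simp
    moreover obtain a where a: "a \<in> carrier ?T" "f z = (f \<circ> p) a"
      using insert.IH[OF zS zF] by blast
    moreover obtain b where b: "b \<in> carrier ?T" "f (single i (y i)) = (f \<circ> p) b"
      using single_im[OF i yU[OF i]] by blast
    ultimately have "f y = (f \<circ> p) (add ?T a b)" using mod_homD(2)[OF hom a(1) b(1)] by simp
    then show ?case using addT[OF a(1) b(1)] by blast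
  qed
  have "(f \<circ> p) ` carrier ?T = carrier M"
  proof
    show "(f \<circ> p) ` carrier ?T \<subseteq> carrier M" using mod_homD(1)[OF hom] by blast
    show "carrier M \<subseteq> (f \<circ> p) ` carrier ?T"
    proof
      fix v assume "v \<in> carrier M"
      then obtain y where "y \<in> carrier ?S" "v = f y" using fs by blast
      then show "v \<in> (f \<circ> p) ` carrier ?T" using im S by blast
    qed
  qed
  then have "f \<circ> p \<in> mod_epi R ?T M" using hom by (simp add: mod_epi_def)
  then show ?thesis unfolding generated_by_def by blast
qed

lemma cogenerated_byI:
  fixes \<Lambda> :: "'i set"
  assumes "f \<in> mod_mono R N (direct_product \<Lambda> (\<lambda>_. V))"
  shows "cogenerated_by R V N"
proof -
  have f: "f \<in> mod_hom R N (direct_product \<Lambda> (\<lambda>_. V))" and inj: "inj_on f (carrier N)"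
    using assms by (auto simp: mod_mono_def)
  define h where "h i = (\<lambda>x. f x i)" for i
  define g where "g x = (\<lambda>k \<in> h ` \<Lambda>. k x)" for x
  have fc: "f x \<in> \<Lambda> \<rightarrow>\<^sub>E carrier V" if "x \<in> carrier N" for x
    using mod_homD(1)[OF f that] by (simp add: direct_product_def)
  have "g \<in> mod_hom R N (direct_product (h ` \<Lambda>) (\<lambda>_. V))"
  proof (rule mod_homI)
    fix x assume "x \<in> carrier N"
    then show "g x \<in> carrier (direct_product (h ` \<Lambda>) (\<lambda>_. V))"
      using fc by (auto simp: direct_product_def g_def h_def)
  next
    fix x y assume "x \<in> carrier N" "y \<in> carrier N"
    then show "g (x \<oplus>\<^bsub>N\<^esub> y) = g x \<oplus>\<^bsub>direct_product (h ` \<Lambda>) (\<lambda>_. V)\<^esub> g y"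
      using mod_homD(2)[OF f] by (auto simp: direct_product_def g_def h_def fun_eq_iff)
  next
    fix a x assume "a \<in> carrier R" "x \<in> carrier N"
    then show "g (a \<odot>\<^bsub>N\<^esub> x) = a \<odot>\<^bsub>direct_product (h ` \<Lambda>) (\<lambda>_. V)\<^esub> g x"
      using mod_homD(3)[OF f] by (auto simp: direct_product_def g_def h_def fun_eq_iff)
  qed
  moreover have "inj_on g (carrier N)"
  proof (rule inj_onI)
    fix x y assume xy: "x \<in> carrier N" "y \<in> carrier N" and eq: "g x = g y"
    have "f x i = f y i" if "i \<in> \<Lambda>" for i
      using fun_cong[OF eq, of "h i"] that by (simp add: g_def h_def)
    then have "f x = f y" using fc[OF xy(1)] fc[OF xy(2)] by (intro PiE_ext) auto
    then show "x = y" using inj xy by (auto dest: inj_onD)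
  qed
  ultimately show ?thesis unfolding cogenerated_by_def mod_mono_def by blast
qed

text \<open>The class \<open>\<P>\<close> of \<open>I\<close>-generated and the class \<open>\<S>\<close> of \<open>I\<^sup>\<circ>\<close>-cogenerated modules.\<close>

definition I_generated :: "('r, 's) ring_scheme \<Rightarrow> 'r set \<Rightarrow> ('r, 'm) module \<Rightarrow> bool"
  where "I_generated R I M \<longleftrightarrow> generated_by R (ideal_module R I) M"

definition I_dual_cogenerated ::
  "('r, 's) ring_scheme \<Rightarrow> ('r, 'e) module \<Rightarrow> 'r set \<Rightarrow> ('r, 'n) module \<Rightarrow> bool"
  where "I_dual_cogenerated R E I N \<longleftrightarrow> cogenerated_by R (matlis_dual R E (ideal_module R I)) N"

end

theory Submission
  imports Defs
begin

text \<open>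
Write \<open>U\<close> for the ideal \<open>I\<close> as a module. Generation by \<open>U\<close> means that the trace of \<open>U\<close> in \<open>M\<close>,
the sum of the images of all homomorphisms \<open>U \<rightarrow> M\<close>, is all of \<open>M\<close>; cogeneration by \<open>U\<^sup>\<circ>\<close> means
that the homomorphisms \<open>N \<rightarrow> U\<^sup>\<circ>\<close> separate the points of \<open>N\<close>. A homomorphism \<open>N \<rightarrow> U\<^sup>\<circ>\<close> is the
same as a homomorphism \<open>U \<rightarrow> N\<^sup>\<circ>\<close>, and \<open>E\<close> is an injective cogenerator of the local ring
(\<open>hull_separates\<close>). Together these give the implications from generated to cogenerated
(\<open>dual_cogenerated_if_generated\<close>, \<open>cogenerated_if_dual_generated\<close>).

The converse implications would follow from the isomorphisms \<open>Hom(U, N\<^sup>\<circ>) = (U \<otimes> N)\<^sup>\<circ>\<close> and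
\<open>U \<otimes> M\<^sup>\<circ> = Hom(U, M)\<^sup>\<circ>\<close>, the second of which holds because \<open>U\<close> is finitely presented. Tensor
products are avoided by computing with a presentation: with generators \<open>a\<^sub>k\<close> (\<open>k \<in> K\<close>) and
relations \<open>r\<^sub>j\<close> (\<open>j \<in> J\<close>), the module \<open>U \<otimes> N\<close> is the cokernel of the relation matrix
\<open>N\<^sup>J \<rightarrow> N\<^sup>K\<close>, and \<open>Hom(U, M)\<close> is the kernel of its transpose \<open>M\<^sup>K \<rightarrow> M\<^sup>J\<close>.

\<^item> If \<open>a\<^sub>k \<otimes> y = 0\<close>, witnessed by the relation matrix, then every \<open>h : N \<rightarrow> U\<^sup>\<circ>\<close> satisfies
  \<open>h y a\<^sub>k = 0\<close> (\<open>tensor_relation_annihilates\<close>).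
\<^item> If \<open>\<phi> : M \<rightarrow> E\<close> kills \<open>f a\<^sub>k\<close> for all \<open>f : U \<rightarrow> M\<close>, then \<open>a\<^sub>k \<otimes> \<phi> = 0\<close> in \<open>U \<otimes> M\<^sup>\<circ>\<close>
  (\<open>tensor_vanishes_if_kills_images\<close>). So a functional that vanishes on the trace of \<open>U\<close> in \<open>M\<close> is killed
  by all homomorphisms \<open>M\<^sup>\<circ> \<rightarrow> U\<^sup>\<circ>\<close>; if these separate points, the trace is \<open>M\<close>
  (\<open>generated_if_dual_cogenerated\<close>).
\<^item> If \<open>N\<close> is cogenerated by \<open>U\<^sup>\<circ>\<close>, then \<open>y \<mapsto> (a\<^sub>k \<otimes> y)\<^sub>k\<close> embeds \<open>N\<close> into \<open>(U \<otimes> N)\<^sup>K\<close>; extending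
  \<open>\<phi> \<in> N\<^sup>\<circ>\<close> along this embedding writes \<open>\<phi>\<close> as a sum of values \<open>h\<^sub>k a\<^sub>k\<close> with \<open>h\<^sub>k : U \<rightarrow> N\<^sup>\<circ>\<close>
  (\<open>dual_generated_if_cogenerated\<close>).

Closure of the \<open>U\<close>-generated modules under products rests on finite generation: every element of
such a module is a sum of values \<open>h\<^sub>k a\<^sub>k\<close> indexed by the fixed finite set \<open>K\<close>, so these sums can be
formed coordinatewise (\<open>generated_iff_gens\<close>, \<open>generated_product\<close>). Finite presentation of ideals
comes from the noetherian hypothesis, applied to the ideal and then to the ideals of coordinates
of its syzygies (\<open>noetherian_ideal_presentation\<close>).
\<close>

section \<open>Homomorphisms, finite sums and function modules\<close>

lemma mod_hom_finsum:
  assumes "module R M" "module R N" "h \<in> mod_hom R M N" "f \<in> A \<rightarrow> carrier M"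
  shows "h (finsum M f A) = (\<Oplus>\<^bsub>N\<^esub>i\<in>A. h (f i))"
proof -
  interpret M: module R M by fact
  interpret N: module R N by fact
  note h = mod_homD[OF assms(3)]
  note h0 = mod_hom_zero[OF assms(1-3)]
  show ?thesis
    using assms(4)
  proof (induction A rule: infinite_finite_induct)
    case (insert x F)
    then have "(\<lambda>i. h (f i)) \<in> F \<rightarrow> carrier N" "f \<in> F \<rightarrow> carrier M" "f x \<in> carrier M"
      using h(1) by auto
    with insert show ?case by (simp add: h)
  qed (simp_all add: h0)
qed

lemma mod_hom_comp:
  assumes "f \<in> mod_hom R A B" "g \<in> mod_hom R B C"
  shows "(\<lambda>x. g (f x)) \<in> mod_hom R A C"
  by (rule mod_homI) (simp_all add: mod_homD[OF assms(1)] mod_homD[OF assms(2)])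

lemma (in abelian_monoid) finsum_swap:
  assumes "finite A" "finite B" "\<And>x y. x \<in> A \<Longrightarrow> y \<in> B \<Longrightarrow> f x y \<in> carrier G"
  shows "(\<Oplus>x\<in>A. \<Oplus>y\<in>B. f x y) = (\<Oplus>y\<in>B. \<Oplus>x\<in>A. f x y)"
  using assms(1,3)
proof (induction A rule: finite_induct)
  case (insert a A)
  have *: "f a \<in> B \<rightarrow> carrier G" "(\<lambda>x. \<Oplus>y\<in>B. f x y) \<in> A \<rightarrow> carrier G"
    "(\<lambda>y. \<Oplus>x\<in>A. f x y) \<in> B \<rightarrow> carrier G"
    using insert.prems by (auto intro!: finsum_closed)
  have "(\<Oplus>y\<in>B. \<Oplus>x\<in>insert a A. f x y) = (\<Oplus>y\<in>B. f a y \<oplus> (\<Oplus>x\<in>A. f x y))"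
    using insert by (intro finsum_cong') (auto intro!: finsum_closed simp: Pi_def)
  also have "\<dots> = (\<Oplus>y\<in>B. f a y) \<oplus> (\<Oplus>y\<in>B. \<Oplus>x\<in>A. f x y)"
    using * by (intro finsum_addf)
  also have "(\<Oplus>y\<in>B. \<Oplus>x\<in>A. f x y) = (\<Oplus>x\<in>A. \<Oplus>y\<in>B. f x y)"
    using insert by auto
  finally show ?case using insert.hyps * insert.prems by (simp add: finsum_closed)
qed simp

lemma (in abelian_monoid) finsum_delta:
  assumes "finite A" "i \<in> A" "x \<in> carrier G"
  shows "(\<Oplus>j\<in>A. if j = i then x else \<zero>) = x"
  using add.finprod_singleton_swap[OF assms(2,1), of "\<lambda>_. x"] assms(3) by auto

lemma direct_product_module:
  assumes "cring R" "\<And>i. i \<in> \<Lambda> \<Longrightarrow> module R (M i)"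
  shows "module R (direct_product \<Lambda> M)"
proof -
  interpret cring R by fact
  let ?P = "direct_product \<Lambda> M"
  have c: "i \<in> \<Lambda> \<Longrightarrow> x \<in> carrier ?P \<Longrightarrow> x i \<in> carrier (M i)" for i x
    by (auto simp: direct_product_def)
  have ab: "abelian_group (M i)" if "i \<in> \<Lambda>" for i
    using assms(2)[OF that] by (rule module.axioms(2))
  note am = abelian_group.axioms(1)[OF ab]
  have eqI: "x = y" if "x \<in> carrier ?P" "y \<in> carrier ?P" "\<And>i. i \<in> \<Lambda> \<Longrightarrow> x i = y i" for x y
    using that by (auto simp: direct_product_def intro: PiE_ext)
  have addc: "x \<oplus>\<^bsub>?P\<^esub> y \<in> carrier ?P" if "x \<in> carrier ?P" "y \<in> carrier ?P" for x y
    using that by (auto simp: direct_product_def intro!: abelian_monoid.a_closed[OF am])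
  have zc: "\<zero>\<^bsub>?P\<^esub> \<in> carrier ?P"
    by (auto simp: direct_product_def intro!: abelian_monoid.zero_closed[OF am])
  have smc: "a \<odot>\<^bsub>?P\<^esub> x \<in> carrier ?P" if "a \<in> carrier R" "x \<in> carrier ?P" for a x
    using that by (auto simp: direct_product_def intro!: module.smult_closed[OF assms(2)])
  have ev: "(x \<oplus>\<^bsub>?P\<^esub> y) i = x i \<oplus>\<^bsub>M i\<^esub> y i" "\<zero>\<^bsub>?P\<^esub> i = \<zero>\<^bsub>M i\<^esub>" "(a \<odot>\<^bsub>?P\<^esub> x) i = a \<odot>\<^bsub>M i\<^esub> x i"
    if "i \<in> \<Lambda>" for i x y a using that by (auto simp: direct_product_def)
  show ?thesis
  proof (rule moduleI)
    show "abelian_group ?P"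
    proof (rule abelian_groupI)
      fix x assume x: "x \<in> carrier ?P"
      have y: "(\<lambda>i\<in>\<Lambda>. \<ominus>\<^bsub>M i\<^esub> x i) \<in> carrier ?P" using x
        by (auto simp: direct_product_def intro!: abelian_group.a_inv_closed[OF ab])
      moreover have "(\<lambda>i\<in>\<Lambda>. \<ominus>\<^bsub>M i\<^esub> x i) \<oplus>\<^bsub>?P\<^esub> x = \<zero>\<^bsub>?P\<^esub>"
        by (rule eqI) (use x y addc zc in \<open>auto simp: ev c abelian_group.l_neg[OF ab]\<close>)
      ultimately show "\<exists>y\<in>carrier ?P. y \<oplus>\<^bsub>?P\<^esub> x = \<zero>\<^bsub>?P\<^esub>" by blast
    qed (auto intro!: eqI addc zc simp: ev c abelian_monoid.a_assoc[OF am]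
        abelian_monoid.a_comm[OF am] abelian_monoid.l_zero[OF am])
  qed (auto intro!: eqI addc smc assms(1) simp: ev c module.smult_l_distr[OF assms(2)]
        module.smult_r_distr[OF assms(2)] module.smult_assoc1[OF assms(2)]
        module.smult_one[OF assms(2)])
qed

lemma proj_hom: "i \<in> \<Lambda> \<Longrightarrow> (\<lambda>x. x i) \<in> mod_hom R (direct_product \<Lambda> M) (M i)"
  by (auto simp: mod_hom_def direct_product_def)

lemma (in module) smult_left_commute:
  assumes "a \<in> carrier R" "b \<in> carrier R" "x \<in> carrier M"
  shows "a \<odot>\<^bsub>M\<^esub> (b \<odot>\<^bsub>M\<^esub> x) = b \<odot>\<^bsub>M\<^esub> (a \<odot>\<^bsub>M\<^esub> x)"
  using assms by (metis R.m_comm smult_assoc1)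

lemma hom_module_module:
  assumes "module R M" "module R N"
  shows "module R (hom_module R M N)"
proof -
  interpret M: module R M by fact
  interpret N: module R N by fact
  let ?P = "hom_module R M N"
  note defs = hom_module_def mod_hom_def
  have eqI: "x = y" if "x \<in> carrier ?P" "y \<in> carrier ?P" "\<And>i. i \<in> carrier M \<Longrightarrow> x i = y i" for x y
    using that by (auto simp: hom_module_def intro: extensionalityI)
  have c: "f x \<in> carrier N" if "f \<in> carrier ?P" "x \<in> carrier M" for f x
    using that by (auto simp: defs)
  have addc: "x \<oplus>\<^bsub>?P\<^esub> y \<in> carrier ?P" if "x \<in> carrier ?P" "y \<in> carrier ?P" for x y
    using that by (auto simp: defs N.M.a_ac N.smult_r_distr Pi_def)
  have zc: "\<zero>\<^bsub>?P\<^esub> \<in> carrier ?P" by (auto simp: defs)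
  have smc: "a \<odot>\<^bsub>?P\<^esub> x \<in> carrier ?P" if "a \<in> carrier R" "x \<in> carrier ?P" for a x
    using that by (auto simp: defs N.smult_r_distr Pi_def N.smult_left_commute)
  have ev: "(x \<oplus>\<^bsub>?P\<^esub> y) i = x i \<oplus>\<^bsub>N\<^esub> y i" "\<zero>\<^bsub>?P\<^esub> i = \<zero>\<^bsub>N\<^esub>" "(a \<odot>\<^bsub>?P\<^esub> x) i = a \<odot>\<^bsub>N\<^esub> x i"
    if "i \<in> carrier M" for i x y a using that by (auto simp: hom_module_def)
  show ?thesis
  proof (rule moduleI)
    show "abelian_group ?P"
    proof (rule abelian_groupI)
      fix x assume x: "x \<in> carrier ?P"
      have y: "(\<ominus>\<^bsub>R\<^esub> \<one>\<^bsub>R\<^esub>) \<odot>\<^bsub>?P\<^esub> x \<in> carrier ?P" using x by (intro smc) auto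
      moreover have "(\<ominus>\<^bsub>R\<^esub> \<one>\<^bsub>R\<^esub>) \<odot>\<^bsub>?P\<^esub> x \<oplus>\<^bsub>?P\<^esub> x = \<zero>\<^bsub>?P\<^esub>"
        by (rule eqI) (use x y addc zc in \<open>auto simp: ev c N.smult_l_minus N.M.l_neg\<close>)
      ultimately show "\<exists>y\<in>carrier ?P. y \<oplus>\<^bsub>?P\<^esub> x = \<zero>\<^bsub>?P\<^esub>" by blast
    qed (auto intro!: eqI addc zc simp: ev c N.M.a_ac)
  qed (auto intro!: eqI addc smc M.R.is_cring simp: ev c N.smult_l_distr
        N.smult_r_distr N.smult_assoc1)
qed

lemma hom_module_carrier:
  "f \<in> carrier (hom_module R M N) \<longleftrightarrow> f \<in> mod_hom R M N \<and> f \<in> extensional (carrier M)"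
  by (simp add: hom_module_def)

lemma restrict_hom_module:
  assumes "module R M" "f \<in> mod_hom R M N"
  shows "restrict f (carrier M) \<in> carrier (hom_module R M N)"
proof -
  interpret module R M by fact
  show ?thesis using assms(2) by (auto simp: hom_module_def mod_hom_def)
qed

lemma eval_hom: "x \<in> carrier M \<Longrightarrow> (\<lambda>f. f x) \<in> mod_hom R (hom_module R M N) N"
  by (auto simp: mod_hom_def hom_module_def)

text \<open>
Both sides are bilinear maps \<open>A \<times> B \<rightarrow> E\<close>, curried in the two possible orders.
\<close>

lemma hom_flip:
  assumes A: "module R A" and B: "module R B" and E: "module R E"
    and h: "h \<in> mod_hom R A (hom_module R B E)"
  shows "(\<lambda>b. \<lambda>a\<in>carrier A. h a b) \<in> mod_hom R B (hom_module R A E)"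
proof -
  interpret A: module R A by fact
  interpret B: module R B by fact
  interpret E: module R E by fact
  have ha: "h a \<in> mod_hom R B E" if "a \<in> carrier A" for a
    using mod_homD(1)[OF h that] by (simp add: hom_module_carrier)
  show ?thesis
  proof (rule mod_homI)
    fix b assume b: "b \<in> carrier B"
    have "(\<lambda>a. h a b) \<in> mod_hom R A E"
      using mod_hom_comp[OF h eval_hom[OF b]] .
    then show "(\<lambda>a\<in>carrier A. h a b) \<in> carrier (hom_module R A E)"
      by (rule restrict_hom_module[OF A])
  qed (auto simp: hom_module_def mod_homD(2,3)[OF ha])
qed

lemma hom_precomp:
  assumes "module R A" "f \<in> mod_hom R A B"
  shows "(\<lambda>\<phi>. \<lambda>a\<in>carrier A. \<phi> (f a)) \<in> mod_hom R (hom_module R B E) (hom_module R A E)"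
proof (rule mod_homI)
  fix \<phi> assume "\<phi> \<in> carrier (hom_module R B E)"
  then show "(\<lambda>a\<in>carrier A. \<phi> (f a)) \<in> carrier (hom_module R A E)"
    using mod_hom_comp[OF assms(2)] restrict_hom_module[OF assms(1)]
    by (force simp: hom_module_carrier)
qed (auto simp: hom_module_def mod_homD(1)[OF assms(2)])

lemma (in module) finsum_smult_rdistr:
  assumes "finite A" "c \<in> A \<rightarrow> carrier R" "x \<in> carrier M"
  shows "(\<Oplus>\<^bsub>R\<^esub>i\<in>A. c i) \<odot>\<^bsub>M\<^esub> x = (\<Oplus>\<^bsub>M\<^esub>i\<in>A. c i \<odot>\<^bsub>M\<^esub> x)"
  using assms(1,2)
proof (induction A rule: finite_induct)
  case (insert i A)
  then have "(\<lambda>i. c i \<odot>\<^bsub>M\<^esub> x) \<in> A \<rightarrow> carrier M" "c i \<in> carrier R" "c \<in> A \<rightarrow> carrier R"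
    using assms(3) by auto
  with insert show ?case using assms(3) by (simp add: smult_l_distr)
qed (simp add: assms(3))

lemma (in module) lincomb_add_left:
  assumes "c \<in> A \<rightarrow> carrier R" "d \<in> A \<rightarrow> carrier R" "x \<in> A \<rightarrow> carrier M"
  shows "(\<Oplus>\<^bsub>M\<^esub>i\<in>A. (c i \<oplus> d i) \<odot>\<^bsub>M\<^esub> x i) =
    (\<Oplus>\<^bsub>M\<^esub>i\<in>A. c i \<odot>\<^bsub>M\<^esub> x i) \<oplus>\<^bsub>M\<^esub> (\<Oplus>\<^bsub>M\<^esub>i\<in>A. d i \<odot>\<^bsub>M\<^esub> x i)"
  using assms
  by (intro trans[OF M.finsum_cong' M.finsum_addf]) (auto simp: smult_l_distr Pi_iff)

lemma (in module) lincomb_smult_left: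
  assumes "finite A" "b \<in> carrier R" "c \<in> A \<rightarrow> carrier R" "x \<in> A \<rightarrow> carrier M"
  shows "(\<Oplus>\<^bsub>M\<^esub>i\<in>A. (b \<otimes> c i) \<odot>\<^bsub>M\<^esub> x i) = b \<odot>\<^bsub>M\<^esub> (\<Oplus>\<^bsub>M\<^esub>i\<in>A. c i \<odot>\<^bsub>M\<^esub> x i)"
  using assms
  by (subst finsum_smult_ldistr) (auto intro!: M.finsum_cong' simp: smult_assoc1 Pi_iff)

lemma (in module) lincomb_add_right:
  assumes "c \<in> A \<rightarrow> carrier R" "x \<in> A \<rightarrow> carrier M" "y \<in> A \<rightarrow> carrier M"
  shows "(\<Oplus>\<^bsub>M\<^esub>i\<in>A. c i \<odot>\<^bsub>M\<^esub> (x i \<oplus>\<^bsub>M\<^esub> y i)) =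
    (\<Oplus>\<^bsub>M\<^esub>i\<in>A. c i \<odot>\<^bsub>M\<^esub> x i) \<oplus>\<^bsub>M\<^esub> (\<Oplus>\<^bsub>M\<^esub>i\<in>A. c i \<odot>\<^bsub>M\<^esub> y i)"
  using assms
  by (intro trans[OF M.finsum_cong' M.finsum_addf]) (auto simp: smult_r_distr Pi_iff)

lemma (in module) lincomb_smult_right:
  assumes "finite A" "b \<in> carrier R" "c \<in> A \<rightarrow> carrier R" "x \<in> A \<rightarrow> carrier M"
  shows "(\<Oplus>\<^bsub>M\<^esub>i\<in>A. c i \<odot>\<^bsub>M\<^esub> (b \<odot>\<^bsub>M\<^esub> x i)) = b \<odot>\<^bsub>M\<^esub> (\<Oplus>\<^bsub>M\<^esub>i\<in>A. c i \<odot>\<^bsub>M\<^esub> x i)"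
  using assms
  by (subst finsum_smult_ldistr) (auto intro!: M.finsum_cong' simp: smult_left_commute Pi_iff)

lemma (in module) lincomb_closed:
  assumes "c \<in> A \<rightarrow> carrier R" "x \<in> A \<rightarrow> carrier M"
  shows "(\<Oplus>\<^bsub>M\<^esub>i\<in>A. c i \<odot>\<^bsub>M\<^esub> x i) \<in> carrier M"
  using assms by (intro M.finsum_closed) auto

lemma (in module) lincomb_delta:
  assumes "finite A" "i \<in> A" "c \<in> A \<rightarrow> carrier R" "x \<in> carrier M"
  shows "(\<Oplus>\<^bsub>M\<^esub>j\<in>A. c j \<odot>\<^bsub>M\<^esub> (if j = i then x else \<zero>\<^bsub>M\<^esub>)) = c i \<odot>\<^bsub>M\<^esub> x"
proof -
  have "(\<Oplus>\<^bsub>M\<^esub>j\<in>A. c j \<odot>\<^bsub>M\<^esub> (if j = i then x else \<zero>\<^bsub>M\<^esub>)) =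
      (\<Oplus>\<^bsub>M\<^esub>j\<in>A. if j = i then c i \<odot>\<^bsub>M\<^esub> x else \<zero>\<^bsub>M\<^esub>)"
    using assms by (intro M.finsum_cong') (auto simp: Pi_iff)
  also have "\<dots> = c i \<odot>\<^bsub>M\<^esub> x" using assms by (intro M.finsum_delta) (auto simp: Pi_iff)
  finally show ?thesis .
qed

lemma (in module) lincomb_zero:
  assumes "c \<in> A \<rightarrow> carrier R" "\<And>j. j \<in> A \<Longrightarrow> x j = \<zero>\<^bsub>M\<^esub>"
  shows "(\<Oplus>\<^bsub>M\<^esub>j\<in>A. c j \<odot>\<^bsub>M\<^esub> x j) = \<zero>\<^bsub>M\<^esub>"
  using assms by (intro M.add.finprod_one_eqI) (auto simp: Pi_iff)

lemma mod_hom_lincomb: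
  assumes "module R M" "module R N" "h \<in> mod_hom R M N"
    and "c \<in> A \<rightarrow> carrier R" "x \<in> A \<rightarrow> carrier M"
  shows "h (\<Oplus>\<^bsub>M\<^esub>i\<in>A. c i \<odot>\<^bsub>M\<^esub> x i) = (\<Oplus>\<^bsub>N\<^esub>i\<in>A. c i \<odot>\<^bsub>N\<^esub> h (x i))"
proof -
  interpret M: module R M by fact
  interpret N: module R N by fact
  have "h (\<Oplus>\<^bsub>M\<^esub>i\<in>A. c i \<odot>\<^bsub>M\<^esub> x i) = (\<Oplus>\<^bsub>N\<^esub>i\<in>A. h (c i \<odot>\<^bsub>M\<^esub> x i))"
    using assms by (intro mod_hom_finsum) auto
  also have "\<dots> = (\<Oplus>\<^bsub>N\<^esub>i\<in>A. c i \<odot>\<^bsub>N\<^esub> h (x i))"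
    using assms(4,5) by (intro N.M.finsum_cong') (auto simp: mod_homD[OF assms(3)] Pi_iff)
  finally show ?thesis .
qed

text \<open>
The coordinate embeddings of a module into a power of itself. They are defined for arbitrary
\<open>\<Lambda>\<close> and serve finite powers, where they identify a homomorphism out of the power with a finite
family of homomorphisms.
\<close>

definition single :: "'i set \<Rightarrow> ('r, 'm) module \<Rightarrow> 'i \<Rightarrow> 'm \<Rightarrow> 'i \<Rightarrow> 'm"
  where "single \<Lambda> M i x = (\<lambda>j\<in>\<Lambda>. if j = i then x else \<zero>\<^bsub>M\<^esub>)"

lemma single_hom:
  assumes "module R M"
  shows "single \<Lambda> M i \<in> mod_hom R M (direct_product \<Lambda> (\<lambda>_. M))"
proof -
  interpret module R M by fact
  show ?thesis
    by (rule mod_homI) (auto simp: single_def direct_product_def fun_eq_iff)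
qed

lemma hom_into_product:
  assumes "\<And>i. i \<in> \<Lambda> \<Longrightarrow> h i \<in> mod_hom R U (M i)"
  shows "(\<lambda>u. \<lambda>i\<in>\<Lambda>. h i u) \<in> mod_hom R U (direct_product \<Lambda> M)"
  by (rule mod_homI) (auto simp: direct_product_def mod_homD[OF assms])

lemma hom_module_nonzero:
  assumes "f \<in> carrier (hom_module R M N)" "f \<noteq> \<zero>\<^bsub>hom_module R M N\<^esub>"
  obtains x where "x \<in> carrier M" "f x \<noteq> \<zero>\<^bsub>N\<^esub>"
proof -
  have "\<exists>x\<in>carrier M. f x \<noteq> \<zero>\<^bsub>N\<^esub>"
  proof (rule ccontr)
    assume "\<not> ?thesis"
    then have "f = \<zero>\<^bsub>hom_module R M N\<^esub>"
      using assms(1) by (intro extensionalityI[of _ "carrier M"]) (auto simp: hom_module_def)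
    with assms(2) show False by simp
  qed
  then show thesis using that by blast
qed

lemma hom_module_nonzeroI:
  "x \<in> carrier M \<Longrightarrow> f x \<noteq> \<zero>\<^bsub>N\<^esub> \<Longrightarrow> f \<noteq> \<zero>\<^bsub>hom_module R M N\<^esub>"
  by (auto simp: hom_module_def)

section \<open>Generation and cogeneration without index sets\<close>

text \<open>
The trace of \<open>U\<close> in \<open>M\<close>. The inductive form turns statements about sums of homomorphic images
into inductions with one homomorphism per step.
\<close>

inductive_set hom_trace ::
  "('r, 's) ring_scheme \<Rightarrow> ('r, 'u) module \<Rightarrow> ('r, 'm) module \<Rightarrow> 'm set"
  for R U M where
    zero: "\<zero>\<^bsub>M\<^esub> \<in> hom_trace R U M"
  | add: "t \<in> hom_trace R U M \<Longrightarrow> h \<in> mod_hom R U M \<Longrightarrow> u \<in> carrier U \<Longrightarrow>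
      t \<oplus>\<^bsub>M\<^esub> h u \<in> hom_trace R U M"

lemma direct_sum_simps:
  "x \<in> carrier (direct_sum \<Lambda> M) \<longleftrightarrow>
    x \<in> (\<Pi>\<^sub>E i\<in>\<Lambda>. carrier (M i)) \<and> finite {i\<in>\<Lambda>. x i \<noteq> \<zero>\<^bsub>M i\<^esub>}"
  "x \<oplus>\<^bsub>direct_sum \<Lambda> M\<^esub> y = (\<lambda>i\<in>\<Lambda>. x i \<oplus>\<^bsub>M i\<^esub> y i)"
  "a \<odot>\<^bsub>direct_sum \<Lambda> M\<^esub> x = (\<lambda>i\<in>\<Lambda>. a \<odot>\<^bsub>M i\<^esub> x i)"
  by (simp_all add: direct_sum_def direct_product_def)

text \<open>
An epimorphism from a direct sum is a family of homomorphisms \<open>U \<rightarrow> M\<close> whose images together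
generate \<open>M\<close>; conversely, the sum of all homomorphisms \<open>U \<rightarrow> M\<close> is defined on the direct sum of
copies of \<open>U\<close> indexed by \<open>Hom(U, M)\<close>, and its image is the trace.
\<close>

lemma generated_by_iff:
  fixes R :: "('r, 's) ring_scheme" and U :: "('r, 'u) module" and M :: "('r, 'm) module"
  assumes U: "module R U" and M: "module R M"
  shows "generated_by R U M \<longleftrightarrow> carrier M \<subseteq> hom_trace R U M"
proof
  interpret U: module R U by fact
  interpret M: module R M by fact
  assume "generated_by R U M"
  then obtain \<Lambda> :: "('u \<Rightarrow> 'm) set" and f where
    f: "f \<in> mod_hom R (direct_sum \<Lambda> (\<lambda>_. U)) M" and
    surj: "f ` carrier (direct_sum \<Lambda> (\<lambda>_. U)) = carrier M"
    unfolding generated_by_def mod_epi_def by blast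
  let ?S = "direct_sum \<Lambda> (\<lambda>_. U)"
  define single where "single i u = (\<lambda>j\<in>\<Lambda>. if j = i then u else \<zero>\<^bsub>U\<^esub>)" for i u
  have single_c: "single i u \<in> carrier ?S" if "u \<in> carrier U" for i u
    using that unfolding direct_sum_simps single_def
    by (auto intro!: finite_subset[of _ "{i}"] split: if_splits)
  have single_h: "(\<lambda>u. f (single i u)) \<in> mod_hom R U M" for i
  proof (rule mod_hom_comp[OF _ f])
    show "single i \<in> mod_hom R U ?S"
      by (rule mod_homI) (auto intro: single_c simp: fun_eq_iff, simp_all add: single_def direct_sum_simps)
  qed
  have im: "f y \<in> hom_trace R U M"
    if "finite F" "y \<in> carrier ?S" "{i\<in>\<Lambda>. y i \<noteq> \<zero>\<^bsub>U\<^esub>} = F" for y F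
    using that
  proof (induction F arbitrary: y rule: finite_induct)
    case empty
    then have "y = \<zero>\<^bsub>R\<^esub> \<odot>\<^bsub>?S\<^esub> y"
      by (auto simp: direct_sum_simps fun_eq_iff PiE_def extensional_def)
    then have "f y = \<zero>\<^bsub>M\<^esub>"
      using mod_homD(3)[OF f U.R.zero_closed empty(1)] mod_homD(1)[OF f empty(1)] by simp
    then show ?case by (simp add: hom_trace.zero)
  next
    case (insert i F)
    have i: "i \<in> \<Lambda>" using insert.prems(2) by blast
    have yU: "y j \<in> carrier U" if "j \<in> \<Lambda>" for j
      using insert.prems(1) that unfolding direct_sum_simps by blast
    define z where "z = (\<lambda>j\<in>\<Lambda>. if j = i then \<zero>\<^bsub>U\<^esub> else y j)"
    have zF: "{j \<in> \<Lambda>. z j \<noteq> \<zero>\<^bsub>U\<^esub>} = F"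
      using insert.prems(2) insert.hyps(2) by (auto simp: z_def)
    have zS: "z \<in> carrier ?S"
      unfolding direct_sum_simps zF using insert.hyps(1) yU by (auto simp: z_def)
    have "y = z \<oplus>\<^bsub>?S\<^esub> single i (y i)"
    proof (rule ext)
      show "y j = (z \<oplus>\<^bsub>?S\<^esub> single i (y i)) j" for j
        using insert.prems(1) yU
        by (cases "j \<in> \<Lambda>") (auto simp: direct_sum_simps z_def single_def)
    qed
    then have "f y = f z \<oplus>\<^bsub>M\<^esub> f (single i (y i))"
      using mod_homD(2)[OF f zS single_c[OF yU[OF i]]] by metis
    then show ?case
      using hom_trace.add[OF insert.IH[OF zS zF] single_h yU[OF i]] by simp
  qed
  have "f y \<in> hom_trace R U M" if "y \<in> carrier ?S" for y
    using im[OF _ that refl] that by (simp add: direct_sum_simps(1))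
  then show "carrier M \<subseteq> hom_trace R U M" unfolding surj[symmetric] by blast
next
  interpret U: module R U by fact
  interpret M: module R M by fact
  assume sub: "carrier M \<subseteq> hom_trace R U M"
  define \<Lambda> where "\<Lambda> = mod_hom R U M"
  let ?S = "direct_sum \<Lambda> (\<lambda>_. U)"
  define supp where "supp x = {h\<in>\<Lambda>. x h \<noteq> \<zero>\<^bsub>U\<^esub>}" for x
  define F where "F x = (\<Oplus>\<^bsub>M\<^esub>h\<in>supp x. h (x h))" for x
  have sfin: "finite (supp x)" and xc: "h \<in> \<Lambda> \<Longrightarrow> x h \<in> carrier U" if "x \<in> carrier ?S" for x h
    using that by (auto simp: direct_sum_simps supp_def)
  have hc: "h u \<in> carrier M" if "h \<in> \<Lambda>" "u \<in> carrier U" for h u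
    using that by (auto simp: \<Lambda>_def mod_hom_def)
  have h0: "h \<zero>\<^bsub>U\<^esub> = \<zero>\<^bsub>M\<^esub>" if "h \<in> \<Lambda>" for h
    using that mod_hom_zero[OF U M] by (simp add: \<Lambda>_def)
  have hD: "v \<in> carrier U \<Longrightarrow> h (u \<oplus>\<^bsub>U\<^esub> v) = h u \<oplus>\<^bsub>M\<^esub> h v"
    "a \<in> carrier R \<Longrightarrow> h (a \<odot>\<^bsub>U\<^esub> u) = a \<odot>\<^bsub>M\<^esub> h u"
    if "h \<in> \<Lambda>" "u \<in> carrier U" for h u v a
    using that by (auto simp: \<Lambda>_def mod_hom_def)
  have F_eq: "F x = (\<Oplus>\<^bsub>M\<^esub>h\<in>T. h (x h))"
    if "x \<in> carrier ?S" "finite T" "supp x \<subseteq> T" "T \<subseteq> \<Lambda>" for x T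
    unfolding F_def using that
    by (intro M.M.add.finprod_mono_neutral_cong_left) (auto simp: supp_def h0 hc xc)
  have addc: "x \<oplus>\<^bsub>?S\<^esub> y \<in> carrier ?S" and supp_add: "supp (x \<oplus>\<^bsub>?S\<^esub> y) \<subseteq> supp x \<union> supp y"
    if xy: "x \<in> carrier ?S" "y \<in> carrier ?S" for x y
  proof -
    show s: "supp (x \<oplus>\<^bsub>?S\<^esub> y) \<subseteq> supp x \<union> supp y"
      by (auto simp: supp_def direct_sum_simps)
    have "finite (supp (x \<oplus>\<^bsub>?S\<^esub> y))" using finite_subset[OF s] sfin xy by blast
    then show "x \<oplus>\<^bsub>?S\<^esub> y \<in> carrier ?S"
      using xy by (auto simp: direct_sum_simps supp_def)
  qed
  have smc: "a \<odot>\<^bsub>?S\<^esub> x \<in> carrier ?S" and supp_sm: "supp (a \<odot>\<^bsub>?S\<^esub> x) \<subseteq> supp x"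
    if a: "a \<in> carrier R" and x: "x \<in> carrier ?S" for a x
  proof -
    show s: "supp (a \<odot>\<^bsub>?S\<^esub> x) \<subseteq> supp x"
      using a by (auto simp: supp_def direct_sum_simps)
    have "finite (supp (a \<odot>\<^bsub>?S\<^esub> x))" using finite_subset[OF s] sfin x by blast
    then show "a \<odot>\<^bsub>?S\<^esub> x \<in> carrier ?S"
      using a x by (auto simp: direct_sum_simps supp_def)
  qed
  have F: "F \<in> mod_hom R ?S M"
  proof (rule mod_homI)
    fix x assume x: "x \<in> carrier ?S"
    show "F x \<in> carrier M"
      unfolding F_def using x by (intro M.M.finsum_closed) (auto simp: supp_def xc hc)
  next
    fix x y assume xy: "x \<in> carrier ?S" "y \<in> carrier ?S"
    let ?T = "supp x \<union> supp y"
    have T: "finite ?T" "?T \<subseteq> \<Lambda>" using sfin xy by (auto simp: supp_def)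
    have "F (x \<oplus>\<^bsub>?S\<^esub> y) = (\<Oplus>\<^bsub>M\<^esub>h\<in>?T. h ((x \<oplus>\<^bsub>?S\<^esub> y) h))"
      by (rule F_eq[OF addc[OF xy] T(1) supp_add[OF xy] T(2)])
    also have "\<dots> = (\<Oplus>\<^bsub>M\<^esub>h\<in>?T. h (x h) \<oplus>\<^bsub>M\<^esub> h (y h))"
      using T xy by (intro M.M.finsum_cong') (auto simp: direct_sum_simps(2) hD hc xc subset_iff)
    also have "\<dots> = (\<Oplus>\<^bsub>M\<^esub>h\<in>?T. h (x h)) \<oplus>\<^bsub>M\<^esub> (\<Oplus>\<^bsub>M\<^esub>h\<in>?T. h (y h))"
      using T xy by (intro M.M.finsum_addf) (auto simp: hc xc subset_iff)
    also have "\<dots> = F x \<oplus>\<^bsub>M\<^esub> F y"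
      using F_eq[OF xy(1) T(1) _ T(2)] F_eq[OF xy(2) T(1) _ T(2)] by simp
    finally show "F (x \<oplus>\<^bsub>?S\<^esub> y) = F x \<oplus>\<^bsub>M\<^esub> F y" .
  next
    fix a x assume a: "a \<in> carrier R" and x: "x \<in> carrier ?S"
    have T: "supp x \<subseteq> \<Lambda>" by (auto simp: supp_def)
    have "F (a \<odot>\<^bsub>?S\<^esub> x) = (\<Oplus>\<^bsub>M\<^esub>h\<in>supp x. h ((a \<odot>\<^bsub>?S\<^esub> x) h))"
      by (rule F_eq[OF smc[OF a x] sfin[OF x] supp_sm[OF a x] T])
    also have "\<dots> = (\<Oplus>\<^bsub>M\<^esub>h\<in>supp x. a \<odot>\<^bsub>M\<^esub> h (x h))"
      using T a x by (intro M.M.finsum_cong') (auto simp: direct_sum_simps(3) hD hc xc subset_iff)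
    also have "\<dots> = a \<odot>\<^bsub>M\<^esub> F x"
      unfolding F_def using T a x
      by (intro M.finsum_smult_ldistr[symmetric]) (auto simp: sfin hc xc subset_iff)
    finally show "F (a \<odot>\<^bsub>?S\<^esub> x) = a \<odot>\<^bsub>M\<^esub> F x" .
  qed
  have "t \<in> F ` carrier ?S" if "t \<in> hom_trace R U M" for t
    using that
  proof induction
    case zero
    have "(\<lambda>h\<in>\<Lambda>. \<zero>\<^bsub>U\<^esub>) \<in> carrier ?S" by (auto simp: direct_sum_simps)
    moreover have "supp (\<lambda>h\<in>\<Lambda>. \<zero>\<^bsub>U\<^esub>) = {}" by (auto simp: supp_def)
    then have "F (\<lambda>h\<in>\<Lambda>. \<zero>\<^bsub>U\<^esub>) = \<zero>\<^bsub>M\<^esub>" by (simp add: F_def)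
    ultimately show ?case by (metis imageI)
  next
    case (add t h u)
    then obtain x where x: "x \<in> carrier ?S" "t = F x" by blast
    define y where "y = (\<lambda>k\<in>\<Lambda>. if k = h then u else \<zero>\<^bsub>U\<^esub>)"
    have h: "h \<in> \<Lambda>" using add by (simp add: \<Lambda>_def)
    have sy: "supp y \<subseteq> {h}" by (auto simp: supp_def y_def)
    have y: "y \<in> carrier ?S"
      using finite_subset[OF sy] add by (auto simp: direct_sum_simps supp_def) (auto simp: y_def)
    have "F y = h u" using F_eq[OF y _ sy] h add hc[OF h] by (simp add: y_def)
    then have "t \<oplus>\<^bsub>M\<^esub> h u = F (x \<oplus>\<^bsub>?S\<^esub> y)" using mod_homD(2)[OF F x(1) y] x(2) by simp
    then show ?case using addc[OF x(1) y] by blast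
  qed
  then have "F ` carrier ?S = carrier M"
    using sub mod_homD(1)[OF F] by blast
  then have "F \<in> mod_epi R ?S M" using F by (simp add: mod_epi_def)
  then show "generated_by R U M"
    unfolding generated_by_def \<Lambda>_def by blast
qed

lemma hom_trace_sum:
  assumes M: "module R M" and "finite X" and h: "\<And>x. x \<in> X \<Longrightarrow> h x \<in> mod_hom R U M"
    and u: "\<And>x. x \<in> X \<Longrightarrow> u x \<in> carrier U"
  shows "(\<Oplus>\<^bsub>M\<^esub>x\<in>X. h x (u x)) \<in> hom_trace R U M"
  using assms(2) h u
proof (induction X rule: finite_induct)
  case empty
  interpret module R M by fact
  show ?case by (simp add: hom_trace.zero)
next
  case (insert x X)
  interpret module R M by fact
  have c: "h y (u y) \<in> carrier M" if "y \<in> insert x X" for y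
    using mod_homD(1)[OF insert.prems(1)[OF that] insert.prems(2)[OF that]] .
  then have "(\<Oplus>\<^bsub>M\<^esub>x\<in>insert x X. h x (u x)) = h x (u x) \<oplus>\<^bsub>M\<^esub> (\<Oplus>\<^bsub>M\<^esub>x\<in>X. h x (u x))"
    using insert.hyps by (intro M.finsum_insert) auto
  also have "\<dots> = (\<Oplus>\<^bsub>M\<^esub>x\<in>X. h x (u x)) \<oplus>\<^bsub>M\<^esub> h x (u x)"
    using c by (intro M.a_comm M.finsum_closed) auto
  also have "\<dots> \<in> hom_trace R U M"
    using insert by (intro hom_trace.add) auto
  finally show ?case .
qed

lemma hom_trace_submodule:
  assumes "module R M"
  shows "submodule (hom_trace R U M) R M"
proof -
  interpret module R M by fact
  have c: "t \<in> carrier M" if "t \<in> hom_trace R U M" for t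
    using that by induction (auto dest: mod_homD(1))
  have add: "s \<oplus>\<^bsub>M\<^esub> t \<in> hom_trace R U M"
    if "t \<in> hom_trace R U M" "s \<in> hom_trace R U M" for s t
    using that
  proof (induction)
    case (add t h u)
    have "s \<oplus>\<^bsub>M\<^esub> (t \<oplus>\<^bsub>M\<^esub> h u) = (s \<oplus>\<^bsub>M\<^esub> t) \<oplus>\<^bsub>M\<^esub> h u"
      using add c mod_homD(1)[OF add(2,3)] by (simp add: M.a_assoc)
    with add show ?case by (simp add: hom_trace.add)
  qed (simp add: c)
  have sm: "a \<odot>\<^bsub>M\<^esub> t \<in> hom_trace R U M" if "t \<in> hom_trace R U M" "a \<in> carrier R" for a t
    using that
  proof (induction)
    case (add t h u)
    have "(\<lambda>x. a \<odot>\<^bsub>M\<^esub> h x) \<in> mod_hom R U M"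
      by (rule mod_homI) (auto simp: mod_homD[OF add(2)] add(5) smult_r_distr smult_left_commute)
    from hom_trace.add[OF add.IH[OF add.prems] this add.hyps(3)] show ?case
      using add c mod_homD(1)[OF add(2,3)] by (simp add: smult_r_distr)
  qed (simp add: hom_trace.zero)
  show ?thesis
  proof (rule submoduleI)
    show "\<ominus>\<^bsub>M\<^esub> t \<in> hom_trace R U M" if "t \<in> hom_trace R U M" for t
      using sm[OF that, of "\<ominus>\<^bsub>R\<^esub> \<one>\<^bsub>R\<^esub>"] c[OF that] by (simp add: smult_l_minus)
  qed (auto simp: c hom_trace.zero add sm)
qed

text \<open>
A monomorphism into a product is a family of homomorphisms \<open>N \<rightarrow> V\<close> that separates points, and
the largest such family is \<open>Hom(N, V)\<close> itself.
\<close>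

lemma cogenerated_by_iff:
  fixes R :: "('r, 's) ring_scheme" and N :: "('r, 'n) module" and V :: "('r, 'v) module"
  assumes N: "module R N" and V: "module R V"
  shows "cogenerated_by R V N \<longleftrightarrow>
    (\<forall>y\<in>carrier N. y \<noteq> \<zero>\<^bsub>N\<^esub> \<longrightarrow> (\<exists>h\<in>mod_hom R N V. h y \<noteq> \<zero>\<^bsub>V\<^esub>))"
proof
  interpret N: module R N by fact
  interpret V: module R V by fact
  assume "cogenerated_by R V N"
  then obtain \<Lambda> :: "('n \<Rightarrow> 'v) set" and f where
    f: "f \<in> mod_hom R N (direct_product \<Lambda> (\<lambda>_. V))" and inj: "inj_on f (carrier N)"
    unfolding cogenerated_by_def mod_mono_def by blast
  let ?P = "direct_product \<Lambda> (\<lambda>_. V)"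
  have P: "module R ?P" using V N.R.is_cring by (intro direct_product_module)
  show "\<forall>y\<in>carrier N. y \<noteq> \<zero>\<^bsub>N\<^esub> \<longrightarrow> (\<exists>h\<in>mod_hom R N V. h y \<noteq> \<zero>\<^bsub>V\<^esub>)"
  proof (intro ballI impI)
    fix y assume y: "y \<in> carrier N" "y \<noteq> \<zero>\<^bsub>N\<^esub>"
    then have "f y \<noteq> \<zero>\<^bsub>?P\<^esub>"
      using inj_onD[OF inj, of y "\<zero>\<^bsub>N\<^esub>"] mod_hom_zero[OF N P f] by auto
    moreover have "f y \<in> carrier ?P" using mod_homD(1)[OF f y(1)] .
    ultimately obtain i where "i \<in> \<Lambda>" "f y i \<noteq> \<zero>\<^bsub>V\<^esub>"
      by (auto simp: direct_product_def fun_eq_iff PiE_def extensional_def split: if_splits)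
    then show "\<exists>h\<in>mod_hom R N V. h y \<noteq> \<zero>\<^bsub>V\<^esub>"
      using mod_hom_comp[OF f proj_hom[of i \<Lambda> R "\<lambda>_. V"]]
      by (intro bexI[of _ "\<lambda>x. f x i"]) auto
  qed
next
  interpret N: module R N by fact
  interpret V: module R V by fact
  assume sep: "\<forall>y\<in>carrier N. y \<noteq> \<zero>\<^bsub>N\<^esub> \<longrightarrow> (\<exists>h\<in>mod_hom R N V. h y \<noteq> \<zero>\<^bsub>V\<^esub>)"
  define f where "f = (\<lambda>y. \<lambda>h\<in>mod_hom R N V. h y)"
  have "f \<in> mod_hom R N (direct_product (mod_hom R N V) (\<lambda>_. V))"
    by (rule mod_homI) (auto simp: f_def direct_product_def fun_eq_iff dest: mod_homD)
  moreover have "inj_on f (carrier N)"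
  proof (rule inj_onI, rule ccontr)
    fix x y assume xy: "x \<in> carrier N" "y \<in> carrier N" "f x = f y" "x \<noteq> y"
    let ?d = "x \<oplus>\<^bsub>N\<^esub> (\<ominus>\<^bsub>R\<^esub> \<one>\<^bsub>R\<^esub>) \<odot>\<^bsub>N\<^esub> y"
    have "?d \<noteq> \<zero>\<^bsub>N\<^esub>"
    proof
      assume "?d = \<zero>\<^bsub>N\<^esub>"
      then have "x \<oplus>\<^bsub>N\<^esub> \<ominus>\<^bsub>N\<^esub> y = \<zero>\<^bsub>N\<^esub>" using xy by (simp add: N.smult_l_minus)
      then show False using xy
        by (metis N.M.a_inv_closed N.M.minus_equality N.M.minus_minus)
    qed
    then obtain h where h: "h \<in> mod_hom R N V" "h ?d \<noteq> \<zero>\<^bsub>V\<^esub>" using sep xy by auto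
    have "h x = h y" using xy(3) h(1) by (auto simp: f_def fun_eq_iff split: if_splits)
    then have "h ?d = \<zero>\<^bsub>V\<^esub>"
      using mod_homD[OF h(1)] xy by (simp add: V.smult_minus_one_cancel)
    with h(2) show False by simp
  qed
  ultimately show "cogenerated_by R V N"
    unfolding cogenerated_by_def mod_mono_def by blast
qed

section \<open>Extending homomorphisms into an injective hull\<close>

text \<open>
Defining a homomorphism by its graph replaces a choice of representatives by one condition: the
graph contains no \<open>(0, u)\<close> with \<open>u \<noteq> 0\<close>.
\<close>

lemma total_partial_graph_hom:
  assumes B: "module R B" and E: "module R E" and G: "partial_graph R B E G"
    and tot: "carrier B \<subseteq> Domain G"
  obtains g where "g \<in> mod_hom R B E" "\<And>x u. (x, u) \<in> G \<Longrightarrow> g x = u"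
proof -
  interpret B: module R B by fact
  note GD = partial_graphD[OF G] and uniq = partial_graph_unique[OF B E G]
  define g where "g x = (SOME u. (x, u) \<in> G)" for x
  have g: "(x, g x) \<in> G" if "x \<in> carrier B" for x
    using that tot unfolding g_def by (metis Domain.cases someI subsetD)
  have "g \<in> mod_hom R B E"
  proof (rule mod_homI)
    show "g x \<in> carrier E" if "x \<in> carrier B" for x
      using GD(2)[OF g[OF that]] .
    show "g (x \<oplus>\<^bsub>B\<^esub> y) = g x \<oplus>\<^bsub>E\<^esub> g y" if "x \<in> carrier B" "y \<in> carrier B" for x y
      using uniq[OF g GD(3)[OF g[OF that(1)] g[OF that(2)]]] that by simp
    show "g (a \<odot>\<^bsub>B\<^esub> x) = a \<odot>\<^bsub>E\<^esub> g x" if "a \<in> carrier R" "x \<in> carrier B" for a x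
      using uniq[OF g GD(4)[OF that(1) g[OF that(2)]]] that by simp
  qed
  moreover have "g x = u" if "(x, u) \<in> G" for x u
    using uniq[OF g that] GD(1)[OF that] that by simp
  ultimately show thesis using that by blast
qed

text \<open>
Injectivity in the form in which it is used below. To extend a homomorphism along a map
\<open>p : A \<rightarrow> B\<close> it suffices that \<open>ker p\<close> lies in the kernel of the homomorphism, and the graph
formulation needs no module structure on \<open>A\<close>, only a parametrised set of pairs.
\<close>

lemma partial_graph_hom:
  fixes R :: "('r, 's) ring_scheme"
  assumes inj: "injective_module R E" and B: "module R B"
    and G: "partial_graph R B E G" and ne: "G \<noteq> {}"
  obtains g where "g \<in> mod_hom R B E" "\<And>x u. (x, u) \<in> G \<Longrightarrow> g x = u"
proof -
  have E: "module R E" using inj by (simp add: injective_module_def)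
  interpret B: module R B by fact
  interpret E: module R E by fact
  note GD = partial_graphD[OF G]
  have sub: "submodule (Domain G) R B"
  proof (rule B.submoduleI)
    show "Domain G \<subseteq> carrier B" using GD(1) by blast
    have neg: "\<ominus>\<^bsub>B\<^esub> x \<in> Domain G" if x: "x \<in> Domain G" for x
    proof -
      obtain u where xu: "(x, u) \<in> G" using x by blast
      have "((\<ominus>\<^bsub>R\<^esub> \<one>\<^bsub>R\<^esub>) \<odot>\<^bsub>B\<^esub> x, (\<ominus>\<^bsub>R\<^esub> \<one>\<^bsub>R\<^esub>) \<odot>\<^bsub>E\<^esub> u) \<in> G" using GD(4)[OF _ xu] by simp
      then show ?thesis using GD(1)[OF xu] by (auto simp: B.smult_l_minus)
    qed
    then show "\<And>a. a \<in> Domain G \<Longrightarrow> \<ominus>\<^bsub>B\<^esub> a \<in> Domain G" .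
    show add: "\<And>a b. \<lbrakk>a \<in> Domain G; b \<in> Domain G\<rbrakk> \<Longrightarrow> a \<oplus>\<^bsub>B\<^esub> b \<in> Domain G"
      using GD(3) by blast
    obtain x u where xu: "(x, u) \<in> G" using ne by auto
    then have x: "x \<in> Domain G" by blast
    show "\<zero>\<^bsub>B\<^esub> \<in> Domain G"
      using add[OF x neg[OF x]] GD(1)[OF xu] by (simp add: B.M.r_neg)
    show "\<And>a x. \<lbrakk>a \<in> carrier R; x \<in> Domain G\<rbrakk> \<Longrightarrow> a \<odot>\<^bsub>B\<^esub> x \<in> Domain G"
      using GD(4) by blast
  qed
  let ?A = "B\<lparr>carrier := Domain G\<rparr>"
  have A: "module R ?A" by (rule submodule.submodule_is_module[OF sub B])
  have i: "(\<lambda>x. x) \<in> mod_mono R ?A B"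
    using GD(1) by (auto simp: mod_mono_def mod_hom_def)
  have GA: "partial_graph R ?A E G"
    using GD by (simp add: partial_graph_def subset_iff) blast
  have dom: "carrier ?A \<subseteq> Domain G" by simp
  obtain f where f: "f \<in> mod_hom R ?A E" "\<And>x u. (x, u) \<in> G \<Longrightarrow> f x = u"
    using total_partial_graph_hom[OF A E GA dom] by blast
  obtain g where g: "g \<in> mod_hom R B E" "\<forall>x\<in>carrier ?A. g x = f x"
    using injective_module_universal[OF inj] A B i f(1) unfolding injective_wrt_def by blast
  have "g x = u" if "(x, u) \<in> G" for x u
    using g(2) f(2)[OF that] that by auto
  with g(1) that show thesis by blast
qed

lemma (in cring) proper_ideal_in_maximal:
  assumes "ideal J R" "J \<noteq> carrier R"
  obtains m where "maximalideal m R" "J \<subseteq> m"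
proof -
  define S where "S = {L. ideal L R \<and> J \<subseteq> L \<and> \<one> \<notin> L}"
  have "\<exists>m\<in>S. \<forall>X\<in>S. m \<subseteq> X \<longrightarrow> X = m"
  proof (rule subset_Zorn_nonempty)
    show "S \<noteq> {}" using assms ideal.one_imp_carrier by (auto simp: S_def)
  next
    fix C assume C: "C \<noteq> {}" "subset.chain S C"
    then have "subset.chain {I. ideal I R} C"
      by (auto simp: S_def subset.chain_def)
    from chain_Union_is_ideal[OF this] C(1) have "ideal (\<Union>C) R" by simp
    then show "\<Union>C \<in> S" using C by (fastforce simp: S_def subset.chain_def)
  qed
  then obtain m where m: "m \<in> S" "\<And>X. X \<in> S \<Longrightarrow> m \<subseteq> X \<Longrightarrow> X = m" by blast
  have "maximalideal m R"
  proof (rule maximalidealI)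
    show "ideal m R" "carrier R \<noteq> m" using m(1) by (auto simp: S_def)
    show "L = m \<or> L = carrier R" if "ideal L R" "m \<subseteq> L" "L \<subseteq> carrier R" for L
    proof (cases "\<one> \<in> L")
      case True
      then show ?thesis using ideal.one_imp_carrier that(1) by blast
    next
      case False
      then have "L \<in> S" using m(1) that by (auto simp: S_def)
      then show ?thesis using m(2) that(2) by blast
    qed
  qed
  then show thesis using that m(1) by (auto simp: S_def)
qed

text \<open>
The injective hull of the residue field is a cogenerator. The annihilator of \<open>y\<close> modulo \<open>T\<close> is a
proper ideal, hence contained in \<open>m\<close>; so \<open>r y + t \<mapsto> r + m\<close> is well defined on \<open>R y + T\<close>, takes
\<open>y\<close> to the nonzero residue class of \<open>1\<close>, and its composition with \<open>R / m \<rightarrow> E\<close> extends to \<open>M\<close>.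
\<close>

lemma hull_separates:
  fixes R :: "('r, 's) ring_scheme"
  assumes loc: "local_ring R m" and hull: "injective_hull R (quotient_module R m) E"
    and M: "module R M" and T: "submodule T R M" and y: "y \<in> carrier M" "y \<notin> T"
  obtains \<phi> where "\<phi> \<in> mod_hom R M E" "\<And>t. t \<in> T \<Longrightarrow> \<phi> t = \<zero>\<^bsub>E\<^esub>" "\<phi> y \<noteq> \<zero>\<^bsub>E\<^esub>"
proof -
  interpret R: cring R using loc by (simp add: local_ring_def)
  have inj: "injective_module R E" using hull by (simp add: injective_hull_def)
  then have E: "module R E" by (simp add: injective_module_def)
  interpret M: module R M by fact
  interpret E: module R E by fact
  interpret m: maximalideal m R using loc by (simp add: local_ring_def)
  interpret Q: ring "R Quot m" by (rule m.quotient_is_ring)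
  interpret rc: ring_hom_ring R "R Quot m" "(+>\<^bsub>R\<^esub>) m" by (rule m.rcos_ring_hom_ring)
  let ?k = "quotient_module R m"
  have k: "module R ?k" by (rule quotient_module_module[OF R.cring_axioms m.is_ideal])
  obtain i where i: "i \<in> mod_hom R ?k E" and i_inj: "inj_on i (carrier ?k)"
    using hull by (auto simp: injective_hull_def mod_mono_def)
  note T' = M.submoduleE[OF T]
  have tc: "t \<in> carrier M" if "t \<in> T" for t using that T'(1) by blast
  have T0: "\<zero>\<^bsub>M\<^esub> \<in> T"
  proof -
    obtain t where t: "t \<in> T" using T'(2) by blast
    show ?thesis using T'(5)[OF t T'(3)[OF t]] tc[OF t] by (simp add: M.M.r_neg)
  qed
  define p where "p r = i (m +>\<^bsub>R\<^esub> r)" for r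
  have kc: "m +>\<^bsub>R\<^esub> r \<in> carrier ?k" if "r \<in> carrier R" for r
    using that by (simp add: quotient_module_def)
  have ph: "p \<in> mod_hom R (ideal_module R (carrier R)) E"
    unfolding p_def
  proof (rule mod_hom_comp[OF _ i])
    show "(+>\<^bsub>R\<^esub>) m \<in> mod_hom R (ideal_module R (carrier R)) ?k"
      by (rule mod_homI) (auto simp: ideal_module_def quotient_module_def)
  qed
  have pc: "p r \<in> carrier E" if "r \<in> carrier R" for r
    using mod_homD(1)[OF ph] that by (simp add: ideal_module_def)
  have pa: "p (r \<oplus>\<^bsub>R\<^esub> s) = p r \<oplus>\<^bsub>E\<^esub> p s" if "r \<in> carrier R" "s \<in> carrier R" for r s
    using mod_homD(2)[OF ph] that by (simp add: ideal_module_def)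
  have ps: "p (a \<otimes>\<^bsub>R\<^esub> r) = a \<odot>\<^bsub>E\<^esub> p r" if "a \<in> carrier R" "r \<in> carrier R" for a r
    using mod_homD(3)[OF ph] that by (simp add: ideal_module_def)
  have zk: "\<zero>\<^bsub>?k\<^esub> \<in> carrier ?k"
    by (simp add: quotient_module_def)
  have p0: "p r = \<zero>\<^bsub>E\<^esub> \<longleftrightarrow> r \<in> m" if r: "r \<in> carrier R" for r
  proof -
    have "p r = \<zero>\<^bsub>E\<^esub> \<longleftrightarrow> i (m +>\<^bsub>R\<^esub> r) = i \<zero>\<^bsub>?k\<^esub>"
      using mod_hom_zero[OF k E i] by (simp add: p_def)
    also have "\<dots> \<longleftrightarrow> m +>\<^bsub>R\<^esub> r = \<zero>\<^bsub>?k\<^esub>"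
      by (rule inj_on_eq_iff[OF i_inj kc[OF r] zk])
    also have "\<dots> \<longleftrightarrow> r \<in> m"
    proof
      have z: "\<zero>\<^bsub>?k\<^esub> = m" unfolding quotient_module_def FactRing_def by (simp only: ring.simps)
      show "r \<in> m" if "m +>\<^bsub>R\<^esub> r = \<zero>\<^bsub>?k\<^esub>"
        using m.rcos_const_imp_mem[OF r] that z by simp
      show "m +>\<^bsub>R\<^esub> r = \<zero>\<^bsub>?k\<^esub>" if "r \<in> m"
        using R.a_rcos_zero[OF m.is_ideal that] z by simp
    qed
    finally show ?thesis .
  qed
  define J where "J = {r \<in> carrier R. r \<odot>\<^bsub>M\<^esub> y \<in> T}"
  have J: "ideal J R"
  proof (rule idealI)
    show "ring R" by (rule R.ring_axioms)
    show "subgroup J (add_monoid R)"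
    proof (rule R.add.subgroupI)
      show "J \<subseteq> carrier R" by (auto simp: J_def)
      have "\<zero>\<^bsub>R\<^esub> \<in> J" using y T0 by (simp add: J_def)
      then show "J \<noteq> {}" by blast
      show "\<ominus>\<^bsub>R\<^esub> a \<in> J" if "a \<in> J" for a
        using that y T'(3) by (simp add: J_def M.smult_l_minus)
      show "a \<oplus>\<^bsub>R\<^esub> b \<in> J" if "a \<in> J" "b \<in> J" for a b
        using that y T'(5) by (simp add: J_def M.smult_l_distr)
    qed
    show l: "x \<otimes>\<^bsub>R\<^esub> a \<in> J" if "a \<in> J" "x \<in> carrier R" for a x
      using that y T'(4) by (simp add: J_def M.smult_assoc1)
    show "a \<otimes>\<^bsub>R\<^esub> x \<in> J" if "a \<in> J" "x \<in> carrier R" for a x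
      using l[OF that] that by (simp add: J_def R.m_comm)
  qed
  have "\<one>\<^bsub>R\<^esub> \<notin> J" using y by (simp add: J_def)
  then have Jm: "J \<subseteq> m"
    using R.proper_ideal_in_maximal[OF J] loc by (metis R.one_closed local_ring_def)
  define G where "G = {(r \<odot>\<^bsub>M\<^esub> y \<oplus>\<^bsub>M\<^esub> t, p r) | r t. r \<in> carrier R \<and> t \<in> T}"
  have GI: "(x, u) \<in> G" if "r \<in> carrier R" "t \<in> T" "x = r \<odot>\<^bsub>M\<^esub> y \<oplus>\<^bsub>M\<^esub> t" "u = p r" for x u r t
    using that unfolding G_def by blast
  have "partial_graph R M E G"
    unfolding partial_graph_def
  proof (intro conjI allI impI)
    show "G \<subseteq> carrier M \<times> carrier E" using y tc pc by (auto simp: G_def)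
  next
    fix x u x' u' assume "(x, u) \<in> G" "(x', u') \<in> G"
    then obtain r t r' t' where *: "r \<in> carrier R" "t \<in> T" "x = r \<odot>\<^bsub>M\<^esub> y \<oplus>\<^bsub>M\<^esub> t" "u = p r"
      "r' \<in> carrier R" "t' \<in> T" "x' = r' \<odot>\<^bsub>M\<^esub> y \<oplus>\<^bsub>M\<^esub> t'" "u' = p r'" unfolding G_def by blast
    show "(x \<oplus>\<^bsub>M\<^esub> x', u \<oplus>\<^bsub>E\<^esub> u') \<in> G"
      by (rule GI[of "r \<oplus>\<^bsub>R\<^esub> r'" "t \<oplus>\<^bsub>M\<^esub> t'"])
        (use * y tc T'(5) in \<open>simp_all add: M.smult_l_distr M.M.a_ac pa\<close>)
  next
    fix a x u assume "a \<in> carrier R" "(x, u) \<in> G"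
    then obtain r t where *: "r \<in> carrier R" "t \<in> T" "x = r \<odot>\<^bsub>M\<^esub> y \<oplus>\<^bsub>M\<^esub> t" "u = p r" "a \<in> carrier R"
      unfolding G_def by blast
    show "(a \<odot>\<^bsub>M\<^esub> x, a \<odot>\<^bsub>E\<^esub> u) \<in> G"
      by (rule GI[of "a \<otimes>\<^bsub>R\<^esub> r" "a \<odot>\<^bsub>M\<^esub> t"])
        (use * y tc T'(4) in \<open>simp_all add: M.smult_r_distr M.smult_assoc1 ps\<close>)
  next
    fix u assume "(\<zero>\<^bsub>M\<^esub>, u) \<in> G"
    then obtain r t where *: "r \<in> carrier R" "t \<in> T" "\<zero>\<^bsub>M\<^esub> = r \<odot>\<^bsub>M\<^esub> y \<oplus>\<^bsub>M\<^esub> t" "u = p r"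
      unfolding G_def by blast
    then have "r \<odot>\<^bsub>M\<^esub> y = \<ominus>\<^bsub>M\<^esub> t" using y tc by (metis M.M.minus_equality M.smult_closed)
    then have "r \<in> J" using *(1,2) T'(3) by (simp add: J_def)
    then show "u = \<zero>\<^bsub>E\<^esub>" using p0 Jm * by auto
  qed
  moreover have "G \<noteq> {}" using GI[OF _ T0] R.zero_closed by blast
  ultimately obtain \<phi> where \<phi>: "\<phi> \<in> mod_hom R M E" "\<And>x u. (x, u) \<in> G \<Longrightarrow> \<phi> x = u"
    using partial_graph_hom[OF inj M] by metis
  have "\<phi> t = \<zero>\<^bsub>E\<^esub>" if t: "t \<in> T" for t
    using \<phi>(2)[OF GI[OF R.zero_closed t refl refl]] t tc y p0 by simp
  moreover have "\<phi> y = p \<one>\<^bsub>R\<^esub>" using \<phi>(2)[OF GI[OF R.one_closed T0 refl refl]] y by simp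
  moreover have "\<one>\<^bsub>R\<^esub> \<notin> m" using m.I_notcarr m.one_imp_carrier by auto
  ultimately show thesis using that \<phi>(1) p0 by simp
qed

section \<open>Finitely presented modules\<close>

text \<open>
A presentation \<open>R\<^sup>J \<rightarrow> R\<^sup>K \<rightarrow> U \<rightarrow> 0\<close> with \<open>J\<close> and \<open>K\<close> finite; \<open>r j\<close> lists the coefficients of the
\<open>j\<close>-th relation. Arbitrary index types allow generators and relations to index themselves.
\<close>

locale finite_presentation = module R U
  for R :: "('r, 's) ring_scheme" (structure) and U :: "('r, 'u) module" (structure) +
  fixes K :: "'k set" and a :: "'k \<Rightarrow> 'u" and J :: "'j set" and r :: "'j \<Rightarrow> 'k \<Rightarrow> 'r"
  assumes finite_gens: "finite K" and finite_rels: "finite J"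
    and gen_closed: "a \<in> K \<rightarrow> carrier U"
    and rel_closed: "j \<in> J \<Longrightarrow> r j \<in> K \<rightarrow> carrier R"
    and gens_span: "u \<in> carrier U \<Longrightarrow> \<exists>c\<in>K \<rightarrow> carrier R. u = (\<Oplus>\<^bsub>U\<^esub>k\<in>K. c k \<odot>\<^bsub>U\<^esub> a k)"
    and rels_hold: "j \<in> J \<Longrightarrow> (\<Oplus>\<^bsub>U\<^esub>k\<in>K. r j k \<odot>\<^bsub>U\<^esub> a k) = \<zero>\<^bsub>U\<^esub>"
    and rels_span: "c \<in> K \<rightarrow> carrier R \<Longrightarrow> (\<Oplus>\<^bsub>U\<^esub>k\<in>K. c k \<odot>\<^bsub>U\<^esub> a k) = \<zero>\<^bsub>U\<^esub> \<Longrightarrow>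
      \<exists>d\<in>J \<rightarrow> carrier R. \<forall>k\<in>K. c k = (\<Oplus>j\<in>J. d j \<otimes> r j k)"
begin

lemma rel_mem: "j \<in> J \<Longrightarrow> k \<in> K \<Longrightarrow> r j k \<in> carrier R"
  using rel_closed by auto

lemma rel_column: "k \<in> K \<Longrightarrow> (\<lambda>j. r j k) \<in> J \<rightarrow> carrier R"
  using rel_mem by auto

text \<open>
The universal property of the presentation: \<open>Hom(U, M)\<close> is the kernel of \<open>M\<^sup>K \<rightarrow> M\<^sup>J\<close>.
\<close>

lemma hom_lift:
  assumes M: "module R M" and x: "x \<in> K \<rightarrow> carrier M"
    and rel: "\<And>j. j \<in> J \<Longrightarrow> (\<Oplus>\<^bsub>M\<^esub>k\<in>K. r j k \<odot>\<^bsub>M\<^esub> x k) = \<zero>\<^bsub>M\<^esub>"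
  obtains h where "h \<in> mod_hom R U M" "\<And>k. k \<in> K \<Longrightarrow> h (a k) = x k"
proof -
  interpret M: module R M by fact
  define G where "G = {((\<Oplus>\<^bsub>U\<^esub>k\<in>K. c k \<odot>\<^bsub>U\<^esub> a k), (\<Oplus>\<^bsub>M\<^esub>k\<in>K. c k \<odot>\<^bsub>M\<^esub> x k)) | c.
    c \<in> K \<rightarrow> carrier R}"
  have GI: "(u, v) \<in> G" if "c \<in> K \<rightarrow> carrier R" "u = (\<Oplus>\<^bsub>U\<^esub>k\<in>K. c k \<odot>\<^bsub>U\<^esub> a k)"
    "v = (\<Oplus>\<^bsub>M\<^esub>k\<in>K. c k \<odot>\<^bsub>M\<^esub> x k)" for u v c
    using that unfolding G_def by blast
  have GE: "\<exists>c\<in>K \<rightarrow> carrier R. u = (\<Oplus>\<^bsub>U\<^esub>k\<in>K. c k \<odot>\<^bsub>U\<^esub> a k) \<and>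
    v = (\<Oplus>\<^bsub>M\<^esub>k\<in>K. c k \<odot>\<^bsub>M\<^esub> x k)" if "(u, v) \<in> G" for u v
    using that unfolding G_def by blast
  have "partial_graph R U M G"
    unfolding partial_graph_def
  proof (intro conjI allI impI)
    show "G \<subseteq> carrier U \<times> carrier M"
      unfolding G_def using lincomb_closed[OF _ gen_closed] M.lincomb_closed[OF _ x] by blast
  next
    fix u v u' v' assume "(u, v) \<in> G" "(u', v') \<in> G"
    then obtain c c' where "c \<in> K \<rightarrow> carrier R" "c' \<in> K \<rightarrow> carrier R"
      and "u = (\<Oplus>\<^bsub>U\<^esub>k\<in>K. c k \<odot>\<^bsub>U\<^esub> a k)" "v = (\<Oplus>\<^bsub>M\<^esub>k\<in>K. c k \<odot>\<^bsub>M\<^esub> x k)"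
      and "u' = (\<Oplus>\<^bsub>U\<^esub>k\<in>K. c' k \<odot>\<^bsub>U\<^esub> a k)" "v' = (\<Oplus>\<^bsub>M\<^esub>k\<in>K. c' k \<odot>\<^bsub>M\<^esub> x k)"
      using GE by meson
    then show "(u \<oplus>\<^bsub>U\<^esub> u', v \<oplus>\<^bsub>M\<^esub> v') \<in> G"
      using gen_closed x
      by (intro GI[of "\<lambda>k. c k \<oplus> c' k"]) (auto simp: lincomb_add_left M.lincomb_add_left)
  next
    fix b u v assume "b \<in> carrier R" "(u, v) \<in> G"
    moreover from GE[OF this(2)] obtain c where "c \<in> K \<rightarrow> carrier R"
      "u = (\<Oplus>\<^bsub>U\<^esub>k\<in>K. c k \<odot>\<^bsub>U\<^esub> a k)" "v = (\<Oplus>\<^bsub>M\<^esub>k\<in>K. c k \<odot>\<^bsub>M\<^esub> x k)" by blast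
    ultimately show "(b \<odot>\<^bsub>U\<^esub> u, b \<odot>\<^bsub>M\<^esub> v) \<in> G"
      using gen_closed x finite_gens
      by (intro GI[of "\<lambda>k. b \<otimes> c k"]) (auto simp: lincomb_smult_left M.lincomb_smult_left)
  next
    fix v assume "(\<zero>\<^bsub>U\<^esub>, v) \<in> G"
    from GE[OF this] obtain c where c: "c \<in> K \<rightarrow> carrier R" "(\<Oplus>\<^bsub>U\<^esub>k\<in>K. c k \<odot>\<^bsub>U\<^esub> a k) = \<zero>\<^bsub>U\<^esub>"
      and v: "v = (\<Oplus>\<^bsub>M\<^esub>k\<in>K. c k \<odot>\<^bsub>M\<^esub> x k)" by auto
    obtain d where d: "d \<in> J \<rightarrow> carrier R" "\<And>k. k \<in> K \<Longrightarrow> c k = (\<Oplus>j\<in>J. d j \<otimes> r j k)"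
      using rels_span[OF c] by blast
    have "v = (\<Oplus>\<^bsub>M\<^esub>k\<in>K. \<Oplus>\<^bsub>M\<^esub>j\<in>J. d j \<odot>\<^bsub>M\<^esub> (r j k \<odot>\<^bsub>M\<^esub> x k))"
      unfolding v
    proof (intro M.M.finsum_cong' refl)
      fix k assume k: "k \<in> K"
      have "c k \<odot>\<^bsub>M\<^esub> x k = (\<Oplus>\<^bsub>M\<^esub>j\<in>J. (d j \<otimes> r j k) \<odot>\<^bsub>M\<^esub> x k)"
        using d x k finite_rels rel_mem by (auto intro!: M.finsum_smult_rdistr)
      also have "\<dots> = (\<Oplus>\<^bsub>M\<^esub>j\<in>J. d j \<odot>\<^bsub>M\<^esub> (r j k \<odot>\<^bsub>M\<^esub> x k))"
        using d x k rel_mem by (intro M.M.finsum_cong') (auto simp: M.smult_assoc1 Pi_iff)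
      finally show "c k \<odot>\<^bsub>M\<^esub> x k = (\<Oplus>\<^bsub>M\<^esub>j\<in>J. d j \<odot>\<^bsub>M\<^esub> (r j k \<odot>\<^bsub>M\<^esub> x k))" .
    qed (use d x rel_mem in \<open>auto intro!: M.M.finsum_closed simp: Pi_iff\<close>)
    also have "\<dots> = (\<Oplus>\<^bsub>M\<^esub>j\<in>J. \<Oplus>\<^bsub>M\<^esub>k\<in>K. d j \<odot>\<^bsub>M\<^esub> (r j k \<odot>\<^bsub>M\<^esub> x k))"
      using finite_gens finite_rels d x rel_mem by (intro M.M.finsum_swap) (auto simp: Pi_iff)
    also have "\<dots> = \<zero>\<^bsub>M\<^esub>"
    proof (rule M.M.add.finprod_one_eqI)
      fix j assume j: "j \<in> J"
      then have "(\<Oplus>\<^bsub>M\<^esub>k\<in>K. d j \<odot>\<^bsub>M\<^esub> (r j k \<odot>\<^bsub>M\<^esub> x k)) = d j \<odot>\<^bsub>M\<^esub> \<zero>\<^bsub>M\<^esub>"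
        using finite_gens d x rel_mem unfolding rel[OF j, symmetric]
        by (intro M.finsum_smult_ldistr[symmetric]) (auto simp: Pi_iff)
      then show "(\<Oplus>\<^bsub>M\<^esub>k\<in>K. d j \<odot>\<^bsub>M\<^esub> (r j k \<odot>\<^bsub>M\<^esub> x k)) = \<zero>\<^bsub>M\<^esub>"
        using d j by (simp add: Pi_iff)
    qed
    finally show "v = \<zero>\<^bsub>M\<^esub>" .
  qed
  moreover have "carrier U \<subseteq> Domain G"
  proof
    fix u assume "u \<in> carrier U"
    from gens_span[OF this] show "u \<in> Domain G" unfolding G_def by blast
  qed
  ultimately obtain h where h: "h \<in> mod_hom R U M" "\<And>u v. (u, v) \<in> G \<Longrightarrow> h u = v"
    using total_partial_graph_hom[OF module_axioms M] by metis
  have "h (a k) = x k" if k: "k \<in> K" for k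
  proof (intro h(2) GI[of "\<lambda>l. if l = k then \<one> else \<zero>"])
    have *: "(\<Oplus>\<^bsub>N\<^esub>l\<in>K. (if l = k then \<one> else \<zero>) \<odot>\<^bsub>N\<^esub> y l) = y k"
      if N: "module R N" and y: "y \<in> K \<rightarrow> carrier N" for N :: "('r, 'z) module" and y
    proof -
      interpret N: module R N by fact
      have "(\<Oplus>\<^bsub>N\<^esub>l\<in>K. (if l = k then \<one> else \<zero>) \<odot>\<^bsub>N\<^esub> y l) =
          (\<Oplus>\<^bsub>N\<^esub>l\<in>K. if l = k then y k else \<zero>\<^bsub>N\<^esub>)"
        using y k by (intro N.M.finsum_cong') (auto simp: Pi_iff)
      then show ?thesis using N.M.finsum_delta[OF finite_gens k] y k by auto
    qed
    show "a k = (\<Oplus>\<^bsub>U\<^esub>l\<in>K. (if l = k then \<one> else \<zero>) \<odot>\<^bsub>U\<^esub> a l)"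
      using *[OF module_axioms gen_closed] by simp
    show "x k = (\<Oplus>\<^bsub>M\<^esub>l\<in>K. (if l = k then \<one> else \<zero>) \<odot>\<^bsub>M\<^esub> x l)"
      using *[OF M x] by simp
  qed auto
  with h(1) that show thesis by blast
qed

lemma hom_eq_zero:
  assumes M: "module R M" and h: "h \<in> mod_hom R U M"
    and z: "\<And>k. k \<in> K \<Longrightarrow> h (a k) = \<zero>\<^bsub>M\<^esub>" and u: "u \<in> carrier U"
  shows "h u = \<zero>\<^bsub>M\<^esub>"
proof -
  interpret M: module R M by fact
  obtain c where c: "c \<in> K \<rightarrow> carrier R" "u = (\<Oplus>\<^bsub>U\<^esub>k\<in>K. c k \<odot>\<^bsub>U\<^esub> a k)"
    using gens_span[OF u] by blast
  have "h u = (\<Oplus>\<^bsub>M\<^esub>k\<in>K. c k \<odot>\<^bsub>M\<^esub> h (a k))"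
    unfolding c(2) by (rule mod_hom_lincomb[OF module_axioms M h c(1) gen_closed])
  also have "\<dots> = \<zero>\<^bsub>M\<^esub>" by (rule M.lincomb_zero[OF c(1) z])
  finally show ?thesis .
qed

text \<open>
The hypothesis says that \<open>a\<^sub>k \<otimes> y\<close> vanishes in \<open>U \<otimes> N\<close>, the cokernel of the relation matrix on
powers of \<open>N\<close>. A homomorphism \<open>h : N \<rightarrow> U\<^sup>\<circ>\<close> is a bilinear map \<open>U \<times> N \<rightarrow> E\<close>, hence factors through
\<open>U \<otimes> N\<close>; the computation exchanges two finite sums so that the relations are applied in \<open>U\<close>.
\<close>

lemma tensor_relation_annihilates:
  assumes N: "module R N" and E: "module R E" and h: "h \<in> mod_hom R N (hom_module R U E)"
    and y: "y \<in> carrier N" and z: "z \<in> J \<rightarrow> carrier N" and k: "k \<in> K"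
    and rel: "\<And>l. l \<in> K \<Longrightarrow>
      (\<Oplus>\<^bsub>N\<^esub>j\<in>J. r j l \<odot>\<^bsub>N\<^esub> z j) = (if l = k then y else \<zero>\<^bsub>N\<^esub>)"
  shows "h y (a k) = \<zero>\<^bsub>E\<^esub>"
proof -
  interpret N: module R N by fact
  interpret E: module R E by fact
  note ac = funcset_mem[OF gen_closed]
  have at_gen: "(\<lambda>y. h y (a l)) \<in> mod_hom R N E" if "l \<in> K" for l
    by (rule mod_hom_comp[OF h eval_hom[OF ac[OF that]]])
  have hz: "h (z j) \<in> mod_hom R U E" if "j \<in> J" for j
    using mod_homD(1)[OF h funcset_mem[OF z that]] by (simp add: hom_module_carrier)
  have hc: "h (z j) (a l) \<in> carrier E" if "j \<in> J" "l \<in> K" for j l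
    using mod_homD(1)[OF hz[OF that(1)] ac[OF that(2)]] .
  have "h y (a k) = (\<Oplus>\<^bsub>E\<^esub>l\<in>K. if l = k then h y (a k) else \<zero>\<^bsub>E\<^esub>)"
    using E.M.finsum_delta[OF finite_gens k] mod_homD(1)[OF at_gen[OF k] y] by simp
  also have "\<dots> = (\<Oplus>\<^bsub>E\<^esub>l\<in>K. \<Oplus>\<^bsub>E\<^esub>j\<in>J. r j l \<odot>\<^bsub>E\<^esub> h (z j) (a l))"
  proof (intro E.M.finsum_cong' refl)
    fix l assume l: "l \<in> K"
    have "(if l = k then h y (a k) else \<zero>\<^bsub>E\<^esub>) = h (if l = k then y else \<zero>\<^bsub>N\<^esub>) (a l)"
      using mod_hom_zero[OF N E at_gen[OF l]] by simp
    also have "\<dots> = h (\<Oplus>\<^bsub>N\<^esub>j\<in>J. r j l \<odot>\<^bsub>N\<^esub> z j) (a l)"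
      by (simp only: rel[OF l])
    also have "\<dots> = (\<Oplus>\<^bsub>E\<^esub>j\<in>J. r j l \<odot>\<^bsub>E\<^esub> h (z j) (a l))"
      by (rule mod_hom_lincomb[OF N E at_gen[OF l] rel_column[OF l] z])
    finally show "(if l = k then h y (a k) else \<zero>\<^bsub>E\<^esub>) =
      (\<Oplus>\<^bsub>E\<^esub>j\<in>J. r j l \<odot>\<^bsub>E\<^esub> h (z j) (a l))" .
  qed (auto intro!: E.M.finsum_closed simp: hc rel_mem)
  also have "\<dots> = (\<Oplus>\<^bsub>E\<^esub>j\<in>J. \<Oplus>\<^bsub>E\<^esub>l\<in>K. r j l \<odot>\<^bsub>E\<^esub> h (z j) (a l))"
    by (intro E.M.finsum_swap) (auto simp: finite_gens finite_rels hc rel_mem)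
  also have "\<dots> = \<zero>\<^bsub>E\<^esub>"
  proof (rule E.M.add.finprod_one_eqI)
    fix j assume j: "j \<in> J"
    show "(\<Oplus>\<^bsub>E\<^esub>l\<in>K. r j l \<odot>\<^bsub>E\<^esub> h (z j) (a l)) = \<zero>\<^bsub>E\<^esub>"
      using mod_hom_lincomb[OF module_axioms E hz[OF j] rel_closed[OF j] gen_closed]
        mod_hom_zero[OF module_axioms E hz[OF j]] rels_hold[OF j] by simp
  qed
  finally show ?thesis .
qed

text \<open>
This is the injectivity of \<open>U \<otimes> M\<^sup>\<circ> \<rightarrow> Hom(U, M)\<^sup>\<circ>\<close> on elements \<open>a\<^sub>k \<otimes> \<phi>\<close>. The hypothesis says that
\<open>\<phi>\<close> composed with the \<open>k\<close>-th projection vanishes on \<open>Hom(U, M)\<close>, the kernel of the relation map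
\<open>M\<^sup>K \<rightarrow> M\<^sup>J\<close>. It therefore factors through the image of that map and, by injectivity of \<open>E\<close>,
through all of \<open>M\<^sup>J\<close>; the components \<open>M \<rightarrow> E\<close> of the extension are the \<open>\<psi>\<^sub>j\<close>.
\<close>

lemma tensor_vanishes_if_kills_images:
  assumes inj: "injective_module R E" and M: "module R M" and \<phi>: "\<phi> \<in> mod_hom R M E"
    and k: "k \<in> K" and kill: "\<And>f. f \<in> mod_hom R U M \<Longrightarrow> \<phi> (f (a k)) = \<zero>\<^bsub>E\<^esub>"
  obtains \<psi> where "\<psi> \<in> J \<rightarrow> carrier (hom_module R M E)"
    and "\<And>l. l \<in> K \<Longrightarrow> (\<Oplus>\<^bsub>hom_module R M E\<^esub>j\<in>J. r j l \<odot>\<^bsub>hom_module R M E\<^esub> \<psi> j) =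
      (if l = k then restrict \<phi> (carrier M) else \<zero>\<^bsub>hom_module R M E\<^esub>)"
proof -
  have E: "module R E" using inj by (simp add: injective_module_def)
  interpret M: module R M by fact
  interpret E: module R E by fact
  let ?D = "hom_module R M E"
  have D: "module R ?D" by (rule hom_module_module[OF M E])
  interpret D: module R ?D by fact
  let ?P = "direct_product J (\<lambda>_. M)"
  have P: "module R ?P" using M R.is_cring by (intro direct_product_module)
  interpret P: module R ?P by fact
  define row where "row x = (\<lambda>j\<in>J. \<Oplus>\<^bsub>M\<^esub>l\<in>K. r j l \<odot>\<^bsub>M\<^esub> x l)" for x
  have rowc: "row x \<in> carrier ?P" if "x \<in> K \<rightarrow> carrier M" for x
    using M.lincomb_closed[OF rel_closed that] by (auto simp: row_def direct_product_def)
  define G where "G = {(row x, \<phi> (x k)) | x. x \<in> K \<rightarrow> carrier M}"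
  have GI: "(w, e) \<in> G" if "x \<in> K \<rightarrow> carrier M" "w = row x" "e = \<phi> (x k)" for w e x
    using that unfolding G_def by blast
  have "partial_graph R ?P E G"
    unfolding partial_graph_def
  proof (intro conjI allI impI)
    show "G \<subseteq> carrier ?P \<times> carrier E"
      unfolding G_def using rowc mod_homD(1)[OF \<phi>] k by blast
  next
    fix w e w' e' assume "(w, e) \<in> G" "(w', e') \<in> G"
    then obtain x x' where x: "x \<in> K \<rightarrow> carrier M" "x' \<in> K \<rightarrow> carrier M"
      and e: "w = row x" "e = \<phi> (x k)" "w' = row x'" "e' = \<phi> (x' k)" unfolding G_def by blast
    show "(w \<oplus>\<^bsub>?P\<^esub> w', e \<oplus>\<^bsub>E\<^esub> e') \<in> G"
    proof (rule GI[of "\<lambda>l. x l \<oplus>\<^bsub>M\<^esub> x' l"])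
      show "w \<oplus>\<^bsub>?P\<^esub> w' = row (\<lambda>l. x l \<oplus>\<^bsub>M\<^esub> x' l)"
        by (auto simp: e row_def direct_product_def fun_eq_iff M.lincomb_add_right[OF rel_closed x])
    qed (use x e k mod_homD(2)[OF \<phi>] in \<open>auto simp: Pi_iff\<close>)
  next
    fix b w e assume b: "b \<in> carrier R" and "(w, e) \<in> G"
    then obtain x where x: "x \<in> K \<rightarrow> carrier M" and e: "w = row x" "e = \<phi> (x k)"
      unfolding G_def by blast
    show "(b \<odot>\<^bsub>?P\<^esub> w, b \<odot>\<^bsub>E\<^esub> e) \<in> G"
    proof (rule GI[of "\<lambda>l. b \<odot>\<^bsub>M\<^esub> x l"])
      show "b \<odot>\<^bsub>?P\<^esub> w = row (\<lambda>l. b \<odot>\<^bsub>M\<^esub> x l)"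
        by (auto simp: e row_def direct_product_def fun_eq_iff
            M.lincomb_smult_right[OF finite_gens b rel_closed x])
    qed (use b x e k mod_homD(3)[OF \<phi>] in \<open>auto simp: Pi_iff\<close>)
  next
    fix e assume "(\<zero>\<^bsub>?P\<^esub>, e) \<in> G"
    then obtain x where x: "x \<in> K \<rightarrow> carrier M" and e: "\<zero>\<^bsub>?P\<^esub> = row x" "e = \<phi> (x k)"
      unfolding G_def by blast
    have "(\<Oplus>\<^bsub>M\<^esub>l\<in>K. r j l \<odot>\<^bsub>M\<^esub> x l) = \<zero>\<^bsub>M\<^esub>" if "j \<in> J" for j
      using fun_cong[OF e(1)[symmetric], of j] that by (simp add: row_def direct_product_def)
    from hom_lift[OF M x this] obtain f where
      f: "f \<in> mod_hom R U M" "\<And>l. l \<in> K \<Longrightarrow> f (a l) = x l" by blast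
    show "e = \<zero>\<^bsub>E\<^esub>" using kill[OF f(1)] f(2)[OF k] e(2) by simp
  qed
  moreover have "G \<noteq> {}"
    using GI[of "\<lambda>_. \<zero>\<^bsub>M\<^esub>"] by blast
  ultimately obtain g where g: "g \<in> mod_hom R ?P E" and gG: "\<And>w e. (w, e) \<in> G \<Longrightarrow> g w = e"
    using partial_graph_hom[OF inj P] by metis
  define \<psi> where "\<psi> j = (\<lambda>x\<in>carrier M. g (single J M j x))" for j
  have \<psi>: "\<psi> \<in> J \<rightarrow> carrier ?D"
    unfolding \<psi>_def using restrict_hom_module[OF M mod_hom_comp[OF single_hom[OF M] g]] by auto
  have "(\<Oplus>\<^bsub>?D\<^esub>j\<in>J. r j l \<odot>\<^bsub>?D\<^esub> \<psi> j) = (if l = k then restrict \<phi> (carrier M) else \<zero>\<^bsub>?D\<^esub>)"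
    (is "?s = ?t") if l: "l \<in> K" for l
  proof (rule extensionalityI)
    have "?s \<in> carrier ?D" by (rule D.lincomb_closed[OF rel_column[OF l] \<psi>])
    then show "?s \<in> extensional (carrier M)" by (simp add: hom_module_carrier)
    show "?t \<in> extensional (carrier M)" by (auto simp: hom_module_def)
  next
    fix x assume x: "x \<in> carrier M"
    have sc: "(\<lambda>j. single J M j x) \<in> J \<rightarrow> carrier ?P"
      using mod_homD(1)[OF single_hom[OF M] x] by auto
    \<comment> \<open>The \<open>l\<close>-th column of the relation matrix, scaled by \<open>x\<close>, is the image of the vector with
      single nonzero entry \<open>x\<close> at \<open>l\<close>.\<close>
    let ?x = "\<lambda>l'. if l' = l then x else \<zero>\<^bsub>M\<^esub>"
    have "?s x = (\<Oplus>\<^bsub>E\<^esub>j\<in>J. r j l \<odot>\<^bsub>E\<^esub> \<psi> j x)"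
      by (rule mod_hom_lincomb[OF D E eval_hom[OF x] rel_column[OF l] \<psi>])
    also have "\<dots> = g (\<Oplus>\<^bsub>?P\<^esub>j\<in>J. r j l \<odot>\<^bsub>?P\<^esub> single J M j x)"
      using mod_hom_lincomb[OF P E g rel_column[OF l] sc] x by (simp add: \<psi>_def)
    also have "(\<Oplus>\<^bsub>?P\<^esub>j\<in>J. r j l \<odot>\<^bsub>?P\<^esub> single J M j x) = row ?x" (is "?w = _")
    proof (rule extensionalityI[where A = J])
      have "?w \<in> carrier ?P" by (rule P.lincomb_closed[OF rel_column[OF l] sc])
      then show "?w \<in> extensional J" by (simp add: direct_product_def PiE_def)
      show "row ?x \<in> extensional J" by (simp add: row_def)
    next
      fix i assume i: "i \<in> J"
      have "?w i = (\<Oplus>\<^bsub>M\<^esub>j\<in>J. r j l \<odot>\<^bsub>M\<^esub> single J M j x i)"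
        by (rule mod_hom_lincomb[OF P M proj_hom[OF i] rel_column[OF l] sc])
      also have "\<dots> = (\<Oplus>\<^bsub>M\<^esub>j\<in>J. r j l \<odot>\<^bsub>M\<^esub> (if j = i then x else \<zero>\<^bsub>M\<^esub>))"
        using i by (simp add: single_def eq_commute)
      also have "\<dots> = r i l \<odot>\<^bsub>M\<^esub> x"
        by (rule M.lincomb_delta[OF finite_rels i rel_column[OF l] x])
      also have "\<dots> = (\<Oplus>\<^bsub>M\<^esub>l'\<in>K. r i l' \<odot>\<^bsub>M\<^esub> ?x l')"
        by (rule M.lincomb_delta[OF finite_gens l rel_closed[OF i] x, symmetric])
      finally show "?w i = row ?x i" using i by (simp add: row_def)
    qed
    also have "g (row ?x) = \<phi> (?x k)"
      by (rule gG, rule GI[of ?x]) (use x in auto)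
    also have "\<dots> = ?t x"
      using x mod_hom_zero[OF M E \<phi>] by (auto simp: hom_module_def)
    finally show "?s x = ?t x" .
  qed
  with \<psi> that show thesis by blast
qed

end

section \<open>Matlis duality between generation and cogeneration\<close>

lemma dual_cogenerated_if_generated:
  assumes U: "module R U" and M: "module R M" and E: "module R E" and gen: "generated_by R U M"
  shows "cogenerated_by R (hom_module R U E) (hom_module R M E)"
  unfolding cogenerated_by_iff[OF hom_module_module[OF M E] hom_module_module[OF U E]]
proof (intro ballI impI)
  interpret M: module R M by fact
  interpret E: module R E by fact
  fix \<phi> assume \<phi>: "\<phi> \<in> carrier (hom_module R M E)" "\<phi> \<noteq> \<zero>\<^bsub>hom_module R M E\<^esub>"
  then obtain y where y: "y \<in> carrier M" "\<phi> y \<noteq> \<zero>\<^bsub>E\<^esub>" by (rule hom_module_nonzero)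
  have \<phi>h: "\<phi> \<in> mod_hom R M E" using \<phi>(1) by (simp add: hom_module_carrier)
  have "y \<in> hom_trace R U M" using gen y(1) unfolding generated_by_iff[OF U M] by blast
  then have "\<exists>f\<in>mod_hom R U M. \<exists>u\<in>carrier U. \<phi> (f u) \<noteq> \<zero>\<^bsub>E\<^esub>"
    using y(2)
  proof induction
    case zero
    then show ?case using mod_hom_zero[OF M E \<phi>h] by simp
  next
    case (add t f u)
    have t: "t \<in> carrier M"
      using add.hyps(1) M.submoduleE(1)[OF hom_trace_submodule[OF M]] by blast
    show ?case
    proof (cases "\<phi> (f u) = \<zero>\<^bsub>E\<^esub>")
      case True
      then have "\<phi> (t \<oplus>\<^bsub>M\<^esub> f u) = \<phi> t"
        using t mod_homD(1)[OF add.hyps(2,3)] mod_homD(1,2)[OF \<phi>h] by simp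
      then show ?thesis using add by simp
    qed (use add in blast)
  qed
  then obtain f u where f: "f \<in> mod_hom R U M" "u \<in> carrier U" "\<phi> (f u) \<noteq> \<zero>\<^bsub>E\<^esub>" by blast
  show "\<exists>h\<in>mod_hom R (hom_module R M E) (hom_module R U E). h \<phi> \<noteq> \<zero>\<^bsub>hom_module R U E\<^esub>"
  proof (intro bexI)
    show "(\<lambda>\<phi>. \<lambda>u\<in>carrier U. \<phi> (f u)) \<in> mod_hom R (hom_module R M E) (hom_module R U E)"
      by (rule hom_precomp[OF U f(1)])
    show "(\<lambda>u\<in>carrier U. \<phi> (f u)) \<noteq> \<zero>\<^bsub>hom_module R U E\<^esub>"
      by (rule hom_module_nonzeroI[OF f(2)]) (use f in simp)
  qed
qed

lemma cogenerated_if_dual_generated: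
  fixes R :: "('r, 's) ring_scheme"
  assumes loc: "local_ring R m" and hull: "injective_hull R (quotient_module R m) E"
    and U: "module R U" and N: "module R N" and gen: "generated_by R U (hom_module R N E)"
  shows "cogenerated_by R (hom_module R U E) N"
proof -
  have E: "module R E" using hull by (simp add: injective_hull_def injective_module_def)
  interpret N: module R N by fact
  interpret E: module R E by fact
  let ?D = "hom_module R N E"
  have D: "module R ?D" by (rule hom_module_module[OF N E])
  interpret D: module R ?D by fact
  show ?thesis
    unfolding cogenerated_by_iff[OF N hom_module_module[OF U E]]
  proof (intro ballI impI)
    fix y assume y: "y \<in> carrier N" "y \<noteq> \<zero>\<^bsub>N\<^esub>"
    have T: "submodule {\<zero>\<^bsub>N\<^esub>} R N" by (rule N.submoduleI) auto
    obtain \<phi> where \<phi>: "\<phi> \<in> mod_hom R N E" "\<phi> y \<noteq> \<zero>\<^bsub>E\<^esub>"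
      using hull_separates[OF loc hull N T y(1)] y(2) by blast
    have "restrict \<phi> (carrier N) \<in> hom_trace R U ?D"
      using gen restrict_hom_module[OF N \<phi>(1)] unfolding generated_by_iff[OF U D] by blast
    moreover have "restrict \<phi> (carrier N) y \<noteq> \<zero>\<^bsub>E\<^esub>" using \<phi>(2) y(1) by simp
    ultimately have "\<exists>h\<in>mod_hom R U ?D. \<exists>u\<in>carrier U. h u y \<noteq> \<zero>\<^bsub>E\<^esub>"
    proof induction
      case zero
      then show ?case using y(1) by (simp add: hom_module_def)
    next
      case (add t h u)
      have t: "t \<in> carrier ?D"
        using add.hyps(1) D.submoduleE(1)[OF hom_trace_submodule[OF D]] by blast
      show ?case
      proof (cases "h u y = \<zero>\<^bsub>E\<^esub>")
        case True
        then have "(t \<oplus>\<^bsub>?D\<^esub> h u) y = t y"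
          using y(1) mod_homD(1)[OF eval_hom[OF y(1)] t]
            mod_homD(2)[OF eval_hom[OF y(1)] t mod_homD(1)[OF add.hyps(2,3)]] by simp
        then show ?thesis using add by simp
      qed (use add in blast)
    qed
    then obtain h u where h: "h \<in> mod_hom R U ?D" "u \<in> carrier U" "h u y \<noteq> \<zero>\<^bsub>E\<^esub>" by blast
    show "\<exists>h\<in>mod_hom R N (hom_module R U E). h y \<noteq> \<zero>\<^bsub>hom_module R U E\<^esub>"
    proof (intro bexI)
      show "(\<lambda>y. \<lambda>u\<in>carrier U. h u y) \<in> mod_hom R N (hom_module R U E)"
        by (rule hom_flip[OF U N E h(1)])
      show "(\<lambda>u\<in>carrier U. h u y) \<noteq> \<zero>\<^bsub>hom_module R U E\<^esub>"
        by (rule hom_module_nonzeroI[OF h(2)]) (use h in simp)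
    qed
  qed
qed

context finite_presentation
begin

lemma generated_if_dual_cogenerated:
  assumes loc: "local_ring R m" and hull: "injective_hull R (quotient_module R m) E"
    and M: "module R M" and cog: "cogenerated_by R (hom_module R U E) (hom_module R M E)"
  shows "generated_by R U M"
  unfolding generated_by_iff[OF module_axioms M]
proof (rule subsetI, rule ccontr)
  have inj: "injective_module R E" using hull by (simp add: injective_hull_def)
  then have E: "module R E" by (simp add: injective_module_def)
  interpret M: module R M by fact
  interpret E: module R E by fact
  let ?D = "hom_module R M E"
  have D: "module R ?D" by (rule hom_module_module[OF M E])
  note T = hom_trace_submodule[OF M, of U]
  fix y assume y: "y \<in> carrier M" "y \<notin> hom_trace R U M"
  obtain \<phi> where \<phi>: "\<phi> \<in> mod_hom R M E" "\<phi> y \<noteq> \<zero>\<^bsub>E\<^esub>"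
    and kill: "\<And>t. t \<in> hom_trace R U M \<Longrightarrow> \<phi> t = \<zero>\<^bsub>E\<^esub>"
    using hull_separates[OF loc hull M T y] by blast
  let ?\<phi> = "restrict \<phi> (carrier M)"
  have \<phi>D: "?\<phi> \<in> carrier ?D" by (rule restrict_hom_module[OF M \<phi>(1)])
  have "?\<phi> \<noteq> \<zero>\<^bsub>?D\<^esub>" by (rule hom_module_nonzeroI[OF y(1)]) (use \<phi>(2) y(1) in simp)
  then obtain h where h: "h \<in> mod_hom R ?D (hom_module R U E)" "h ?\<phi> \<noteq> \<zero>\<^bsub>hom_module R U E\<^esub>"
    using cog \<phi>D unfolding cogenerated_by_iff[OF D hom_module_module[OF module_axioms E]] by blast
  have h\<phi>: "h ?\<phi> \<in> carrier (hom_module R U E)" by (rule mod_homD(1)[OF h(1) \<phi>D])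
  then have h\<phi>': "h ?\<phi> \<in> mod_hom R U E" by (simp add: hom_module_carrier)
  have "h ?\<phi> (a k) = \<zero>\<^bsub>E\<^esub>" if k: "k \<in> K" for k
  proof -
    have ak: "a k \<in> carrier U" using gen_closed k by blast
    have z: "\<phi> (f (a k)) = \<zero>\<^bsub>E\<^esub>" if "f \<in> mod_hom R U M" for f
      using kill[OF hom_trace.add[OF hom_trace.zero that ak]] mod_homD(1)[OF that ak] by simp
    obtain \<psi> where "\<psi> \<in> J \<rightarrow> carrier ?D" and "\<And>l. l \<in> K \<Longrightarrow>
        (\<Oplus>\<^bsub>?D\<^esub>j\<in>J. r j l \<odot>\<^bsub>?D\<^esub> \<psi> j) = (if l = k then ?\<phi> else \<zero>\<^bsub>?D\<^esub>)"
      by (rule tensor_vanishes_if_kills_images[OF inj M \<phi>(1) k]) (erule z, rule that)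
    then show ?thesis by (rule tensor_relation_annihilates[OF D E h(1) \<phi>D _ k])
  qed
  from hom_eq_zero[OF E h\<phi>' this] show False
    using hom_module_nonzero[OF h\<phi> h(2)] by metis
qed

text \<open>
The embedding \<open>y \<mapsto> (a\<^sub>k \<otimes> y)\<^sub>k\<close> of \<open>N\<close> into \<open>(U \<otimes> N)\<^sup>K\<close> is lifted to the \<open>K \<times> K\<close> matrices over
\<open>N\<close>: the quotient by the relations disappears, and \<open>\<phi>\<close> is extended from the diagonal matrices
\<open>y \<cdot> 1\<close> plus matrices whose rows are combinations of relations, on which it is set to be zero. Row \<open>k\<close> of the
extension satisfies the relations of \<open>U\<close>, hence defines \<open>h\<^sub>k : U \<rightarrow> N\<^sup>\<circ>\<close>, and evaluating the
extension at \<open>y \<cdot> 1\<close> shows that \<open>\<phi>\<close> is the sum of the \<open>h\<^sub>k a\<^sub>k\<close>.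
\<close>

lemma dual_generated_if_cogenerated:
  assumes inj: "injective_module R E" and N: "module R N"
    and cog: "cogenerated_by R (hom_module R U E) N"
  shows "generated_by R U (hom_module R N E)"
proof -
  have E: "module R E" using inj by (simp add: injective_module_def)
  interpret N: module R N by fact
  interpret E: module R E by fact
  let ?D = "hom_module R N E"
  have D: "module R ?D" by (rule hom_module_module[OF N E])
  interpret D: module R ?D by fact
  let ?Q = "direct_product (K \<times> K) (\<lambda>_. N)"
  have Q: "module R ?Q" using N R.is_cring by (intro direct_product_module)
  interpret Q: module R ?Q by fact
  let ?e = "single (K \<times> K) N"
  have ec: "?e p x \<in> carrier ?Q" if "x \<in> carrier N" for p x
    by (rule mod_homD(1)[OF single_hom[OF N] that])
  have Q_ext: "v = w" if "v \<in> carrier ?Q" "w \<in> carrier ?Q"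
    "\<And>k l. k \<in> K \<Longrightarrow> l \<in> K \<Longrightarrow> v (k, l) = w (k, l)" for v w
    using that by (intro PiE_ext[of v "K \<times> K" "\<lambda>_. carrier N"]) (auto simp: direct_product_def)
  define mat where "mat y z = (\<lambda>(k, l)\<in>K \<times> K.
    (if l = k then y else \<zero>\<^bsub>N\<^esub>) \<oplus>\<^bsub>N\<^esub> (\<Oplus>\<^bsub>N\<^esub>j\<in>J. r j l \<odot>\<^bsub>N\<^esub> z k j))" for y z
  have Sc: "(\<Oplus>\<^bsub>N\<^esub>j\<in>J. r j l \<odot>\<^bsub>N\<^esub> z k j) \<in> carrier N"
    if "z \<in> K \<rightarrow> J \<rightarrow> carrier N" "k \<in> K" "l \<in> K" for z k l
    using N.lincomb_closed[OF rel_column[OF that(3)]] that by blast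
  have matc: "mat y z \<in> carrier ?Q" if "y \<in> carrier N" "z \<in> K \<rightarrow> J \<rightarrow> carrier N" for y z
    using that Sc by (auto simp: mat_def direct_product_def)
  have mat_ev: "mat y z (k, l) =
    (if l = k then y else \<zero>\<^bsub>N\<^esub>) \<oplus>\<^bsub>N\<^esub> (\<Oplus>\<^bsub>N\<^esub>j\<in>J. r j l \<odot>\<^bsub>N\<^esub> z k j)"
    if "k \<in> K" "l \<in> K" for y z k l
    using that by (simp add: mat_def)
  have Q_ev: "(v \<oplus>\<^bsub>?Q\<^esub> w) (k, l) = v (k, l) \<oplus>\<^bsub>N\<^esub> w (k, l)"
    "(b \<odot>\<^bsub>?Q\<^esub> v) (k, l) = b \<odot>\<^bsub>N\<^esub> v (k, l)" "\<zero>\<^bsub>?Q\<^esub> (k, l) = \<zero>\<^bsub>N\<^esub>"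
    if "k \<in> K" "l \<in> K" for v w b k l using that by (auto simp: direct_product_def)
  have "\<phi> \<in> hom_trace R U ?D" if \<phi>: "\<phi> \<in> carrier ?D" for \<phi>
  proof -
    have \<phi>h: "\<phi> \<in> mod_hom R N E" using \<phi> by (simp add: hom_module_carrier)
    define G where "G = {(mat y z, \<phi> y) | y z. y \<in> carrier N \<and> z \<in> K \<rightarrow> J \<rightarrow> carrier N}"
    have GI: "(w, e) \<in> G" if "y \<in> carrier N" "z \<in> K \<rightarrow> J \<rightarrow> carrier N" "w = mat y z" "e = \<phi> y"
      for w e y z using that unfolding G_def by blast
    have "partial_graph R ?Q E G"
      unfolding partial_graph_def
    proof (intro conjI allI impI)
      show "G \<subseteq> carrier ?Q \<times> carrier E"
        unfolding G_def using matc mod_homD(1)[OF \<phi>h] by blast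
    next
      fix w e w' e' assume "(w, e) \<in> G" "(w', e') \<in> G"
      then obtain y z y' z' where yz: "y \<in> carrier N" "z \<in> K \<rightarrow> J \<rightarrow> carrier N"
        "y' \<in> carrier N" "z' \<in> K \<rightarrow> J \<rightarrow> carrier N"
        and e: "w = mat y z" "e = \<phi> y" "w' = mat y' z'" "e' = \<phi> y'" unfolding G_def by blast
      let ?z = "\<lambda>k j. z k j \<oplus>\<^bsub>N\<^esub> z' k j"
      show "(w \<oplus>\<^bsub>?Q\<^esub> w', e \<oplus>\<^bsub>E\<^esub> e') \<in> G"
      proof (rule GI[of "y \<oplus>\<^bsub>N\<^esub> y'" ?z])
        show z: "?z \<in> K \<rightarrow> J \<rightarrow> carrier N" using yz(2,4) by (auto simp: Pi_iff)
        show "w \<oplus>\<^bsub>?Q\<^esub> w' = mat (y \<oplus>\<^bsub>N\<^esub> y') ?z"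
        proof (rule Q_ext)
          show "mat (y \<oplus>\<^bsub>N\<^esub> y') ?z \<in> carrier ?Q" using matc[OF _ z] yz by simp
          fix k l assume kl: "k \<in> K" "l \<in> K"
          have "(\<Oplus>\<^bsub>N\<^esub>j\<in>J. r j l \<odot>\<^bsub>N\<^esub> ?z k j) =
              (\<Oplus>\<^bsub>N\<^esub>j\<in>J. r j l \<odot>\<^bsub>N\<^esub> z k j) \<oplus>\<^bsub>N\<^esub> (\<Oplus>\<^bsub>N\<^esub>j\<in>J. r j l \<odot>\<^bsub>N\<^esub> z' k j)"
            using yz kl by (intro N.lincomb_add_right rel_column) auto
          then show "(w \<oplus>\<^bsub>?Q\<^esub> w') (k, l) = mat (y \<oplus>\<^bsub>N\<^esub> y') ?z (k, l)"
            using kl yz Sc[OF yz(2) kl] Sc[OF yz(4) kl]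
            by (auto simp: e Q_ev mat_ev N.M.a_ac)
        qed (use e matc yz in auto)
      qed (use e yz mod_homD(2)[OF \<phi>h] in auto)
    next
      fix b w e assume b: "b \<in> carrier R" and "(w, e) \<in> G"
      then obtain y z where yz: "y \<in> carrier N" "z \<in> K \<rightarrow> J \<rightarrow> carrier N"
        and e: "w = mat y z" "e = \<phi> y" unfolding G_def by blast
      let ?z = "\<lambda>k j. b \<odot>\<^bsub>N\<^esub> z k j"
      show "(b \<odot>\<^bsub>?Q\<^esub> w, b \<odot>\<^bsub>E\<^esub> e) \<in> G"
      proof (rule GI[of "b \<odot>\<^bsub>N\<^esub> y" ?z])
        show z: "?z \<in> K \<rightarrow> J \<rightarrow> carrier N" using yz(2) b by (auto simp: Pi_iff)
        show "b \<odot>\<^bsub>?Q\<^esub> w = mat (b \<odot>\<^bsub>N\<^esub> y) ?z"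
        proof (rule Q_ext)
          show "mat (b \<odot>\<^bsub>N\<^esub> y) ?z \<in> carrier ?Q" using matc[OF _ z] yz b by simp
          fix k l assume kl: "k \<in> K" "l \<in> K"
          have "(\<Oplus>\<^bsub>N\<^esub>j\<in>J. r j l \<odot>\<^bsub>N\<^esub> ?z k j) = b \<odot>\<^bsub>N\<^esub> (\<Oplus>\<^bsub>N\<^esub>j\<in>J. r j l \<odot>\<^bsub>N\<^esub> z k j)"
            using yz kl b by (intro N.lincomb_smult_right rel_column finite_rels) auto
          then show "(b \<odot>\<^bsub>?Q\<^esub> w) (k, l) = mat (b \<odot>\<^bsub>N\<^esub> y) ?z (k, l)"
            using kl b yz Sc[OF yz(2) kl] by (auto simp: e Q_ev mat_ev N.smult_r_distr)
        qed (use e matc yz b in auto)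
      qed (use e yz b mod_homD(3)[OF \<phi>h] in auto)
    next
      fix e assume "(\<zero>\<^bsub>?Q\<^esub>, e) \<in> G"
      then obtain y z where yz: "y \<in> carrier N" "z \<in> K \<rightarrow> J \<rightarrow> carrier N"
        and e: "\<zero>\<^bsub>?Q\<^esub> = mat y z" "e = \<phi> y" unfolding G_def by blast
      have "y = \<zero>\<^bsub>N\<^esub>"
      proof (rule ccontr)
        assume "y \<noteq> \<zero>\<^bsub>N\<^esub>"
        then obtain h where h: "h \<in> mod_hom R N (hom_module R U E)" "h y \<noteq> \<zero>\<^bsub>hom_module R U E\<^esub>"
          using cog yz(1) unfolding cogenerated_by_iff[OF N hom_module_module[OF module_axioms E]]
          by blast
        have hy: "h y \<in> carrier (hom_module R U E)" by (rule mod_homD(1)[OF h(1) yz(1)])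
        then have hy': "h y \<in> mod_hom R U E" by (simp add: hom_module_carrier)
        have "h y (a k) = \<zero>\<^bsub>E\<^esub>" if k: "k \<in> K" for k
        proof (rule tensor_relation_annihilates[OF N E h(1) yz(1) _ k])
          \<comment> \<open>Row \<open>k\<close> of the zero matrix reads \<open>y e\<^sub>k\<close> plus a combination of relations.\<close>
          let ?z = "\<lambda>j. (\<ominus> \<one>) \<odot>\<^bsub>N\<^esub> z k j"
          show "?z \<in> J \<rightarrow> carrier N" using yz(2) k by (auto simp: Pi_iff)
          fix l assume l: "l \<in> K"
          let ?s = "\<Oplus>\<^bsub>N\<^esub>j\<in>J. r j l \<odot>\<^bsub>N\<^esub> z k j" and ?y = "if l = k then y else \<zero>\<^bsub>N\<^esub>"
          have "(\<Oplus>\<^bsub>N\<^esub>j\<in>J. r j l \<odot>\<^bsub>N\<^esub> ?z j) = (\<ominus> \<one>) \<odot>\<^bsub>N\<^esub> ?s"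
            using yz k l by (intro N.lincomb_smult_right rel_column finite_rels) auto
          also have "\<dots> = \<ominus>\<^bsub>N\<^esub> ?s" using Sc[OF yz(2) k l] by (simp add: N.smult_l_minus)
          also have "\<dots> = ?y"
            using mat_ev[OF k l, of y z] Q_ev(3)[OF k l] e(1) Sc[OF yz(2) k l] yz(1)
            by (intro N.M.minus_equality) auto
          finally show "(\<Oplus>\<^bsub>N\<^esub>j\<in>J. r j l \<odot>\<^bsub>N\<^esub> ?z j) = ?y" .
        qed
        from hom_eq_zero[OF E hy' this] show False
          using hom_module_nonzero[OF hy h(2)] by metis
      qed
      then show "e = \<zero>\<^bsub>E\<^esub>" using e(2) mod_hom_zero[OF N E \<phi>h] by simp
    qed
    moreover have "G \<noteq> {}"
      using GI[of "\<zero>\<^bsub>N\<^esub>" "\<lambda>_ _. \<zero>\<^bsub>N\<^esub>"] by blast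
    ultimately obtain g where g: "g \<in> mod_hom R ?Q E" and gG: "\<And>w e. (w, e) \<in> G \<Longrightarrow> g w = e"
      using partial_graph_hom[OF inj Q] by metis
    \<comment> \<open>\<open>g\<close> restricted to the \<open>(k, l)\<close> entry; \<open>H k l\<close> will be the value of \<open>h\<^sub>k\<close> at \<open>a\<^sub>l\<close>.\<close>
    define H where "H k l = (\<lambda>x\<in>carrier N. g (?e (k, l) x))" for k l
    have H: "H k l \<in> carrier ?D" for k l
      unfolding H_def by (rule restrict_hom_module[OF N mod_hom_comp[OF single_hom[OF N] g]])
    have rel: "(\<Oplus>\<^bsub>?D\<^esub>l\<in>K. r j l \<odot>\<^bsub>?D\<^esub> H k l) = \<zero>\<^bsub>?D\<^esub>" (is "?s = _")
      if k: "k \<in> K" and j: "j \<in> J" for k j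
    proof (rule ccontr)
      have Hk: "H k \<in> K \<rightarrow> carrier ?D" using H by blast
      have s: "?s \<in> carrier ?D" by (rule D.lincomb_closed[OF rel_closed[OF j] Hk])
      assume "?s \<noteq> \<zero>\<^bsub>?D\<^esub>"
      with s obtain x where x: "x \<in> carrier N" and ne: "?s x \<noteq> \<zero>\<^bsub>E\<^esub>"
        by (rule hom_module_nonzero)
      have ex: "(\<lambda>l. ?e (k, l) x) \<in> K \<rightarrow> carrier ?Q" using ec[OF x] by blast
      \<comment> \<open>The matrix with \<open>x\<close> times the \<open>j\<close>-th relation in row \<open>k\<close> is the member of the graph with
        coefficients \<open>?z\<close> and diagonal \<open>0\<close>, where the extension vanishes.\<close>
      let ?z = "\<lambda>k' j'. if j' = j then (if k' = k then x else \<zero>\<^bsub>N\<^esub>) else \<zero>\<^bsub>N\<^esub>"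
      have z: "?z \<in> K \<rightarrow> J \<rightarrow> carrier N" using x by auto
      have "?s x = (\<Oplus>\<^bsub>E\<^esub>l\<in>K. r j l \<odot>\<^bsub>E\<^esub> H k l x)"
        by (rule mod_hom_lincomb[OF D E eval_hom[OF x] rel_closed[OF j] Hk])
      also have "\<dots> = g (\<Oplus>\<^bsub>?Q\<^esub>l\<in>K. r j l \<odot>\<^bsub>?Q\<^esub> ?e (k, l) x)"
        using mod_hom_lincomb[OF Q E g rel_closed[OF j] ex] x by (simp add: H_def)
      also have "(\<Oplus>\<^bsub>?Q\<^esub>l\<in>K. r j l \<odot>\<^bsub>?Q\<^esub> ?e (k, l) x) = mat \<zero>\<^bsub>N\<^esub> ?z" (is "?w = _")
      proof (rule Q_ext)
        show "?w \<in> carrier ?Q" by (rule Q.lincomb_closed[OF rel_closed[OF j] ex])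
        show "mat \<zero>\<^bsub>N\<^esub> ?z \<in> carrier ?Q" by (rule matc[OF _ z]) simp
        fix k' l' assume kl: "k' \<in> K" "l' \<in> K"
        let ?x = "if k' = k then x else \<zero>\<^bsub>N\<^esub>"
        have "?w (k', l') = (\<Oplus>\<^bsub>N\<^esub>l\<in>K. r j l \<odot>\<^bsub>N\<^esub> ?e (k, l) x (k', l'))"
          using kl by (intro mod_hom_lincomb[OF Q N proj_hom rel_closed[OF j] ex]) auto
        also have "\<dots> = (\<Oplus>\<^bsub>N\<^esub>l\<in>K. r j l \<odot>\<^bsub>N\<^esub> (if l = l' then ?x else \<zero>\<^bsub>N\<^esub>))"
          using kl x j rel_mem by (intro N.M.finsum_cong') (auto simp: single_def)
        also have "\<dots> = r j l' \<odot>\<^bsub>N\<^esub> ?x"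
          by (rule N.lincomb_delta[OF finite_gens kl(2) rel_closed[OF j]]) (use x in auto)
        also have "\<dots> = (\<Oplus>\<^bsub>N\<^esub>j'\<in>J. r j' l' \<odot>\<^bsub>N\<^esub> ?z k' j')"
          by (rule N.lincomb_delta[OF finite_rels j rel_column[OF kl(2)], symmetric]) (use x in auto)
        also have "\<dots> = mat \<zero>\<^bsub>N\<^esub> ?z (k', l')"
          using mat_ev[OF kl, of "\<zero>\<^bsub>N\<^esub>" ?z] Sc[OF z kl] by simp
        finally show "?w (k', l') = mat \<zero>\<^bsub>N\<^esub> ?z (k', l')" .
      qed
      also have "g \<dots> = \<phi> \<zero>\<^bsub>N\<^esub>" by (rule gG, rule GI[OF _ z]) auto
      also have "\<dots> = \<zero>\<^bsub>E\<^esub>" by (rule mod_hom_zero[OF N E \<phi>h])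
      finally show False using ne by contradiction
    qed
    have "\<exists>h. h \<in> mod_hom R U ?D \<and> (\<forall>l\<in>K. h (a l) = H k l)" if k: "k \<in> K" for k
    proof -
      have "H k \<in> K \<rightarrow> carrier ?D" using H by blast
      then obtain h where "h \<in> mod_hom R U ?D" "\<And>l. l \<in> K \<Longrightarrow> h (a l) = H k l"
        using hom_lift[OF D _ rel[OF k]] by metis
      then show ?thesis by blast
    qed
    then have "\<exists>h. \<forall>k\<in>K. h k \<in> mod_hom R U ?D \<and> (\<forall>l\<in>K. h k (a l) = H k l)"
      by (intro bchoice) blast
    then obtain h where h: "\<And>k. k \<in> K \<Longrightarrow> h k \<in> mod_hom R U ?D"
      and ha: "\<And>k l. k \<in> K \<Longrightarrow> l \<in> K \<Longrightarrow> h k (a l) = H k l" by blast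
    have "\<phi> = (\<Oplus>\<^bsub>?D\<^esub>k\<in>K. H k k)" (is "_ = ?s")
    proof (rule extensionalityI[where A = "carrier N"])
      have "?s \<in> carrier ?D" using H by (intro D.M.finsum_closed) blast
      then show "?s \<in> extensional (carrier N)" by (simp add: hom_module_carrier)
      show "\<phi> \<in> extensional (carrier N)" using \<phi> by (simp add: hom_module_carrier)
    next
      fix x assume x: "x \<in> carrier N"
      have "?s x = (\<Oplus>\<^bsub>E\<^esub>k\<in>K. H k k x)"
        using H by (intro mod_hom_finsum[OF D E eval_hom[OF x]]) blast
      also have "\<dots> = g (\<Oplus>\<^bsub>?Q\<^esub>k\<in>K. ?e (k, k) x)"
        using mod_hom_finsum[OF Q E g, of "\<lambda>k. ?e (k, k) x" K] ec[OF x] x by (simp add: H_def Pi_iff)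
      also have "(\<Oplus>\<^bsub>?Q\<^esub>k\<in>K. ?e (k, k) x) = mat x (\<lambda>_ _. \<zero>\<^bsub>N\<^esub>)" (is "?w = _")
      proof (rule Q_ext)
        show "?w \<in> carrier ?Q" using ec[OF x] by (intro Q.M.finsum_closed) blast
        show "mat x (\<lambda>_ _. \<zero>\<^bsub>N\<^esub>) \<in> carrier ?Q" by (rule matc[OF x]) simp
        fix k' l' assume kl: "k' \<in> K" "l' \<in> K"
        let ?x = "if l' = k' then x else \<zero>\<^bsub>N\<^esub>"
        have "?w (k', l') = (\<Oplus>\<^bsub>N\<^esub>k\<in>K. ?e (k, k) x (k', l'))"
          using kl ec[OF x] by (intro mod_hom_finsum[OF Q N proj_hom]) auto
        also have "\<dots> = (\<Oplus>\<^bsub>N\<^esub>k\<in>K. if k = k' then ?x else \<zero>\<^bsub>N\<^esub>)"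
          using kl x by (intro N.M.finsum_cong') (auto simp: single_def)
        also have "\<dots> = ?x" by (rule N.M.finsum_delta[OF finite_gens kl(1)]) (use x in auto)
        also have "\<dots> = mat x (\<lambda>_ _. \<zero>\<^bsub>N\<^esub>) (k', l')"
          using mat_ev[OF kl, of x "\<lambda>_ _. \<zero>\<^bsub>N\<^esub>"] N.lincomb_zero[OF rel_column[OF kl(2)]] x by simp
        finally show "?w (k', l') = mat x (\<lambda>_ _. \<zero>\<^bsub>N\<^esub>) (k', l')" .
      qed
      also have "g \<dots> = \<phi> x" by (rule gG, rule GI[OF x]) auto
      finally show "\<phi> x = ?s x" by simp
    qed
    also have "\<dots> = (\<Oplus>\<^bsub>?D\<^esub>k\<in>K. h k (a k))"
      using H ha by (intro D.M.finsum_cong') auto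
    also have "\<dots> \<in> hom_trace R U ?D"
      using h gen_closed by (intro hom_trace_sum[OF D finite_gens]) auto
    finally show ?thesis .
  qed
  then show ?thesis unfolding generated_by_iff[OF module_axioms D] by blast
qed

end

section \<open>Direct summands and direct products\<close>

context finite_presentation
begin

text \<open>
The number of homomorphisms needed for one element is bounded by the number of generators of
\<open>U\<close>, independently of the element: if \<open>u\<close> is the combination of the \<open>a\<^sub>k\<close> with coefficients \<open>c\<^sub>k\<close>,
then \<open>f u\<close> is the sum of the values of \<open>c\<^sub>k f\<close> at \<open>a\<^sub>k\<close>, so all summands can be collected by
generator. This uniformity is what makes infinite products work.
\<close>

lemma generated_iff_gens:
  assumes M: "module R M"
  shows "generated_by R U M \<longleftrightarrow>
    (\<forall>y\<in>carrier M. \<exists>h\<in>K \<rightarrow> mod_hom R U M. y = (\<Oplus>\<^bsub>M\<^esub>k\<in>K. h k (a k)))"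
  unfolding generated_by_iff[OF module_axioms M]
proof (intro iffI subsetI ballI)
  fix y assume "\<forall>y\<in>carrier M. \<exists>h\<in>K \<rightarrow> mod_hom R U M. y = (\<Oplus>\<^bsub>M\<^esub>k\<in>K. h k (a k))" "y \<in> carrier M"
  then obtain h where "h \<in> K \<rightarrow> mod_hom R U M" "y = (\<Oplus>\<^bsub>M\<^esub>k\<in>K. h k (a k))" by blast
  then show "y \<in> hom_trace R U M"
    using gen_closed by (auto intro!: hom_trace_sum[OF M finite_gens])
next
  interpret M: module R M by fact
  fix y assume "carrier M \<subseteq> hom_trace R U M" "y \<in> carrier M"
  then have "y \<in> hom_trace R U M" by blast
  then show "\<exists>h\<in>K \<rightarrow> mod_hom R U M. y = (\<Oplus>\<^bsub>M\<^esub>k\<in>K. h k (a k))"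
  proof induction
    case zero
    have "(\<lambda>_. \<zero>\<^bsub>M\<^esub>) \<in> mod_hom R U M" by (rule mod_homI) auto
    then show ?case by (intro bexI[of _ "\<lambda>_ _. \<zero>\<^bsub>M\<^esub>"]) auto
  next
    case (add t f u)
    then obtain h where h: "h \<in> K \<rightarrow> mod_hom R U M" "t = (\<Oplus>\<^bsub>M\<^esub>k\<in>K. h k (a k))" by blast
    obtain c where c: "c \<in> K \<rightarrow> carrier R" "u = (\<Oplus>\<^bsub>U\<^esub>k\<in>K. c k \<odot>\<^bsub>U\<^esub> a k)"
      using gens_span[OF add.hyps(3)] by blast
    note f = mod_homD[OF add.hyps(2)]
    have hk: "h k \<in> mod_hom R U M" "c k \<in> carrier R" "a k \<in> carrier U" if "k \<in> K" for k
      using h c gen_closed that by auto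
    note hD = mod_homD[OF hk(1)]
    let ?h = "\<lambda>k x. h k x \<oplus>\<^bsub>M\<^esub> c k \<odot>\<^bsub>M\<^esub> f x"
    have "?h \<in> K \<rightarrow> mod_hom R U M"
    proof (intro funcsetI mod_homI)
      fix k assume k: "k \<in> K"
      show "?h k x \<in> carrier M" if "x \<in> carrier U" for x
        using that k by (simp add: hD f hk)
      show "?h k (x \<oplus>\<^bsub>U\<^esub> y) = ?h k x \<oplus>\<^bsub>M\<^esub> ?h k y" if "x \<in> carrier U" "y \<in> carrier U" for x y
        using that k by (simp add: hD f hk M.smult_r_distr M.M.a_ac)
      show "?h k (b \<odot>\<^bsub>U\<^esub> x) = b \<odot>\<^bsub>M\<^esub> ?h k x" if "b \<in> carrier R" "x \<in> carrier U" for b x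
        using that k by (simp add: hD f hk M.smult_r_distr M.smult_left_commute)
    qed
    moreover have "t \<oplus>\<^bsub>M\<^esub> f u = (\<Oplus>\<^bsub>M\<^esub>k\<in>K. ?h k (a k))"
    proof -
      have "f u = (\<Oplus>\<^bsub>M\<^esub>k\<in>K. c k \<odot>\<^bsub>M\<^esub> f (a k))"
        unfolding c(2) by (rule mod_hom_lincomb[OF module_axioms M add.hyps(2) c(1) gen_closed])
      then show ?thesis
        unfolding h(2) by (simp add: M.M.finsum_addf hD f hk)
    qed
    ultimately show ?case by (intro bexI[of _ ?h])
  qed
qed

lemma generated_product:
  assumes "\<And>i. i \<in> \<Lambda> \<Longrightarrow> module R (M i)" "\<And>i. i \<in> \<Lambda> \<Longrightarrow> generated_by R U (M i)"
  shows "generated_by R U (direct_product \<Lambda> M)"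
proof -
  let ?P = "direct_product \<Lambda> M"
  have P: "module R ?P" using assms(1) R.is_cring by (intro direct_product_module)
  interpret P: module R ?P by fact
  show ?thesis
    unfolding generated_iff_gens[OF P]
  proof
    fix y assume y: "y \<in> carrier ?P"
    have "\<exists>h. h \<in> K \<rightarrow> mod_hom R U (M i) \<and> y i = (\<Oplus>\<^bsub>M i\<^esub>k\<in>K. h k (a k))"
      if i: "i \<in> \<Lambda>" for i
    proof -
      have "y i \<in> carrier (M i)" using y i by (auto simp: direct_product_def)
      then show ?thesis using assms(2)[OF i] generated_iff_gens[OF assms(1)[OF i]] by blast
    qed
    then have "\<exists>h. \<forall>i\<in>\<Lambda>. h i \<in> K \<rightarrow> mod_hom R U (M i) \<and> y i = (\<Oplus>\<^bsub>M i\<^esub>k\<in>K. h i k (a k))"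
      by (intro bchoice) blast
    then obtain h where h: "\<And>i k. i \<in> \<Lambda> \<Longrightarrow> k \<in> K \<Longrightarrow> h i k \<in> mod_hom R U (M i)"
      and yh: "\<And>i. i \<in> \<Lambda> \<Longrightarrow> y i = (\<Oplus>\<^bsub>M i\<^esub>k\<in>K. h i k (a k))" by blast
    let ?H = "\<lambda>k u. \<lambda>i\<in>\<Lambda>. h i k u"
    have H: "?H k \<in> mod_hom R U ?P" if "k \<in> K" for k
      by (rule hom_into_product) (rule h[OF _ that])
    have Hc: "(\<lambda>k. ?H k (a k)) \<in> K \<rightarrow> carrier ?P"
    proof
      fix k assume k: "k \<in> K"
      show "?H k (a k) \<in> carrier ?P" by (rule mod_homD(1)[OF H[OF k]]) (use gen_closed k in blast)
    qed
    have "y = (\<Oplus>\<^bsub>?P\<^esub>k\<in>K. ?H k (a k))" (is "_ = ?s")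
    proof (rule extensionalityI[where A = \<Lambda>])
      show "y \<in> extensional \<Lambda>" using y by (simp add: direct_product_def PiE_def)
      have "?s \<in> carrier ?P" by (rule P.M.finsum_closed[OF Hc])
      then show "?s \<in> extensional \<Lambda>" by (simp add: direct_product_def PiE_def)
      fix i assume i: "i \<in> \<Lambda>"
      have "?s i = (\<Oplus>\<^bsub>M i\<^esub>k\<in>K. ?H k (a k) i)"
        by (rule mod_hom_finsum[OF P assms(1)[OF i] proj_hom[OF i] Hc])
      then show "y i = ?s i" using i yh by simp
    qed
    then show "\<exists>h\<in>K \<rightarrow> mod_hom R U ?P. y = (\<Oplus>\<^bsub>?P\<^esub>k\<in>K. h k (a k))"
      using H by (intro bexI[of _ ?H]) auto
  qed
qed

end

lemma cogenerated_product:
  assumes R: "cring R" and V: "module R V" and "\<And>i. i \<in> \<Lambda> \<Longrightarrow> module R (N i)"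
    and cog: "\<And>i. i \<in> \<Lambda> \<Longrightarrow> cogenerated_by R V (N i)"
  shows "cogenerated_by R V (direct_product \<Lambda> N)"
proof -
  have P: "module R (direct_product \<Lambda> N)" using assms by (intro direct_product_module)
  show ?thesis
    unfolding cogenerated_by_iff[OF P V]
  proof (intro ballI impI)
    fix y assume y: "y \<in> carrier (direct_product \<Lambda> N)" "y \<noteq> \<zero>\<^bsub>direct_product \<Lambda> N\<^esub>"
    then obtain i where i: "i \<in> \<Lambda>" "y i \<noteq> \<zero>\<^bsub>N i\<^esub>"
      by (auto simp: direct_product_def fun_eq_iff PiE_def extensional_def split: if_splits)
    moreover have "y i \<in> carrier (N i)" using y i by (auto simp: direct_product_def)
    ultimately obtain h where h: "h \<in> mod_hom R (N i) V" "h (y i) \<noteq> \<zero>\<^bsub>V\<^esub>"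
      using cog[OF i(1)] cogenerated_by_iff[OF assms(3)[OF i(1)] V] by blast
    show "\<exists>h\<in>mod_hom R (direct_product \<Lambda> N) V. h y \<noteq> \<zero>\<^bsub>V\<^esub>"
      by (rule bexI[OF _ mod_hom_comp[OF proj_hom[OF i(1), of R N] h(1)]]) (rule h(2))
  qed
qed

lemma cogenerated_mono:
  assumes A: "module R A" and N: "module R N" and V: "module R V" and g: "g \<in> mod_mono R A N"
    and cog: "cogenerated_by R V N"
  shows "cogenerated_by R V A"
  unfolding cogenerated_by_iff[OF A V]
proof (intro ballI impI)
  interpret A: module R A by fact
  have gh: "g \<in> mod_hom R A N" and inj: "inj_on g (carrier A)" using g by (auto simp: mod_mono_def)
  fix y assume y: "y \<in> carrier A" "y \<noteq> \<zero>\<^bsub>A\<^esub>"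
  have "g y \<noteq> \<zero>\<^bsub>N\<^esub>"
    using inj_on_eq_iff[OF inj y(1) A.M.zero_closed] y(2) mod_hom_zero[OF A N gh] by simp
  then obtain h where h: "h \<in> mod_hom R N V" "h (g y) \<noteq> \<zero>\<^bsub>V\<^esub>"
    using cog mod_homD(1)[OF gh y(1)] cogenerated_by_iff[OF N V] by blast
  show "\<exists>h\<in>mod_hom R A V. h y \<noteq> \<zero>\<^bsub>V\<^esub>"
    by (rule bexI[OF _ mod_hom_comp[OF gh h(1)]]) (rule h(2))
qed

lemma generated_epi:
  assumes U: "module R U" and M: "module R M" and A: "module R A" and g: "g \<in> mod_epi R M A"
    and gen: "generated_by R U M"
  shows "generated_by R U A"
  unfolding generated_by_iff[OF U A]
proof
  interpret M: module R M by fact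
  have gh: "g \<in> mod_hom R M A" and surj: "g ` carrier M = carrier A" using g by (auto simp: mod_epi_def)
  have "g t \<in> hom_trace R U A" if "t \<in> hom_trace R U M" for t
    using that
  proof induction
    case zero
    then show ?case using mod_hom_zero[OF M A gh] by (simp add: hom_trace.zero)
  next
    case (add t h u)
    have "t \<in> carrier M"
      using add.hyps(1) M.submoduleE(1)[OF hom_trace_submodule[OF M]] by blast
    then have "g (t \<oplus>\<^bsub>M\<^esub> h u) = g t \<oplus>\<^bsub>A\<^esub> g (h u)"
      using mod_homD(2)[OF gh] mod_homD(1)[OF add.hyps(2,3)] by simp
    then show ?case
      using hom_trace.add[OF add.IH mod_hom_comp[OF add.hyps(2) gh] add.hyps(3)] by simp
  qed
  moreover fix x assume "x \<in> carrier A"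
  then obtain t where "t \<in> carrier M" "x = g t" using surj by blast
  moreover have "carrier M \<subseteq> hom_trace R U M" using gen generated_by_iff[OF U M] by blast
  ultimately show "x \<in> hom_trace R U A" by blast
qed

lemma summand_inclusion:
  assumes N: "module R N" and A: "module R A" and B: "module R B"
    and f: "f \<in> mod_iso R N (binary_sum A B)"
  shows "(\<lambda>x. inv_into (carrier N) f (x, \<zero>\<^bsub>B\<^esub>)) \<in> mod_mono R A N"
proof -
  interpret N: module R N by fact
  interpret A: module R A by fact
  interpret B: module R B by fact
  let ?S = "binary_sum A B"
  have fh: "f \<in> mod_hom R N ?S" and bij: "bij_betw f (carrier N) (carrier ?S)"
    using f by (auto simp: mod_iso_def)
  define g where "g x = inv_into (carrier N) f (x, \<zero>\<^bsub>B\<^esub>)" for x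
  have g: "g x \<in> carrier N" "f (g x) = (x, \<zero>\<^bsub>B\<^esub>)" if "x \<in> carrier A" for x
  proof -
    have "(x, \<zero>\<^bsub>B\<^esub>) \<in> f ` carrier N"
      using bij that by (simp add: bij_betw_def binary_sum_def)
    then show "g x \<in> carrier N" "f (g x) = (x, \<zero>\<^bsub>B\<^esub>)"
      unfolding g_def by (auto simp: inv_into_into f_inv_into_f)
  qed
  have gI: "g x = n" if "n \<in> carrier N" "f n = (x, \<zero>\<^bsub>B\<^esub>)" for x n
    unfolding g_def that(2)[symmetric]
    by (rule inv_into_f_f) (use bij that in \<open>auto simp: bij_betw_def\<close>)
  have "g \<in> mod_hom R A N"
  proof (rule mod_homI)
    show "g (x \<oplus>\<^bsub>A\<^esub> y) = g x \<oplus>\<^bsub>N\<^esub> g y" if "x \<in> carrier A" "y \<in> carrier A" for x y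
      by (rule gI) (use that in \<open>auto simp: g mod_homD(2)[OF fh] binary_sum_def\<close>)
    show "g (b \<odot>\<^bsub>A\<^esub> x) = b \<odot>\<^bsub>N\<^esub> g x" if "b \<in> carrier R" "x \<in> carrier A" for b x
      by (rule gI) (use that in \<open>auto simp: g mod_homD(3)[OF fh] binary_sum_def\<close>)
  qed (rule g(1))
  moreover have "inj_on g (carrier A)"
    by (rule inj_onI) (metis g(2) fst_conv)
  ultimately show ?thesis by (simp add: mod_mono_def g_def[abs_def])
qed

lemma summand_projection:
  assumes N: "module R N" and B: "module R B"
    and f: "f \<in> mod_iso R N (binary_sum A B)"
  shows "(\<lambda>x. fst (f x)) \<in> mod_epi R N A"
proof -
  interpret B: module R B by fact
  have fh: "f \<in> mod_hom R N (binary_sum A B)" and im: "f ` carrier N = carrier A \<times> carrier B"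
    using f by (auto simp: mod_iso_def bij_betw_def binary_sum_def)
  have "fst \<in> mod_hom R (binary_sum A B) A"
    by (auto simp: mod_hom_def binary_sum_def)
  then have "(\<lambda>x. fst (f x)) \<in> mod_hom R N A" by (rule mod_hom_comp[OF fh])
  moreover have "(\<lambda>x. fst (f x)) ` carrier N = fst ` (f ` carrier N)" by (simp add: image_image)
  then have "(\<lambda>x. fst (f x)) ` carrier N = carrier A"
    unfolding im using B.M.zero_closed by (simp add: fst_image_times) blast
  ultimately show ?thesis by (simp add: mod_epi_def)
qed

section \<open>Ideals of noetherian rings are finitely presented\<close>

lemma submodule_lincomb:
  assumes M: "module R M" and T: "submodule T R M" and "finite A"
    and "c \<in> A \<rightarrow> carrier R" "x \<in> A \<rightarrow> T"
  shows "(\<Oplus>\<^bsub>M\<^esub>i\<in>A. c i \<odot>\<^bsub>M\<^esub> x i) \<in> T"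
proof -
  interpret M: module R M by fact
  note T' = M.submoduleE[OF T]
  have T0: "\<zero>\<^bsub>M\<^esub> \<in> T"
    using subgroup.one_closed[OF submodule.axioms(1)[OF T]] by simp
  show ?thesis
    using assms(3-5)
  proof (induction A rule: finite_induct)
    case (insert i A)
    then have "c i \<odot>\<^bsub>M\<^esub> x i \<in> T" "(\<Oplus>\<^bsub>M\<^esub>i\<in>A. c i \<odot>\<^bsub>M\<^esub> x i) \<in> T"
      using T'(4) by auto
    moreover have "(\<lambda>i. c i \<odot>\<^bsub>M\<^esub> x i) \<in> insert i A \<rightarrow> carrier M"
      using insert.prems T'(1) by (auto simp: Pi_iff)
    ultimately show ?case
      using insert.hyps T'(5) by simp
  qed (simp add: T0)
qed

definition lin_span :: "('r, 's) ring_scheme \<Rightarrow> ('r, 'm) module \<Rightarrow> 'm set \<Rightarrow> 'm set"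
  where "lin_span R M F = {\<Oplus>\<^bsub>M\<^esub>x\<in>F. c x \<odot>\<^bsub>M\<^esub> x | c. c \<in> F \<rightarrow> carrier R}"

lemma lin_spanI: "c \<in> F \<rightarrow> carrier R \<Longrightarrow> (\<Oplus>\<^bsub>M\<^esub>x\<in>F. c x \<odot>\<^bsub>M\<^esub> x) \<in> lin_span R M F"
  unfolding lin_span_def by blast

lemma lin_spanE:
  assumes "y \<in> lin_span R M F"
  obtains c where "c \<in> F \<rightarrow> carrier R" "y = (\<Oplus>\<^bsub>M\<^esub>x\<in>F. c x \<odot>\<^bsub>M\<^esub> x)"
  using assms unfolding lin_span_def by blast

lemma lin_span_least:
  assumes M: "module R M" and T: "submodule T R M" and F: "finite F" "F \<subseteq> T"
  shows "lin_span R M F \<subseteq> T"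
proof
  fix y assume "y \<in> lin_span R M F"
  then obtain c where "c \<in> F \<rightarrow> carrier R" "y = (\<Oplus>\<^bsub>M\<^esub>x\<in>F. c x \<odot>\<^bsub>M\<^esub> x)" by (rule lin_spanE)
  then show "y \<in> T" using F by (auto intro!: submodule_lincomb[OF M T])
qed

lemma lin_span_superset:
  assumes M: "module R M" and F: "finite F" "F \<subseteq> carrier M"
  shows "F \<subseteq> lin_span R M F"
proof
  interpret M: module R M by fact
  fix y assume y: "y \<in> F"
  have "(\<Oplus>\<^bsub>M\<^esub>x\<in>F. (if x = y then \<one>\<^bsub>R\<^esub> else \<zero>\<^bsub>R\<^esub>) \<odot>\<^bsub>M\<^esub> x) =
      (\<Oplus>\<^bsub>M\<^esub>x\<in>F. if x = y then y else \<zero>\<^bsub>M\<^esub>)"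
    using F y by (intro M.M.finsum_cong') auto
  also have "\<dots> = y" using F y by (intro M.M.finsum_delta) auto
  finally show "y \<in> lin_span R M F"
    using lin_spanI[of "\<lambda>x. if x = y then \<one>\<^bsub>R\<^esub> else \<zero>\<^bsub>R\<^esub>" F R M] by simp
qed

lemma lin_span_submodule:
  assumes M: "module R M" and F: "finite F" "F \<subseteq> carrier M"
  shows "submodule (lin_span R M F) R M"
proof -
  interpret M: module R M by fact
  have id: "(\<lambda>x. x) \<in> F \<rightarrow> carrier M" using F by blast
  have sm: "b \<odot>\<^bsub>M\<^esub> y \<in> lin_span R M F" if b: "b \<in> carrier R" and y: "y \<in> lin_span R M F" for b y
  proof -
    obtain c where c: "c \<in> F \<rightarrow> carrier R" "y = (\<Oplus>\<^bsub>M\<^esub>x\<in>F. c x \<odot>\<^bsub>M\<^esub> x)"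
      using y by (rule lin_spanE)
    have "(\<lambda>x. b \<otimes>\<^bsub>R\<^esub> c x) \<in> F \<rightarrow> carrier R" using b c by auto
    from lin_spanI[OF this, of M] show ?thesis
      unfolding c(2) M.lincomb_smult_left[OF F(1) b c(1) id] .
  qed
  have c: "lin_span R M F \<subseteq> carrier M"
    by (rule lin_span_least[OF M M.carrier_is_submodule F])
  show ?thesis
  proof (rule M.submoduleI[OF c])
    have "(\<Oplus>\<^bsub>M\<^esub>x\<in>F. \<zero>\<^bsub>R\<^esub> \<odot>\<^bsub>M\<^esub> x) = \<zero>\<^bsub>M\<^esub>"
      using F by (intro M.M.add.finprod_one_eqI) auto
    then show "\<zero>\<^bsub>M\<^esub> \<in> lin_span R M F"
      using lin_spanI[of "\<lambda>_. \<zero>\<^bsub>R\<^esub>" F R M] by simp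
    show "\<ominus>\<^bsub>M\<^esub> y \<in> lin_span R M F" if "y \<in> lin_span R M F" for y
      using sm[OF _ that, of "\<ominus>\<^bsub>R\<^esub> \<one>\<^bsub>R\<^esub>"] c that by (auto simp: M.smult_l_minus)
    show "x \<oplus>\<^bsub>M\<^esub> y \<in> lin_span R M F" if xy: "x \<in> lin_span R M F" "y \<in> lin_span R M F" for x y
    proof -
      obtain c where c: "c \<in> F \<rightarrow> carrier R" "x = (\<Oplus>\<^bsub>M\<^esub>x\<in>F. c x \<odot>\<^bsub>M\<^esub> x)"
        using xy(1) by (rule lin_spanE)
      obtain d where d: "d \<in> F \<rightarrow> carrier R" "y = (\<Oplus>\<^bsub>M\<^esub>x\<in>F. d x \<odot>\<^bsub>M\<^esub> x)"
        using xy(2) by (rule lin_spanE)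
      have "(\<lambda>x. c x \<oplus>\<^bsub>R\<^esub> d x) \<in> F \<rightarrow> carrier R" using c d by auto
      from lin_spanI[OF this, of M] show ?thesis
        unfolding c(2) d(2) M.lincomb_add_left[OF c(1) d(1) id] .
    qed
  qed (rule sm)
qed

abbreviation regular_module :: "('r, 's) ring_scheme \<Rightarrow> ('r, 'r) module"
  where "regular_module R \<equiv> ideal_module R (carrier R)"

lemma (in cring) submodule_regular_ideal:
  assumes "submodule T R (regular_module R)"
  shows "ideal T R"
proof -
  interpret M: module R "regular_module R"
    by (rule ideal_module_module[OF is_cring oneideal])
  note T' = M.submoduleE[OF assms]
  have T0: "\<zero> \<in> T"
    using subgroup.one_closed[OF submodule.axioms(1)[OF assms]] by (simp add: ideal_module_def)
  have TR: "T \<subseteq> carrier R" using T'(1) by (simp add: ideal_module_def)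
  have l: "x \<otimes> b \<in> T" if "b \<in> T" "x \<in> carrier R" for b x
    using T'(4)[OF that(2,1)] by (simp add: ideal_module_def)
  show ?thesis
  proof (rule idealI)
    show "subgroup T (add_monoid R)"
    proof (rule add.subgroupI)
      show "T \<noteq> {}" using T0 by blast
      show "\<ominus> b \<in> T" if "b \<in> T" for b
        using l[OF that, of "\<ominus> \<one>"] that TR by (auto simp: l_minus)
      show "b \<oplus> c \<in> T" if "b \<in> T" "c \<in> T" for b c
        using T'(5)[OF that] by (simp add: ideal_module_def)
    qed (rule TR)
    show "b \<otimes> x \<in> T" if "b \<in> T" "x \<in> carrier R" for b x
      using l[OF that] that TR by (metis m_comm subsetD)
  qed (auto intro: l ring_axioms)
qed

lemma finsum_regular: "finsum (regular_module R) f A = finsum R f A"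
  by (simp add: finsum_def ideal_module_def finprod_def)

lemma (in cring) genideal_lin_span:
  assumes "finite A" "A \<subseteq> carrier R"
  shows "Idl A \<subseteq> lin_span R (regular_module R) A"
proof -
  have M: "module R (regular_module R)"
    by (rule ideal_module_module[OF is_cring oneideal])
  have A: "A \<subseteq> carrier (regular_module R)" using assms(2) by (simp add: ideal_module_def)
  show ?thesis
    by (rule genideal_minimal[OF submodule_regular_ideal[OF lin_span_submodule[OF M assms(1) A]]
          lin_span_superset[OF M assms(1) A]])
qed

text \<open>
The induction removes one coordinate \<open>x\<close> at a time. The \<open>x\<close>-coordinates of \<open>T\<close> form an ideal; lifts
of its finitely many generators, together with generators of the submodule of \<open>T\<close> where the
\<open>x\<close>-coordinate vanishes, generate \<open>T\<close>. Tracking the support \<open>X\<close> inside a fixed \<open>R\<^sup>\<Lambda>\<close> keeps all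
submodules in the same ambient module.
\<close>

lemma noetherian_submodule_finitely_generated:
  fixes R :: "('r, 's) ring_scheme" and \<Lambda> X :: "'i set"
  defines "P \<equiv> direct_product \<Lambda> (\<lambda>_. regular_module R)"
  assumes R: "cring R" and noeth: "noetherian_ring R" and X: "finite X" "X \<subseteq> \<Lambda>"
    and T: "submodule T R P" and supp: "\<And>v i. v \<in> T \<Longrightarrow> i \<in> \<Lambda> - X \<Longrightarrow> v i = \<zero>\<^bsub>R\<^esub>"
  shows "\<exists>F. finite F \<and> F \<subseteq> T \<and> T \<subseteq> lin_span R P F"
proof -
  interpret R: cring R by fact
  have M: "module R (regular_module R)"
    by (rule ideal_module_module[OF R R.oneideal])
  have P: "module R P" unfolding P_def by (intro direct_product_module R M)
  interpret P: module R P by fact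
  have ev: "(v \<oplus>\<^bsub>P\<^esub> w) i = v i \<oplus>\<^bsub>R\<^esub> w i" "\<zero>\<^bsub>P\<^esub> i = \<zero>\<^bsub>R\<^esub>" "(b \<odot>\<^bsub>P\<^esub> v) i = b \<otimes>\<^bsub>R\<^esub> v i"
    if "i \<in> \<Lambda>" for v w b i using that by (simp_all add: P_def direct_product_def ideal_module_def)
  have vR: "v i \<in> carrier R" if "v \<in> carrier P" "i \<in> \<Lambda>" for v i
    using that by (auto simp: P_def direct_product_def ideal_module_def)
  have ext: "v = w" if "v \<in> carrier P" "w \<in> carrier P" "\<And>i. i \<in> \<Lambda> \<Longrightarrow> v i = w i" for v w
    using that unfolding P_def by (auto simp: direct_product_def intro: PiE_ext)
  show ?thesis
    using X T supp
  proof (induction X arbitrary: T rule: finite_induct)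
    case empty
    have "T \<subseteq> {\<zero>\<^bsub>P\<^esub>}"
    proof
      fix v assume v: "v \<in> T"
      have "v = \<zero>\<^bsub>P\<^esub>"
        by (rule ext) (use v empty P.submoduleE(1)[OF empty(2)] ev in auto)
      then show "v \<in> {\<zero>\<^bsub>P\<^esub>}" by simp
    qed
    then have "T \<subseteq> lin_span R P {}" by (auto simp: lin_span_def)
    then show ?case by blast
  next
    case (insert x X)
    note T = insert.prems(2)
    note T' = P.submoduleE[OF T]
    have x: "x \<in> \<Lambda>" using insert.prems(1) by simp
    have T0: "\<zero>\<^bsub>P\<^esub> \<in> T"
      using subgroup.one_closed[OF submodule.axioms(1)[OF T]] by simp
    have TP: "v \<in> carrier P" if "v \<in> T" for v using T'(1) that by blast
    let ?J = "(\<lambda>v. v x) ` T"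
    have "submodule ?J R (regular_module R)"
    proof (rule module.submoduleI[OF M])
      show "?J \<subseteq> carrier (regular_module R)" using vR[OF TP x] by (auto simp: ideal_module_def)
      show "\<zero>\<^bsub>regular_module R\<^esub> \<in> ?J"
        using T0 ev(2)[OF x] by (auto simp: ideal_module_def intro!: image_eqI[of _ _ "\<zero>\<^bsub>P\<^esub>"])
      show add: "p \<oplus>\<^bsub>regular_module R\<^esub> q \<in> ?J" if pq: "p \<in> ?J" "q \<in> ?J" for p q
      proof -
        obtain v w where "v \<in> T" "w \<in> T" "p = v x" "q = w x" using pq by blast
        then show ?thesis using T'(5) ev(1)[OF x]
          by (auto simp: ideal_module_def intro!: image_eqI[of _ _ "v \<oplus>\<^bsub>P\<^esub> w"])
      qed
      show sm: "b \<odot>\<^bsub>regular_module R\<^esub> p \<in> ?J" if bp: "b \<in> carrier R" "p \<in> ?J" for b p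
      proof -
        obtain v where "v \<in> T" "p = v x" using bp by blast
        then show ?thesis using T'(4) ev(3)[OF x] bp(1)
          by (auto simp: ideal_module_def intro!: image_eqI[of _ _ "b \<odot>\<^bsub>P\<^esub> v"])
      qed
      interpret M: module R "regular_module R" by (rule M)
      show "\<ominus>\<^bsub>regular_module R\<^esub> p \<in> ?J" if "p \<in> ?J" for p
      proof -
        have "p \<in> carrier (regular_module R)" using that vR[OF TP x] by (auto simp: ideal_module_def)
        then show ?thesis using sm[OF _ that, of "\<ominus>\<^bsub>R\<^esub> \<one>\<^bsub>R\<^esub>"] by (simp add: M.smult_l_minus)
      qed
    qed
    from noetherian_ring.finetely_gen[OF noeth R.submodule_regular_ideal[OF this]]
    obtain A where A: "A \<subseteq> carrier R" "finite A" "?J = Idl\<^bsub>R\<^esub> A" by blast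
    have "\<forall>b\<in>A. \<exists>v. v \<in> T \<and> v x = b"
      using R.genideal_self[OF A(1)] unfolding A(3)[symmetric] by blast
    then obtain w where w: "\<And>b. b \<in> A \<Longrightarrow> w b \<in> T" "\<And>b. b \<in> A \<Longrightarrow> w b x = b"
      using bchoice[of A "\<lambda>b v. v \<in> T \<and> v x = b"] by blast
    define T1 where "T1 = {v \<in> T. v x = \<zero>\<^bsub>R\<^esub>}"
    have "submodule T1 R P"
    proof (rule P.submoduleI)
      show "\<ominus>\<^bsub>P\<^esub> v \<in> T1" if "v \<in> T1" for v
      proof -
        have "\<ominus>\<^bsub>P\<^esub> v = (\<ominus>\<^bsub>R\<^esub> \<one>\<^bsub>R\<^esub>) \<odot>\<^bsub>P\<^esub> v" using that TP by (simp add: T1_def P.smult_l_minus)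
        then show ?thesis using that T'(4) ev(3)[OF x] by (simp add: T1_def)
      qed
    qed (use T0 T'(4,5) TP ev[OF x] in \<open>auto simp: T1_def\<close>)
    moreover have "v i = \<zero>\<^bsub>R\<^esub>" if "v \<in> T1" "i \<in> \<Lambda> - X" for v i
      using that insert.prems(3)[of v i] by (auto simp: T1_def)
    ultimately obtain F where F: "finite F" "F \<subseteq> T1" "T1 \<subseteq> lin_span R P F"
      using insert.IH[of T1] insert.prems(1) by blast
    let ?F = "F \<union> w ` A"
    have finF: "finite ?F" and FT: "?F \<subseteq> T" using F A(2) w(1) by (auto simp: T1_def)
    have FP: "?F \<subseteq> carrier P" using FT TP by blast
    note span = lin_span_submodule[OF P finF FP] and sup = lin_span_superset[OF P finF FP]
    note span' = P.submoduleE[OF span]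
    have T1F: "T1 \<subseteq> lin_span R P ?F"
      using lin_span_least[OF P span F(1)] F(3) sup by blast
    have "v \<in> lin_span R P ?F" if v: "v \<in> T" for v
    proof -
      have "v x \<in> lin_span R (regular_module R) A"
        using R.genideal_lin_span[OF A(2,1)] v unfolding A(3)[symmetric] by blast
      then obtain c where c: "c \<in> A \<rightarrow> carrier R"
        and vx: "v x = (\<Oplus>\<^bsub>regular_module R\<^esub>b\<in>A. c b \<odot>\<^bsub>regular_module R\<^esub> b)" by (rule lin_spanE)
      let ?s = "\<Oplus>\<^bsub>P\<^esub>b\<in>A. c b \<odot>\<^bsub>P\<^esub> w b"
      have sT: "?s \<in> T" using w(1) by (intro submodule_lincomb[OF P T A(2) c]) blast
      have sF: "?s \<in> lin_span R P ?F"
        using sup by (intro submodule_lincomb[OF P span A(2) c]) blast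
      have "w \<in> A \<rightarrow> carrier P" using w(1) TP by blast
      then have "?s x = (\<Oplus>\<^bsub>regular_module R\<^esub>b\<in>A. c b \<odot>\<^bsub>regular_module R\<^esub> w b x)"
        unfolding P_def by (rule mod_hom_lincomb[OF P[unfolded P_def] M proj_hom[OF x] c])
      also have "\<dots> = v x"
        unfolding vx
        by (rule abelian_monoid.finsum_cong'[OF abelian_group.axioms(1)[OF module.axioms(2)[OF M]]])
          (use c w A(1) in \<open>auto simp: ideal_module_def\<close>)
      finally have sx: "?s x = v x" .
      \<comment> \<open>Subtracting \<open>?s\<close> clears the \<open>x\<close>-coordinate of \<open>v\<close>.\<close>
      let ?t = "v \<oplus>\<^bsub>P\<^esub> (\<ominus>\<^bsub>R\<^esub> \<one>\<^bsub>R\<^esub>) \<odot>\<^bsub>P\<^esub> ?s"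
      have "?t x = \<zero>\<^bsub>R\<^esub>"
        using vR[OF TP[OF v] x] by (simp add: ev[OF x] sx R.l_minus R.r_neg)
      moreover have "?t \<in> T" using T'(4,5) v sT by simp
      ultimately have "?t \<in> lin_span R P ?F" using T1F by (auto simp: T1_def)
      then have "?t \<oplus>\<^bsub>P\<^esub> ?s \<in> lin_span R P ?F" using sF span'(5) by blast
      moreover have "?t \<oplus>\<^bsub>P\<^esub> ?s = v"
        using TP[OF v] TP[OF sT] by (simp add: P.smult_l_minus P.M.a_assoc P.M.l_neg)
      ultimately show ?thesis by simp
    qed
    then show ?case using finF FT by blast
  qed
qed

text \<open>
The syzygies of a finite generating set \<open>A\<close> form a submodule of \<open>R\<^sup>A\<close>, and generators of that
submodule are the relations.
\<close>

lemma noetherian_ideal_presentation: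
  fixes R :: "('r, 's) ring_scheme"
  assumes R: "cring R" and noeth: "noetherian_ring R" and I: "ideal I R"
  obtains A F where "finite_presentation R (ideal_module R I) A (\<lambda>x. x) F (\<lambda>v. v)"
proof -
  interpret R: cring R by fact
  let ?U = "ideal_module R I" and ?M = "regular_module R"
  have U: "module R ?U" by (rule ideal_module_module[OF R I])
  have M: "module R ?M" by (rule ideal_module_module[OF R R.oneideal])
  interpret U: module R ?U by fact
  interpret M: module R ?M by fact
  obtain A where A: "A \<subseteq> carrier R" "finite A" "I = Idl\<^bsub>R\<^esub> A"
    using noetherian_ring.finetely_gen[OF noeth I] by blast
  have AU: "(\<lambda>x. x) \<in> A \<rightarrow> carrier ?U"
    using R.genideal_self[OF A(1)] A(3) by (auto simp: ideal_module_def)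
  have incl: "(\<lambda>x. x) \<in> mod_hom R ?U ?M"
    using ideal.Icarr[OF I] by (auto simp: mod_hom_def ideal_module_def)
  let ?P = "direct_product A (\<lambda>_. ?M)"
  have P: "module R ?P" by (intro direct_product_module R M)
  interpret P: module R ?P by fact
  let ?s = "\<lambda>c. \<Oplus>\<^bsub>?U\<^esub>x\<in>A. c x \<odot>\<^bsub>?U\<^esub> x"
  define T where "T = {c \<in> carrier ?P. ?s c = \<zero>\<^bsub>?U\<^esub>}"
  have Pc: "c \<in> A \<rightarrow> carrier R" if "c \<in> carrier ?P" for c
    using that by (auto simp: direct_product_def ideal_module_def)
  have s_cong: "?s c = ?s d" if "\<And>x. x \<in> A \<Longrightarrow> c x = d x" "d \<in> A \<rightarrow> carrier R" for c d
    using that AU by (intro U.M.finsum_cong') (auto simp: Pi_iff)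
  have sm: "b \<odot>\<^bsub>?P\<^esub> c \<in> T" if b: "b \<in> carrier R" and c: "c \<in> T" for b c
  proof -
    have cA: "c \<in> A \<rightarrow> carrier R" using c Pc by (simp add: T_def)
    have "?s (b \<odot>\<^bsub>?P\<^esub> c) = ?s (\<lambda>x. b \<otimes>\<^bsub>R\<^esub> c x)"
      using b cA by (intro s_cong) (auto simp: direct_product_def ideal_module_def)
    also have "\<dots> = b \<odot>\<^bsub>?U\<^esub> ?s c"
      by (rule U.lincomb_smult_left[OF A(2) b cA AU])
    finally show ?thesis using b c by (simp add: T_def)
  qed
  have T: "submodule T R ?P"
  proof (rule P.submoduleI)
    show TP: "T \<subseteq> carrier ?P" by (auto simp: T_def)
    have "?s \<zero>\<^bsub>?P\<^esub> = ?s (\<lambda>_. \<zero>\<^bsub>R\<^esub>)"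
      by (rule s_cong) (auto simp: direct_product_def ideal_module_def)
    also have "\<dots> = \<zero>\<^bsub>?U\<^esub>" using AU by (intro U.M.add.finprod_one_eqI) (auto simp: Pi_iff)
    finally show "\<zero>\<^bsub>?P\<^esub> \<in> T" by (simp add: T_def)
    show "c \<oplus>\<^bsub>?P\<^esub> d \<in> T" if "c \<in> T" "d \<in> T" for c d
    proof -
      have cd: "c \<in> A \<rightarrow> carrier R" "d \<in> A \<rightarrow> carrier R" using that Pc by (auto simp: T_def)
      have "?s (c \<oplus>\<^bsub>?P\<^esub> d) = ?s (\<lambda>x. c x \<oplus>\<^bsub>R\<^esub> d x)"
        using cd by (intro s_cong) (auto simp: direct_product_def ideal_module_def)
      also have "\<dots> = ?s c \<oplus>\<^bsub>?U\<^esub> ?s d" by (rule U.lincomb_add_left[OF cd AU])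
      finally show ?thesis using that by (simp add: T_def)
    qed
    show "\<ominus>\<^bsub>?P\<^esub> c \<in> T" if "c \<in> T" for c
      using sm[OF _ that, of "\<ominus>\<^bsub>R\<^esub> \<one>\<^bsub>R\<^esub>"] that TP by (auto simp: P.smult_l_minus)
  qed (rule sm)
  obtain F where F: "finite F" "F \<subseteq> T" "T \<subseteq> lin_span R ?P F"
    using noetherian_submodule_finitely_generated[OF R noeth A(2) subset_refl T] by blast
  have "finite_presentation R ?U A (\<lambda>x. x) F (\<lambda>v. v)"
  proof (intro finite_presentation.intro finite_presentation_axioms.intro U A(2) F(1) AU)
    show "v \<in> A \<rightarrow> carrier R" if "v \<in> F" for v
      using that F(2) Pc by (auto simp: T_def)
    show "?s v = \<zero>\<^bsub>?U\<^esub>" if "v \<in> F" for v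
      using that F(2) by (auto simp: T_def)
    show "\<exists>c\<in>A \<rightarrow> carrier R. u = ?s c" if "u \<in> carrier ?U" for u
    proof -
      have "u \<in> lin_span R ?M A"
        using that R.genideal_lin_span[OF A(2,1)] A(3) by (auto simp: ideal_module_def)
      then obtain c where c: "c \<in> A \<rightarrow> carrier R" "u = (\<Oplus>\<^bsub>?M\<^esub>x\<in>A. c x \<odot>\<^bsub>?M\<^esub> x)" by (rule lin_spanE)
      then have "u = ?s c" using mod_hom_lincomb[OF U M incl c(1) AU] by simp
      then show ?thesis using c(1) by blast
    qed
    fix c assume c: "c \<in> A \<rightarrow> carrier R" "?s c = \<zero>\<^bsub>?U\<^esub>"
    have "?s (restrict c A) = ?s c" by (rule s_cong) (use c in auto)
    then have "restrict c A \<in> T"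
      using c by (auto simp: T_def direct_product_def ideal_module_def)
    then have "restrict c A \<in> lin_span R ?P F" using F(3) by blast
    then obtain d where d: "d \<in> F \<rightarrow> carrier R"
      "restrict c A = (\<Oplus>\<^bsub>?P\<^esub>v\<in>F. d v \<odot>\<^bsub>?P\<^esub> v)" by (rule lin_spanE)
    have FP: "(\<lambda>v. v) \<in> F \<rightarrow> carrier ?P" using F(2) by (auto simp: T_def)
    have "c x = (\<Oplus>\<^bsub>R\<^esub>v\<in>F. d v \<otimes>\<^bsub>R\<^esub> v x)" if x: "x \<in> A" for x
    proof -
      have "c x = restrict c A x" using x by simp
      also have "\<dots> = (\<Oplus>\<^bsub>?M\<^esub>v\<in>F. d v \<odot>\<^bsub>?M\<^esub> v x)"
        unfolding d(2) by (rule mod_hom_lincomb[OF P M proj_hom[OF x] d(1) FP])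
      also have "\<dots> = (\<Oplus>\<^bsub>R\<^esub>v\<in>F. d v \<otimes>\<^bsub>R\<^esub> v x)"
        unfolding finsum_regular by (simp add: ideal_module_def)
      finally show ?thesis .
    qed
    then show "\<exists>d\<in>F \<rightarrow> carrier R. \<forall>x\<in>A. c x = (\<Oplus>\<^bsub>R\<^esub>v\<in>F. d v \<otimes>\<^bsub>R\<^esub> v x)"
      using d(1) by blast
  qed
  then show thesis by (rule that)
qed

section \<open>The dual pair\<close>

theorem mainTheorem7:
  fixes R :: "'r ring" and m I :: "'r set" and E :: "('r, 'e) module"
  assumes "noetherian_ring R" and "local_ring R m"
    and "ideal I R"
    and "injective_hull R (quotient_module R m) E"
  shows
    "(\<forall>N :: ('r, 'n) module. module R N \<longrightarrow>
        (I_dual_cogenerated R E I N \<longleftrightarrow> I_generated R I (matlis_dual R E N))) \<and>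
     (\<forall>M :: ('r, 'm) module. module R M \<longrightarrow>
        (I_generated R I M \<longleftrightarrow> I_dual_cogenerated R E I (matlis_dual R E M))) \<and>
     (\<forall>(N :: ('r, 'a) module) (A :: ('r, 'b) module) (B :: ('r, 'c) module) f.
        module R N \<and> module R A \<and> module R B \<and> f \<in> mod_iso R N (binary_sum A B) \<and>
        I_dual_cogenerated R E I N \<longrightarrow> I_dual_cogenerated R E I A) \<and>
     (\<forall>(M :: ('r, 'a) module) (A :: ('r, 'b) module) (B :: ('r, 'c) module) f.
        module R M \<and> module R A \<and> module R B \<and> f \<in> mod_iso R M (binary_sum A B) \<and>
        I_generated R I M \<longrightarrow> I_generated R I A) \<and>
     (\<forall>(\<Lambda> :: 'i set) (N :: 'i \<Rightarrow> ('r, 'd) module).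
        (\<forall>i \<in> \<Lambda>. module R (N i) \<and> I_dual_cogenerated R E I (N i)) \<longrightarrow>
        I_dual_cogenerated R E I (direct_product \<Lambda> N)) \<and>
     (\<forall>(\<Lambda> :: 'i set) (M :: 'i \<Rightarrow> ('r, 'd) module).
        (\<forall>i \<in> \<Lambda>. module R (M i) \<and> I_generated R I (M i)) \<longrightarrow>
        I_generated R I (direct_product \<Lambda> M))"
proof -
  have R: "cring R" using assms(2) by (simp add: local_ring_def)
  have inj: "injective_module R E" using assms(4) by (simp add: injective_hull_def)
  then have E: "module R E" by (simp add: injective_module_def)
  let ?U = "ideal_module R I" and ?V = "matlis_dual R E (ideal_module R I)"
  have U: "module R ?U" by (rule ideal_module_module[OF R assms(3)])
  have V: "module R ?V" by (rule hom_module_module[OF U E])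
  obtain A F where fp: "finite_presentation R ?U A (\<lambda>x. x) F (\<lambda>v. v)"
    using noetherian_ideal_presentation[OF R assms(1,3)] by blast
  interpret U: finite_presentation R ?U A "\<lambda>x. x" F "\<lambda>v. v" by (rule fp)
  show ?thesis
    unfolding I_generated_def I_dual_cogenerated_def
  proof (intro conjI allI impI)
    fix N :: "('r, 'n) module" assume N: "module R N"
    show "cogenerated_by R ?V N \<longleftrightarrow> generated_by R ?U (matlis_dual R E N)"
      using U.dual_generated_if_cogenerated[OF inj N]
        cogenerated_if_dual_generated[OF assms(2,4) U N] by blast
  next
    fix M :: "('r, 'm) module" assume M: "module R M"
    show "generated_by R ?U M \<longleftrightarrow> cogenerated_by R ?V (matlis_dual R E M)"
      using U.generated_if_dual_cogenerated[OF assms(2,4) M]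
        dual_cogenerated_if_generated[OF U M E] by blast
  next
    fix N :: "('r, 'a) module" and A :: "('r, 'b) module" and B :: "('r, 'c) module" and f
    assume "module R N \<and> module R A \<and> module R B \<and> f \<in> mod_iso R N (binary_sum A B) \<and>
      cogenerated_by R ?V N"
    then show "cogenerated_by R ?V A"
      using cogenerated_mono[OF _ _ V summand_inclusion] by blast
  next
    fix M :: "('r, 'a) module" and A :: "('r, 'b) module" and B :: "('r, 'c) module" and f
    assume "module R M \<and> module R A \<and> module R B \<and> f \<in> mod_iso R M (binary_sum A B) \<and>
      generated_by R ?U M"
    then show "generated_by R ?U A"
      using generated_epi[OF U _ _ summand_projection] by blast
  next
    fix \<Lambda> :: "'i set" and N :: "'i \<Rightarrow> ('r, 'd) module"
    assume "\<forall>i\<in>\<Lambda>. module R (N i) \<and> cogenerated_by R ?V (N i)"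
    then show "cogenerated_by R ?V (direct_product \<Lambda> N)"
      by (intro cogenerated_product[OF R V]) auto
  next
    fix \<Lambda> :: "'i set" and M :: "'i \<Rightarrow> ('r, 'd) module"
    assume "\<forall>i\<in>\<Lambda>. module R (M i) \<and> generated_by R ?U (M i)"
    then show "generated_by R ?U (direct_product \<Lambda> M)"
      by (intro U.generated_product) auto
  qed
qed

end
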